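(* Let $N\ge 1$, $\mu\ge 0$, $m\ge 0$, $p>1$, and let $\Omega^c=\mathbb{R}^N\setminus B_1(0)$. Assume that $(u_0,u_1)\in H^1(\Omega^c)\times L^2(\Omega^c)$ satisfy: $u_0\ge 0$ and $u_1\ge 0$ a.e.; $u_0(x)=u_1(x)=0$ for $|x|>R$, for some $R>1$; $u_0\not\equiv 0$ and $u_1\not\equiv 0$. Assume that $p$ lies in the following range: - if $N\ge 2$: $1<p\le p_T\big(N+\tfrac{\mu}{m+1},m\big)$; - if $N=1$: $1<p<p_{\mu,m}$, or $\mu>m$ and $p=1+\tfrac{2}{\mu-m}$, where $p_{\mu,m}:=1+\frac{2}{\mu-m}$ if $\mu>m$ and $p_{\mu,m}:=\infty$ if $\mu\le m$. Then there exist $\varepsilon_0=\varepsilon_0(u_0,u_1,N,R,p,m,\mu)>0$ and a constant $C>0$ independent of $\varepsilon$ such that for every $0<\varepsilon\le\varepsilon_0$ the weak solution $u$ of the initial boundary value problem $$\begin{cases} u_{tt}-t^{2m}\Delta u+\frac{\mu}{t}u_t=|u_t|^p & \text{in } \Omega^c\times[1,\infty),\\ u(x,1)=\varepsilon u_0(x),\quad u_t(x,1)=\varepsilon u_1(x), & x\in\Omega^c,\\ u(x,t)=0, & |x|=1,\ t\ge 1,\end{cases}$$ satisfying $\operatorname{supp}(u)\subset\{(x,t)\in\Omega^c\times[1,\infty): |x|\le R+\phi_m(t)\}$, blows up in finite time $T_\varepsilon$. Moreover, for $N\ge 2$, $$T_\varepsilon\le\begin{cases} C\,\varepsilon^{-\frac{2(p-1)}{2-((1+m)(N-1)-m+\mu)(p-1)}}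 & \text{if } 1<p<p_T\big(N+\tfrac{\mu}{m+1},m\big),\\ \exp\big(C\varepsilon^{-(p-1)}\big) & \text{if } p=p_T\big(N+\tfrac{\mu}{m+1},m\big),\end{cases}$$ and for $N=1$, $$T_\varepsilon\le\begin{cases} C\,\varepsilon^{-\frac{2(p-1)}{2-(\mu-m)(p-1)}} & \text{if } 1<p<p_{\mu,m},\\ \exp\big(C\varepsilon^{-(p-1)}\big) & \text{if } \mu>m \text{ and } p=1+\frac{2}{\mu-m}.\end{cases}$$
   Context: $B_r(0)=\{x\in\mathbb{R}^N:|x|<r\}$. Set $\phi_m(t):=\frac{t^{1+m}}{1+m}$, and for real $\nu$ with $(m+1)(\nu-1)-m>0$ set $p_T(\nu,m):=1+\frac{2}{(m+1)(\nu-1)-m}$. Weak solution: $u$ is a weak solution of the problem on $[1,T)$, $T\in(1,\infty]$, if $u\in\mathcal{C}([1,T),H^1(\Omega^c))\cap\mathcal{C}^1([1,T),L^2(\Omega^c))$, $u_t\in L^p_{loc}((1,T)\times\Omega^c)$, $u(\cdot,t)$ has zero trace on $\{|x|=1\}$ for every $t$, $u(\cdot,1)=\varepsilon u_0$ in $H^1(\Omega^c)$, $u_t(\cdot,1)=\varepsilon u_1$, and for all $\Phi\in\mathcal{C}_0^\infty(\Omega^c\times[1,T))$ vanishing on $\{|x|=1\}$ and all $t\in[1,T)$, $$\int_{\Omega^c}u_t(x,t)\Phi(x,t)dx-\int_{\Omega^c}u_t(x,1)\Phi(x,1)dx-\int_1^t\!\int_{\Omega^c}u_t\Phi_t\,dx\,ds+\int_1^t\!\int_{\Omega^c}s^{2m}\nabla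 u\cdot\nabla\Phi\,dx\,ds+\int_1^t\!\int_{\Omega^c}\frac{\mu}{s}u_t\Phi\,dx\,ds=\int_1^t\!\int_{\Omega^c}|u_t|^p\Phi\,dx\,ds.$$ $T_\varepsilon$ denotes the lifespan of $u$, i.e. the supremum of all $T$ such that a weak solution with the stated support property (for times in $[1,T)$) exists on $[1,T)$. "Blows up in finite time" means $T_\varepsilon<\infty$. *)

theory Defs
  imports "HOL-Analysis.Analysis"
begin

section \<open>Smooth functions and gradients\<close>

primrec C_k :: "nat \<Rightarrow> ('a::real_normed_vector \<Rightarrow> real) \<Rightarrow> bool" where
  "C_k 0 f \<longleftrightarrow> continuous_on UNIV f"
| "C_k (Suc k) f \<longleftrightarrow>
     (\<forall>x. f differentiable (at x)) \<and> (\<forall>v. C_k k (\<lambda>x. frechet_derivative f (at x) v))"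

definition smooth :: "('a::real_normed_vector \<Rightarrow> real) \<Rightarrow> bool" where
  "smooth f \<longleftrightarrow> (\<forall>k. C_k k f)"

text \<open>Smooth functions with compact support in \<open>S\<close>. The set \<open>S\<close> need not be open: functions that
  are smooth up to a boundary contained in \<open>S\<close> are represented by a smooth extension to the whole
  space, and only the values on \<open>S\<close> matter.\<close>

definition C0_infty :: "'a::real_normed_vector set \<Rightarrow> ('a \<Rightarrow> real) set" where
  "C0_infty S = {\<phi>. smooth \<phi> \<and> (\<exists>K. compact K \<and> K \<subseteq> S \<and> (\<forall>x\<in>S - K. \<phi> x = 0))}"

definition grad :: "('a::euclidean_space \<Rightarrow> real) \<Rightarrow> 'a \<Rightarrow> 'a" where
  "grad f x = (\<Sum>b\<in>Basis. frechet_derivative f (at x) b *\<^sub>R b)"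


section \<open>Function spaces on the exterior of the unit ball\<close>

text \<open>The space \<open>\<real>\<^sup>N\<close> is a Euclidean space \<open>'a\<close> with \<open>N = DIM('a)\<close>. Elements of \<open>L\<^sup>2\<close> and \<open>H\<^sup>1\<close> are
  represented by functions; their equality is equality almost everywhere.\<close>

definition Ext :: "'a::euclidean_space set" where
  "Ext = UNIV - ball 0 1"

abbreviation LExt :: "'a::euclidean_space measure" where
  "LExt \<equiv> lebesgue_on Ext"

definition L2 :: "('a::euclidean_space \<Rightarrow> 'b::euclidean_space) set" where
  "L2 = {f. f \<in> borel_measurable LExt \<and> integrable LExt (\<lambda>x. (norm (f x))\<^sup>2)}"

definition L2_norm :: "('a::euclidean_space \<Rightarrow> 'b::euclidean_space) \<Rightarrow> real" where
  "L2_norm f = sqrt (\<integral>x. (norm (f x))\<^sup>2 \<partial>LExt)"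

definition has_weak_grad :: "('a::euclidean_space \<Rightarrow> real) \<Rightarrow> ('a \<Rightarrow> 'a) \<Rightarrow> bool" where
  "has_weak_grad f G \<longleftrightarrow>
     (\<forall>\<phi>\<in>C0_infty (interior Ext). \<forall>b\<in>Basis.
        (\<integral>x. f x * (grad \<phi> x \<bullet> b) \<partial>LExt) = - (\<integral>x. (G x \<bullet> b) * \<phi> x \<partial>LExt))"

definition H1 :: "('a::euclidean_space \<Rightarrow> real) set" where
  "H1 = {f \<in> L2. \<exists>G\<in>L2. has_weak_grad f G}"

text \<open>Weak gradients are unique up to null sets, so the choice is immaterial.\<close>

definition weak_grad :: "('a::euclidean_space \<Rightarrow> real) \<Rightarrow> 'a \<Rightarrow> 'a" where
  "weak_grad f = (SOME G. G \<in> L2 \<and> has_weak_grad f G)"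

definition H1_norm :: "('a::euclidean_space \<Rightarrow> real) \<Rightarrow> real" where
  "H1_norm f = sqrt ((L2_norm f)\<^sup>2 + (L2_norm (weak_grad f))\<^sup>2)"

text \<open>Surface measure of the unit sphere: \<open>N\<close> times the volume of the cone over a set. For
  \<open>N = 1\<close> it is the counting measure on \<open>{-1, 1}\<close>. Note that \<^term>\<open>sgn x = x /\<^sub>R norm x\<close>.\<close>

definition sphere_measure :: "'a::euclidean_space measure" where
  "sphere_measure =
     scale_measure (of_nat DIM('a)) (distr (restrict_space lborel (ball 0 1)) borel sgn)"

text \<open>The trace on \<open>{|x| = 1}\<close>, as the continuous extension of the restriction map from
  functions smooth up to the boundary to \<open>H\<^sup>1\<close>.\<close>

definition has_trace :: "('a::euclidean_space \<Rightarrow> real) \<Rightarrow> ('a \<Rightarrow> real) \<Rightarrow> bool" where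
  "has_trace f g \<longleftrightarrow>
     g \<in> borel_measurable borel \<and> integrable sphere_measure (\<lambda>x. (g x)\<^sup>2) \<and>
     (\<exists>w. (\<forall>k::nat. w k \<in> C0_infty Ext) \<and>
          (\<lambda>k. H1_norm (\<lambda>x. f x - w k x)) \<longlonglongrightarrow> 0 \<and>
          (\<lambda>k. \<integral>x. (w k x - g x)\<^sup>2 \<partial>sphere_measure) \<longlonglongrightarrow> 0)"


section \<open>Weak solutions and lifespan\<close>

definition phi_m :: "real \<Rightarrow> real \<Rightarrow> real" where
  "phi_m m t = t powr (1 + m) / (1 + m)"

definition p_T :: "real \<Rightarrow> real \<Rightarrow> real" where
  "p_T \<nu> m = 1 + 2 / ((m + 1) * (\<nu> - 1) - m)"

definition p_crit1 :: "real \<Rightarrow> real \<Rightarrow> ereal" where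
  "p_crit1 \<mu> m = (if \<mu> > m then ereal (1 + 2 / (\<mu> - m)) else \<infinity>)"

definition Ico :: "ereal \<Rightarrow> real set" where
  "Ico T = {t. 1 \<le> t \<and> ereal t < T}"

definition C_H1 :: "ereal \<Rightarrow> (real \<Rightarrow> 'a::euclidean_space \<Rightarrow> real) \<Rightarrow> bool" where
  "C_H1 T u \<longleftrightarrow> (\<forall>t\<in>Ico T. u t \<in> H1 \<and>
     ((\<lambda>s. H1_norm (\<lambda>x. u s x - u t x)) \<longlongrightarrow> 0) (at t within Ico T))"

definition C_L2 :: "ereal \<Rightarrow> (real \<Rightarrow> 'a::euclidean_space \<Rightarrow> real) \<Rightarrow> bool" where
  "C_L2 T v \<longleftrightarrow> (\<forall>t\<in>Ico T. v t \<in> L2 \<and>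
     ((\<lambda>s. L2_norm (\<lambda>x. v s x - v t x)) \<longlongrightarrow> 0) (at t within Ico T))"

text \<open>\<open>v\<close> is the (continuous) derivative of the curve \<open>u\<close> in \<open>L\<^sup>2\<close>.\<close>

definition C1_L2 ::
  "ereal \<Rightarrow> (real \<Rightarrow> 'a::euclidean_space \<Rightarrow> real) \<Rightarrow> (real \<Rightarrow> 'a \<Rightarrow> real) \<Rightarrow> bool" where
  "C1_L2 T u v \<longleftrightarrow> C_L2 T u \<and> C_L2 T v \<and>
     (\<forall>t\<in>Ico T. ((\<lambda>s. L2_norm (\<lambda>x. (u s x - u t x) / (s - t) - v t x)) \<longlongrightarrow> 0)
        (at t within Ico T))"

definition Lp_loc :: "real \<Rightarrow> (real \<times> 'a::euclidean_space) set \<Rightarrow> (real \<times> 'a \<Rightarrow> real) set" where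
  "Lp_loc p S = {f. f \<in> borel_measurable (lebesgue_on S) \<and>
     (\<forall>K. compact K \<and> K \<subseteq> S \<longrightarrow> integrable (lebesgue_on K) (\<lambda>z. \<bar>f z\<bar> powr p))}"

text \<open>In \<open>weak_solution\<close>, \<open>v\<close> is \<open>u\<^sub>t\<close>; representing it by a jointly measurable function
  (implied by membership in \<^const>\<open>Lp_loc\<close>) is no restriction. Since the Bochner integral of a
  non-integrable function is \<open>0\<close>, and local integrability in \<open>(1, T)\<close> says nothing about times near
  \<open>1\<close>, the existence of the integral of the nonlinear term is made explicit. The other
  integrals exist by the regularity of \<open>u\<close> and \<open>v\<close>.\<close>

definition weak_solution ::
  "real \<Rightarrow> real \<Rightarrow> real \<Rightarrow> real \<Rightarrow> ('a::euclidean_space \<Rightarrow> real) \<Rightarrow> ('a \<Rightarrow> real) \<Rightarrow>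
   ereal \<Rightarrow> (real \<Rightarrow> 'a \<Rightarrow> real) \<Rightarrow> bool" where
  "weak_solution m \<mu> p \<epsilon> u0 u1 T u \<longleftrightarrow>
     C_H1 T u \<and>
     (\<forall>t\<in>Ico T. has_trace (u t) (\<lambda>_. 0)) \<and>
     (AE x in LExt. u 1 x = \<epsilon> * u0 x) \<and>
     (\<exists>v. C1_L2 T u v \<and>
          (\<lambda>(t, x). v t x) \<in> Lp_loc p ({t. 1 < t \<and> ereal t < T} \<times> Ext) \<and>
          (AE x in LExt. v 1 x = \<epsilon> * u1 x) \<and>
          (\<forall>\<Phi> \<in> C0_infty (Ext \<times> Ico T).
             (\<forall>x. \<forall>t\<in>Ico T. norm x = 1 \<longrightarrow> \<Phi> (x, t) = 0) \<longrightarrow>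
             (\<forall>t\<in>Ico T.
                integrable (lebesgue_on ({1..t} \<times> Ext)) (\<lambda>(s, x). \<bar>v s x\<bar> powr p * \<Phi> (x, s)) \<and>
                (\<integral>x. v t x * \<Phi> (x, t) \<partial>LExt)
                - (\<integral>x. v 1 x * \<Phi> (x, 1) \<partial>LExt)
                - (LINT s:{1..t}|lebesgue. (\<integral>x. v s x * deriv (\<lambda>\<tau>. \<Phi> (x, \<tau>)) s \<partial>LExt))
                + (LINT s:{1..t}|lebesgue.
                     (\<integral>x. s powr (2 * m) * (weak_grad (u s) x \<bullet> grad (\<lambda>y. \<Phi> (y, s)) x) \<partial>LExt))
                + (LINT s:{1..t}|lebesgue. (\<integral>x. \<mu> / s * v s x * \<Phi> (x, s) \<partial>LExt))
                = (LINT s:{1..t}|lebesgue. (\<integral>x. \<bar>v s x\<bar> powr p * \<Phi> (x, s) \<partial>LExt)))))"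

text \<open>\<open>supp u \<subseteq> {(x, t). |x| \<le> R + \<phi>\<^sub>m t}\<close> for times in \<open>[1, T)\<close>. As the right-hand side is closed, this
  says that \<open>u\<close> vanishes almost everywhere off it; as \<open>u\<close> is continuous in time, at every time.\<close>

definition support_property ::
  "real \<Rightarrow> real \<Rightarrow> ereal \<Rightarrow> (real \<Rightarrow> 'a::euclidean_space \<Rightarrow> real) \<Rightarrow> bool" where
  "support_property m R T u \<longleftrightarrow>
     (\<forall>t\<in>Ico T. AE x in LExt. norm x > R + phi_m m t \<longrightarrow> u t x = 0)"

definition lifespan ::
  "real \<Rightarrow> real \<Rightarrow> real \<Rightarrow> real \<Rightarrow> real \<Rightarrow> ('a::euclidean_space \<Rightarrow> real) \<Rightarrow> ('a \<Rightarrow> real) \<Rightarrow> ereal" where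
  "lifespan m \<mu> p R \<epsilon> u0 u1 =
     Sup {T. 1 < T \<and> (\<exists>u. weak_solution m \<mu> p \<epsilon> u0 u1 T u \<and> support_property m R T u)}"

end

theory Submission
  imports Defs "HOL-Real_Asymp.Real_Asymp"
begin

text \<open>Testing the equation with a fixed function \<open>\<phi>\<close> of space turns it into a scalar problem. Choose
  \<open>\<phi>\<close> radial with \<open>\<Delta> \<phi> = \<phi>\<close>, \<open>\<phi> = 0\<close> on the unit sphere and \<open>\<phi> > 0\<close> outside; it is bounded by a
  multiple of \<open>exp r * r powr (- (N - 1) / 2)\<close>, \<open>r = |x|\<close>. Then \<open>U = \<integral> u \<phi>\<close> and \<open>V = \<integral> u\<^sub>t \<phi>\<close>
  satisfy \<open>U' = V\<close> and \<open>V' + (\<mu> / t) V - t powr (2 m) U = \<integral> |u\<^sub>t| powr p \<phi> \<ge> b(t) |V| powr p\<close>, the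
  inequality being Hoelder's on the support of \<open>u\<^sub>t\<close>. Solutions of the linear part grow like
  \<open>t powr ((m - \<mu>) / 2) * exp (phi_m m t)\<close>. Dividing \<open>V + (t powr m + (m + \<mu>) / (2 t)) U\<close> by this (up to a
  bounded factor) leaves \<open>w\<close> with \<open>w' \<ge> c t powr (- \<theta>) w powr p\<close> and \<open>w 1 \<ge> c \<epsilon>\<close>, where
  \<open>2 \<theta> = (p - 1) ((1 + m) (N - 1) - m + \<mu>)\<close>. Since \<open>\<theta> \<le> 1\<close> in the given range of \<open>p\<close>, \<open>w\<close> blows up,
  and integrating the inequality bounds the lifespan.\<close>

section \<open>Smooth functions on open sets\<close>

text \<open>The nonlinear term controls \<open>V\<close> alone, whereas the growing mode carries
  \<open>U\<close> as well. The gap is closed by \<open>V \<ge> \<kappa> * t powr m * U\<close>,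
  which the linear part propagates from time 1; positive pairings of both data provide
  \<open>\<kappa>\<close>. The factor \<open>r powr (- (N - 1) / 2)\<close> fixes
  \<open>\<theta>\<close>: the mass of \<open>\<phi>\<close> on
  \<open>|x| \<le> R + phi_m m t\<close> is of order
  \<open>t powr ((1 + m) * (N - 1) / 2) * exp (phi_m m t)\<close>, and its Hoelder power
  \<open>1 - p\<close> meets the same power of the weight in \<open>w\<close>. The exponentials
  cancel, the powers of \<open>t\<close> combine to \<open>t powr (- \<theta>)\<close>, and
  \<open>N = 1\<close> needs no separate formula. Two obstacles shape the rest. The support of
  \<open>\<phi>\<close> is unbounded and the origin is excluded, so \<open>\<phi>\<close> is cut off
  inside the unit ball and beyond the cone at the time considered; the profile then varies with
  time, while the constants must not. And the boundary condition is given by approximation in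
  \<open>H1\<close>, while weak gradients are tested away from the sphere, so Green's formula
  requires a boundary-layer argument.\<close>

primrec Ck_on :: "nat \<Rightarrow> 'a::real_normed_vector set \<Rightarrow> ('a \<Rightarrow> real) \<Rightarrow> bool" where
  "Ck_on 0 S f \<longleftrightarrow> continuous_on S f"
| "Ck_on (Suc k) S f \<longleftrightarrow>
     (\<exists>f'. (\<forall>x\<in>S. (f has_derivative f' x) (at x)) \<and> (\<forall>v. Ck_on k S (\<lambda>x. f' x v)))"

definition smooth_on :: "'a::real_normed_vector set \<Rightarrow> ('a \<Rightarrow> real) \<Rightarrow> bool" where
  "smooth_on S f \<longleftrightarrow> (\<forall>k. Ck_on k S f)"

lemma Ck_on_imp_continuous_on: "Ck_on k S f \<Longrightarrow> continuous_on S f"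
  by (cases k) (auto intro: has_derivative_continuous_on has_derivative_at_withinI)

lemma Ck_on_SucD: "Ck_on (Suc k) S f \<Longrightarrow> Ck_on k S f"
proof (induction k arbitrary: f)
  case 0
  then show ?case using Ck_on_imp_continuous_on by fastforce
next
  case (Suc k)
  then obtain f' where "\<forall>x\<in>S. (f has_derivative f' x) (at x)" "\<forall>v. Ck_on (Suc k) S (\<lambda>x. f' x v)"
    by (subst (asm) Ck_on.simps(2)) blast
  then show ?case using Suc.IH by (subst Ck_on.simps(2)) blast
qed

lemma Ck_on_subset: "Ck_on k T f \<Longrightarrow> S \<subseteq> T \<Longrightarrow> Ck_on k S f"
proof (induction k arbitrary: f)
  case 0
  then show ?case by (auto intro: continuous_on_subset)
next
  case (Suc k)
  then obtain f' where "\<forall>x\<in>T. (f has_derivative f' x) (at x)" "\<forall>v. Ck_on k T (\<lambda>x. f' x v)"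
    by auto
  then show ?case using Suc by (subst Ck_on.simps(2)) blast
qed

lemma Ck_on_cong:
  assumes "open S" "\<And>x. x \<in> S \<Longrightarrow> f x = g x"
  shows "Ck_on k S f \<longleftrightarrow> Ck_on k S g"
proof -
  have "Ck_on k S g" if "Ck_on k S f" "\<And>x. x \<in> S \<Longrightarrow> f x = g x" for f g
  proof (cases k)
    case 0
    then show ?thesis using that continuous_on_cong[of S S f g] by auto
  next
    case (Suc j)
    then show ?thesis using that
      by (auto intro: has_derivative_transform_within_open[OF _ assms(1)])
  qed
  from this[of f g] this[of g f] show ?thesis using assms by auto
qed

text \<open>On the overlap the two derivatives agree by uniqueness, so a case distinction glues them
  into one family to which the induction hypothesis applies on each set.\<close>

lemma Ck_on_Un:
  assumes "open S" "open T" "Ck_on k S f" "Ck_on k T f"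
  shows "Ck_on k (S \<union> T) f"
  using assms(3,4)
proof (induction k arbitrary: f)
  case 0
  then show ?case using assms by (auto intro: continuous_on_open_Un)
next
  case (Suc k)
  obtain f' where f': "\<forall>x\<in>S. (f has_derivative f' x) (at x)" "\<forall>v. Ck_on k S (\<lambda>x. f' x v)"
    using Suc by auto
  obtain g' where g': "\<forall>x\<in>T. (f has_derivative g' x) (at x)" "\<forall>v. Ck_on k T (\<lambda>x. g' x v)"
    using Suc by auto
  let ?h = "\<lambda>x. if x \<in> S then f' x else g' x"
  have eq: "?h x = g' x" if "x \<in> T" for x
    using f'(1)[rule_format, of x] g'(1)[rule_format, of x] that has_derivative_unique[of f _ x] by auto
  have "Ck_on k S (\<lambda>x. ?h x v)" "Ck_on k T (\<lambda>x. ?h x v)" for v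
  proof -
    show "Ck_on k S (\<lambda>x. ?h x v)"
      by (subst Ck_on_cong[OF assms(1), of _ "\<lambda>x. f' x v"]) (simp_all add: f'(2))
    show "Ck_on k T (\<lambda>x. ?h x v)"
      by (subst Ck_on_cong[OF assms(2), of _ "\<lambda>x. g' x v"]) (simp_all only: eq g'(2))
  qed
  then have "\<forall>v. Ck_on k (S \<union> T) (\<lambda>x. ?h x v)" using Suc.IH by blast
  then show ?case using f' g' by (subst Ck_on.simps(2), intro exI[of _ ?h]) auto
qed

lemma Ck_on_const: "Ck_on k S (\<lambda>x. c)"
proof (induction k arbitrary: c)
  case (Suc k)
  then show ?case by (subst Ck_on.simps(2), intro exI[of _ "\<lambda>x v. 0"]) auto
qed auto

lemma Ck_on_bounded_linear: "bounded_linear f \<Longrightarrow> Ck_on k S f"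
  by (cases k) (auto intro!: exI[of _ "\<lambda>x. f"] bounded_linear_imp_has_derivative Ck_on_const
     linear_continuous_on)

lemma Ck_on_add: "Ck_on k S f \<Longrightarrow> Ck_on k S g \<Longrightarrow> Ck_on k S (\<lambda>x. f x + g x)"
proof (induction k arbitrary: f g)
  case 0
  then show ?case by (auto intro: continuous_intros)
next
  case (Suc k)
  obtain f' where f': "\<forall>x\<in>S. (f has_derivative f' x) (at x)" "\<forall>v. Ck_on k S (\<lambda>x. f' x v)"
    using Suc by auto
  obtain g' where g': "\<forall>x\<in>S. (g has_derivative g' x) (at x)" "\<forall>v. Ck_on k S (\<lambda>x. g' x v)"
    using Suc by auto
  show ?case
    using f' g' Suc.IH
    by (subst Ck_on.simps(2), intro exI[of _ "\<lambda>x v. f' x v + g' x v"])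
      (auto intro: has_derivative_add)
qed

lemma Ck_on_mult: "Ck_on k S f \<Longrightarrow> Ck_on k S g \<Longrightarrow> Ck_on k S (\<lambda>x. f x * g x)"
proof (induction k arbitrary: f g)
  case 0
  then show ?case by (auto intro: continuous_intros)
next
  case (Suc k)
  obtain f' where f': "\<forall>x\<in>S. (f has_derivative f' x) (at x)" "\<forall>v. Ck_on k S (\<lambda>x. f' x v)"
    using Suc by auto
  obtain g' where g': "\<forall>x\<in>S. (g has_derivative g' x) (at x)" "\<forall>v. Ck_on k S (\<lambda>x. g' x v)"
    using Suc by auto
  have "Ck_on k S f" "Ck_on k S g" using Suc Ck_on_SucD by blast+
  then have "\<forall>v. Ck_on k S (\<lambda>x. f x * g' x v + f' x v * g x)"
    using Suc.IH f' g' by (auto intro!: Ck_on_add)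
  then show ?case
    using f' g' 
    by (subst Ck_on.simps(2), intro exI[of _ "\<lambda>x v. f x * g' x v + f' x v * g x"])
      (auto intro: has_derivative_mult)
qed

text \<open>By induction with the outer function arbitrary: the chain rule gives the derivative
  \<open>f' x v * h' (f x) 1\<close>, a product whose second factor is again such a composition, of
  lower order. Real outer functions suffice for the radial profiles and cutoffs below.\<close>

lemma Ck_on_compose:
  fixes h :: "real \<Rightarrow> real"
  assumes "Ck_on k T h" "Ck_on k S f" "f ` S \<subseteq> T"
  shows "Ck_on k S (\<lambda>x. h (f x))"
  using assms
proof (induction k arbitrary: h)
  case 0
  then show ?case by (auto intro: continuous_on_compose2)
next
  case (Suc k)
  obtain f' where f': "\<forall>x\<in>S. (f has_derivative f' x) (at x)" "\<forall>v. Ck_on k S (\<lambda>x. f' x v)"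
    using Suc by auto
  obtain h' where h': "\<forall>x\<in>T. (h has_derivative h' x) (at x)" "\<forall>v. Ck_on k T (\<lambda>x. h' x v)"
    using Suc by auto
  have "Ck_on k S f" using Suc Ck_on_SucD by blast
  then have "Ck_on k S (\<lambda>x. h' (f x) 1)" using Suc.IH[of "\<lambda>x. h' x 1"] h' Suc.prems by auto
  then have 1: "\<forall>v. Ck_on k S (\<lambda>x. f' x v * h' (f x) 1)" using f' by (auto intro: Ck_on_mult)
  have "((\<lambda>x. h (f x)) has_derivative (\<lambda>v. f' x v * h' (f x) 1)) (at x)" if "x \<in> S" for x
  proof -
    have h: "(h has_derivative h' (f x)) (at (f x))" using h' that Suc.prems by auto
    have "h' (f x) = (\<lambda>r. r * h' (f x) 1)"
      using linear_cmul[OF has_derivative_linear[OF h], of _ 1] by (metis mult.right_neutral real_scaleR_def)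
    with h have "(h has_derivative (\<lambda>r. r * h' (f x) 1)) (at (f x))" by simp
    then show ?thesis
      by (rule has_derivative_compose[OF f'(1)[rule_format, OF that]])
  qed
  with 1 show ?case
    by (subst Ck_on.simps(2), intro exI[of _ "\<lambda>x v. f' x v * h' (f x) 1"]) auto
qed

lemma Ck_on_Suc_real:
  fixes f :: "real \<Rightarrow> real"
  assumes "\<And>x. x \<in> S \<Longrightarrow> (f has_real_derivative d x) (at x)" "Ck_on k S d"
  shows "Ck_on (Suc k) S f"
  using assms by (subst Ck_on.simps(2), intro exI[of _ "\<lambda>x v. d x * v"])
    (auto simp: has_field_derivative_def Ck_on_const intro!: Ck_on_mult)

text \<open>\<open>Ck_on\<close> asks for some derivative at the points of \<open>S\<close> only,
  whereas \<open>C_k\<close> fixes the choice \<open>frechet_derivative\<close> on the whole space;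
  on \<open>UNIV\<close> they coincide because derivatives are unique. The local notion serves
  profiles that are smooth only on the positive half-line.\<close>

lemma C_k_iff_Ck_on: "C_k k f \<longleftrightarrow> Ck_on k UNIV f"
proof (induction k arbitrary: f)
  case 0
  show ?case by simp
next
  case (Suc k)
  show ?case (is "?L = ?R")
  proof
    assume ?L
    then show ?R using Suc
      by (subst Ck_on.simps(2), intro exI[of _ "\<lambda>x. frechet_derivative f (at x)"])
        (simp add: frechet_derivative_works)
  next
    assume ?R
    then obtain f' where f': "\<forall>x. (f has_derivative f' x) (at x)" "\<forall>v. Ck_on k UNIV (\<lambda>x. f' x v)"
      by auto
    then have "frechet_derivative f (at x) = f' x" for x
      by (metis frechet_derivative_at)
    then show ?L using f' Suc by (auto simp: differentiable_def)
  qed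
qed

lemma smooth_iff_smooth_on: "smooth f \<longleftrightarrow> smooth_on UNIV f"
  by (simp add: smooth_def smooth_on_def C_k_iff_Ck_on)

lemma smooth_on_imp_continuous_on: "smooth_on S f \<Longrightarrow> continuous_on S f"
  using Ck_on_imp_continuous_on unfolding smooth_on_def by blast

lemma smooth_on_subset: "smooth_on T f \<Longrightarrow> S \<subseteq> T \<Longrightarrow> smooth_on S f"
  using Ck_on_subset unfolding smooth_on_def by blast

lemma smooth_on_cong:
  "open S \<Longrightarrow> (\<And>x. x \<in> S \<Longrightarrow> f x = g x) \<Longrightarrow> smooth_on S f \<longleftrightarrow> smooth_on S g"
  using Ck_on_cong unfolding smooth_on_def by blast

lemma smooth_on_Un: "open S \<Longrightarrow> open T \<Longrightarrow> smooth_on S f \<Longrightarrow> smooth_on T f \<Longrightarrow> smooth_on (S \<union> T) f"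
  using Ck_on_Un unfolding smooth_on_def by blast

lemma smooth_on_const: "smooth_on S (\<lambda>x. c)"
  and smooth_on_bounded_linear: "bounded_linear l \<Longrightarrow> smooth_on S l"
  and smooth_on_add: "smooth_on S f \<Longrightarrow> smooth_on S g \<Longrightarrow> smooth_on S (\<lambda>x. f x + g x)"
  and smooth_on_mult: "smooth_on S f \<Longrightarrow> smooth_on S g \<Longrightarrow> smooth_on S (\<lambda>x. f x * g x)"
  unfolding smooth_on_def
  by (simp_all add: Ck_on_const Ck_on_bounded_linear Ck_on_add Ck_on_mult)

lemma smooth_on_compose:
  fixes h :: "real \<Rightarrow> real"
  shows "smooth_on T h \<Longrightarrow> smooth_on S f \<Longrightarrow> f ` S \<subseteq> T \<Longrightarrow> smooth_on S (\<lambda>x. h (f x))"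
  unfolding smooth_on_def using Ck_on_compose by blast

lemma smooth_on_antiderivative:
  fixes f :: "real \<Rightarrow> real"
  assumes "\<And>x. x \<in> S \<Longrightarrow> (f has_real_derivative d x) (at x)" "smooth_on S d"
  shows "smooth_on S f"
  unfolding smooth_on_def
proof
  fix k
  show "Ck_on k S f"
    using Ck_on_SucD[OF Ck_on_Suc_real[of S f d k]] assms by (auto simp: smooth_on_def)
qed

lemma smooth_on_deriv:
  fixes f :: "real \<Rightarrow> real"
  assumes "open S" "smooth_on S f"
  shows "\<And>x. x \<in> S \<Longrightarrow> (f has_real_derivative deriv f x) (at x)" and "smooth_on S (deriv f)"
proof -
  have D: "f differentiable (at x)" if "x \<in> S" for x
    using assms(2)[unfolded smooth_on_def, rule_format, of "Suc 0"] that
    by (auto simp: differentiable_def)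
  then show der: "\<And>x. x \<in> S \<Longrightarrow> (f has_real_derivative deriv f x) (at x)"
    by (metis DERIV_deriv_iff_real_differentiable)
  show "smooth_on S (deriv f)"
    unfolding smooth_on_def
  proof
    fix k
    obtain f' where f': "\<forall>x\<in>S. (f has_derivative f' x) (at x)" "\<forall>v. Ck_on k S (\<lambda>x. f' x v)"
      using assms(2)[unfolded smooth_on_def, rule_format, of "Suc k"] by auto
    have "deriv f x = f' x 1" if "x \<in> S" for x
      using der[OF that] f'(1)[rule_format, OF that]
      by (metis has_derivative_unique has_field_derivative_def mult.right_neutral)
    then show "Ck_on k S (deriv f)"
      using Ck_on_cong[OF assms(1), of "deriv f" "\<lambda>x. f' x 1" k] f'(2) by auto
  qed
qed

lemma smooth_frechet_derivative:
  "smooth f \<Longrightarrow> smooth (\<lambda>x. frechet_derivative f (at x) v)"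
  unfolding smooth_def by (metis C_k.simps(2))

lemma smooth_imp_has_derivative: "smooth f \<Longrightarrow> (f has_derivative frechet_derivative f (at x)) (at x)"
  unfolding smooth_def by (metis C_k.simps(2) frechet_derivative_works)

section \<open>Concrete smooth functions: powers, power series and a smooth step\<close>

lemma smooth_on_powr: "smooth_on {0<..} (\<lambda>x::real. x powr a)"
proof -
  have "Ck_on k {0<..} (\<lambda>x::real. x powr a)" for k
  proof (induction k arbitrary: a)
    case 0
    show ?case by (auto intro!: continuous_intros)
  next
    case (Suc k)
    show ?case
      by (rule Ck_on_Suc_real[where d = "\<lambda>x. a * x powr (a - 1)"])
        (auto intro!: has_real_derivative_powr Ck_on_mult Ck_on_const Suc)
  qed
  then show ?thesis by (simp add: smooth_on_def)
qed

lemma smooth_on_inverse: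
  assumes "smooth_on S f" "\<And>x. x \<in> S \<Longrightarrow> f x > 0"
  shows "smooth_on S (\<lambda>x. inverse (f x))"
proof -
  have "smooth_on {0<..} (\<lambda>x::real. inverse x)"
    using smooth_on_cong[of "{0<..}" inverse "\<lambda>x::real. x powr (-1)"] smooth_on_powr[of "-1"]
    by (simp add: powr_minus)
  from smooth_on_compose[OF this assms(1)] assms(2) show ?thesis by auto
qed

text \<open>Termwise differentiation replaces \<open>c\<close> by \<open>diffs c\<close>, whose
  series again converges everywhere, so the induction on the order runs over arbitrary coefficient
  sequences.\<close>

lemma smooth_on_power_series:
  fixes c :: "nat \<Rightarrow> real"
  assumes "\<And>x. summable (\<lambda>n. c n * x ^ n)"
  shows "smooth_on UNIV (\<lambda>x. \<Sum>n. c n * x ^ n)"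
proof -
  have "Ck_on k UNIV (\<lambda>x. \<Sum>n. c n * x ^ n)" if "\<And>x::real. summable (\<lambda>n. c n * x ^ n)" for k c
    using that
  proof (induction k arbitrary: c)
    case 0
    have "isCont (\<lambda>x. \<Sum>n. c n * x ^ n) x" for x
      using termdiffs_strong_converges_everywhere[OF 0, of x] DERIV_isCont by blast
    then show ?case by (simp add: continuous_at_imp_continuous_on)
  next
    case (Suc k)
    have "summable (\<lambda>n. diffs c n * x ^ n)" for x
      by (rule termdiff_converges_all[OF Suc.prems])
    then show ?case
      by (intro Ck_on_Suc_real[OF termdiffs_strong_converges_everywhere[OF Suc.prems] Suc.IH])
  qed
  then show ?thesis using assms by (simp add: smooth_on_def)
qed

text \<open>\<open>flat 0\<close> is the classical \<open>exp (- 1 / x)\<close> extended by 0. The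
  extra powers of \<open>1 / x\<close> close the family under differentiation up to linear
  combinations, so one derivative formula for all \<open>n\<close> yields smoothness.\<close>

definition flat :: "nat \<Rightarrow> real \<Rightarrow> real" where
  "flat n x = (if x > 0 then exp (- (1 / x)) / x ^ n else 0)"

lemma flat_deriv: "(flat n has_real_derivative flat (n + 2) x - real n * flat (n + 1) x) (at x)"
proof -
  consider "x > 0" | "x < 0" | "x = 0" by linarith
  then show ?thesis
  proof cases
    case 1
    have "((\<lambda>x. exp (- (1 / x)) / x ^ n) has_real_derivative
        flat (n + 2) x - real n * flat (n + 1) x) (at x)"
      using 1 
      apply (auto intro!: derivative_eq_intros simp: flat_def)
      apply (cases n)
       apply (auto simp: field_simps power2_eq_square)
      done
    then show ?thesis
      by (rule has_field_derivative_transform_within_open[of _ _ _ "{0<..}"])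
        (use 1 in \<open>auto simp: flat_def\<close>)
  next
    case 2
    have "((\<lambda>x. 0) has_real_derivative flat (n + 2) x - real n * flat (n + 1) x) (at x)"
      using 2 by (auto simp: flat_def)
    then show ?thesis
      by (rule has_field_derivative_transform_within_open[of _ _ _ "{..<0}"])
        (use 2 in \<open>auto simp: flat_def\<close>)
  next
    case 3
    \<comment> \<open>The difference quotient at 0 from the right, with one more power from the
      division by \<open>x\<close>; from the left it vanishes identically.\<close>
    have "((\<lambda>x::real. exp (- (1 / x)) / x ^ (Suc n)) \<longlongrightarrow> 0) (at_right 0)"
      by real_asymp
    then have "((\<lambda>x. (flat n (0 + x) - flat n 0) / x) \<longlongrightarrow> 0) (at_right 0)"
      by (rule Lim_transform_eventually)
        (auto simp: flat_def eventually_at_right_less field_simps intro!: eventually_at_rightI[of 0 1])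
    moreover have "((\<lambda>x. (flat n (0 + x) - flat n 0) / x) \<longlongrightarrow> 0) (at_left 0)"
      by (rule tendsto_eventually) (auto simp: flat_def intro!: eventually_at_leftI[of "-1"])
    ultimately have "((\<lambda>x. (flat n (0 + x) - flat n 0) / x) \<longlongrightarrow> 0) (at 0)"
      by (simp add: filterlim_split_at)
    then show ?thesis using 3 by (simp add: DERIV_def flat_def)
  qed
qed

lemma smooth_on_flat: "smooth_on UNIV (flat n)"
proof -
  have "Ck_on k UNIV (flat n)" for k
  proof (induction k arbitrary: n)
    case 0
    show ?case using DERIV_isCont[OF flat_deriv[of n]] by (simp add: continuous_at_imp_continuous_on)
  next
    case (Suc k)
    have "Ck_on k UNIV (\<lambda>x. flat (n + 2) x + (- real n) * flat (n + 1) x)"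
      by (intro Ck_on_add Ck_on_mult Ck_on_const Suc)
    then show ?case
      by (intro Ck_on_Suc_real[OF flat_deriv]) simp
  qed
  then show ?thesis by (simp add: smooth_on_def)
qed

text \<open>The denominator is positive because \<open>x\<close> and \<open>1 - x\<close> are never
  both nonpositive. The result is a smooth step with transition interval
  \<open>{0..1}\<close>.\<close>

definition cutoff :: "real \<Rightarrow> real" where
  "cutoff x = flat 0 x * inverse (flat 0 x + flat 0 (1 - x))"

lemma cutoff_0: "x \<le> 0 \<Longrightarrow> cutoff x = 0"
  and cutoff_1: "x \<ge> 1 \<Longrightarrow> cutoff x = 1"
  and cutoff_ge_0: "0 \<le> cutoff x"
  and cutoff_le_1: "cutoff x \<le> 1"
  by (auto simp: cutoff_def flat_def field_simps add_pos_pos divide_le_eq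
      not_less_iff_gr_or_eq dest: less_asym[OF add_pos_pos])

lemma smooth_on_cutoff: "smooth_on UNIV cutoff"
proof -
  have 1: "smooth_on UNIV (\<lambda>x. flat 0 (1 + -1 * x))"
    by (intro smooth_on_compose[OF smooth_on_flat, where S=UNIV] smooth_on_add smooth_on_mult smooth_on_const
        smooth_on_bounded_linear bounded_linear_ident) simp
  have "smooth_on UNIV (\<lambda>x. flat 0 x * inverse (flat 0 x + flat 0 (1 + -1 * x)))"
    by (intro smooth_on_mult smooth_on_inverse smooth_on_add smooth_on_flat 1)
      (auto simp: flat_def add_pos_pos)
  then show ?thesis by (simp add: cutoff_def[abs_def])
qed

section \<open>A second-order differential inequality\<close>

text \<open>\<open>V\<close> has a derivative only almost everywhere, as the nonlinear term is merely integrable in time; lower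
  bounds on the lower right Dini derivative are all that is needed.\<close>

definition lower_rderiv :: "(real \<Rightarrow> real) \<Rightarrow> real \<Rightarrow> real \<Rightarrow> bool" where
  "lower_rderiv X t d \<longleftrightarrow> (\<forall>c<d. \<forall>\<^sub>F s in at_right t. c * (s - t) \<le> X s - X t)"

lemma lower_rderiv_le: "lower_rderiv X t d \<Longrightarrow> d' \<le> d \<Longrightarrow> lower_rderiv X t d'"
  unfolding lower_rderiv_def by auto

lemma lower_rderiv_deriv:
  assumes "(X has_real_derivative d) (at_right t)"
  shows "lower_rderiv X t d"
  unfolding lower_rderiv_def
proof (intro allI impI)
  fix c assume "c < d"
  have "((\<lambda>s. (X s - X t) / (s - t)) \<longlongrightarrow> d) (at_right t)"
    using assms by (simp add: has_field_derivative_iff)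
  then have "\<forall>\<^sub>F s in at_right t. c < (X s - X t) / (s - t)"
    using \<open>c < d\<close> by (rule order_tendstoD)
  moreover have "\<forall>\<^sub>F s in at_right t. t < s" by (rule eventually_at_right_less)
  ultimately show "\<forall>\<^sub>F s in at_right t. c * (s - t) \<le> X s - X t"
    by eventually_elim (simp add: field_simps)
qed

lemma lower_rderiv_add:
  assumes "lower_rderiv X t d" "lower_rderiv Y t d'"
  shows "lower_rderiv (\<lambda>s. X s + Y s) t (d + d')"
  unfolding lower_rderiv_def
proof (intro allI impI)
  fix c assume c: "c < d + d'"
  define e where "e = (d + d' - c) / 2"
  have "e > 0" using c by (simp add: e_def)
  then have "\<forall>\<^sub>F s in at_right t. (d - e) * (s - t) \<le> X s - X t"
    "\<forall>\<^sub>F s in at_right t. (d' - e) * (s - t) \<le> Y s - Y t"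
    using assms by (auto simp: lower_rderiv_def)
  then show "\<forall>\<^sub>F s in at_right t. c * (s - t) \<le> X s + Y s - (X t + Y t)"
  proof eventually_elim
    case (elim s)
    have "c = (d - e) + (d' - e)" by (simp add: e_def field_simps)
    then have "c * (s - t) = (d - e) * (s - t) + (d' - e) * (s - t)" by (metis distrib_right)
    then show ?case using elim by linarith
  qed
qed

text \<open>Split the increment as \<open>k s * (X s - X t) + (k s - k t) * X t\<close>: positivity
  of \<open>k\<close> preserves the bound in the first summand, and the second is differentiated
  classically, whatever the sign of \<open>X t\<close>. Integrating factors enter through this
  rule.\<close>

lemma lower_rderiv_mult:
  assumes k: "(k has_real_derivative k') (at_right t)" "k t > 0" and X: "lower_rderiv X t d"
  shows "lower_rderiv (\<lambda>s. k s * X s) t (k t * d + k' * X t)"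
  unfolding lower_rderiv_def
proof (intro allI impI)
  fix c assume c: "c < k t * d + k' * X t"
  define e where "e = (k t * d + k' * X t - c) / (2 * k t)"
  have e: "e > 0" using c k by (simp add: e_def)
  have "k t * e = (k t * d + k' * X t - c) / 2" using k by (simp add: e_def)
  then have ek: "c < k t * (d - e) + k' * X t" using c by (simp add: right_diff_distrib)
  have q: "((\<lambda>s. (k s - k t) / (s - t)) \<longlongrightarrow> k') (at_right t)"
    using k by (simp add: has_field_derivative_iff)
  have kc: "(k \<longlongrightarrow> k t) (at_right t)"
    using DERIV_continuous[OF k(1)] by (simp add: continuous_within)
  have "((\<lambda>s. k s * (d - e) + (k s - k t) / (s - t) * X t) \<longlongrightarrow> k t * (d - e) + k' * X t) (at_right t)"
    by (intro tendsto_intros q kc)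
  then have 1: "\<forall>\<^sub>F s in at_right t. c < k s * (d - e) + (k s - k t) / (s - t) * X t"
    using ek by (rule order_tendstoD)
  have 2: "\<forall>\<^sub>F s in at_right t. 0 < k s" using kc k(2) by (rule order_tendstoD)
  have 3: "\<forall>\<^sub>F s in at_right t. (d - e) * (s - t) \<le> X s - X t" using X e by (auto simp: lower_rderiv_def)
  show "\<forall>\<^sub>F s in at_right t. c * (s - t) \<le> k s * X s - k t * X t"
    using 1 2 3 eventually_at_right_less[of t]
  proof eventually_elim
    case (elim s)
    have "c * (s - t) \<le> (k s * (d - e) + (k s - k t) / (s - t) * X t) * (s - t)"
      using elim by (intro mult_right_mono) auto
    also have "\<dots> = k s * ((d - e) * (s - t)) + (k s - k t) * X t"
      using elim by (simp add: field_simps)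
    also have "\<dots> \<le> k s * (X s - X t) + (k s - k t) * X t"
      using elim by (intro add_right_mono mult_left_mono) auto
    also have "\<dots> = k s * X s - k t * X t" by (simp add: algebra_simps)
    finally show ?case .
  qed
qed

text \<open>To the right of \<open>t\<close>, \<open>X\<close> stays above a line of slope
  \<open>d1\<close>, chosen strictly between \<open>c / q\<close> and \<open>d\<close>. Monotonicity
  of \<open>\<psi>\<close> transfers this bound, and along the line the ordinary chain rule
  applies.\<close>

lemma lower_rderiv_compose:
  assumes \<psi>: "mono_on {0<..} \<psi>" "(\<psi> has_real_derivative q) (at (X t))" "q > 0"
    and X: "lower_rderiv X t d" "X t > 0"
  shows "lower_rderiv (\<lambda>s. \<psi> (X s)) t (q * d)"
  unfolding lower_rderiv_def
proof (intro allI impI)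
  fix c assume c: "c < q * d"
  define d1 where "d1 = (d + c / q) / 2"
  have d1: "d1 < d" "c < q * d1" using c \<psi>(3) by (auto simp: d1_def field_simps)
  have "((\<lambda>s. \<psi> (X t + d1 * (s - t))) has_real_derivative q * d1) (at_right t)"
    using \<psi>(2) by (auto intro!: derivative_eq_intros DERIV_chain2[where f=\<psi>])
  then have "((\<lambda>s. (\<psi> (X t + d1 * (s - t)) - \<psi> (X t)) / (s - t)) \<longlongrightarrow> q * d1) (at_right t)"
    by (simp add: has_field_derivative_iff)
  then have 1: "\<forall>\<^sub>F s in at_right t. c < (\<psi> (X t + d1 * (s - t)) - \<psi> (X t)) / (s - t)"
    using d1(2) by (rule order_tendstoD)
  have "((\<lambda>s. X t + d1 * (s - t)) \<longlongrightarrow> X t + d1 * (t - t)) (at_right t)"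
    by (intro tendsto_intros)
  then have 2: "\<forall>\<^sub>F s in at_right t. 0 < X t + d1 * (s - t)"
    using X(2) by (intro order_tendstoD) auto
  have 3: "\<forall>\<^sub>F s in at_right t. d1 * (s - t) \<le> X s - X t" using X d1 by (auto simp: lower_rderiv_def)
  show "\<forall>\<^sub>F s in at_right t. c * (s - t) \<le> \<psi> (X s) - \<psi> (X t)"
    using 1 2 3 eventually_at_right_less[of t]
  proof eventually_elim
    case (elim s)
    have "c * (s - t) \<le> \<psi> (X t + d1 * (s - t)) - \<psi> (X t)"
      using elim by (simp add: field_simps)
    also have "\<psi> (X t + d1 * (s - t)) \<le> \<psi> (X s)"
      using elim by (intro mono_onD[OF \<psi>(1)]) auto
    finally show ?case by simp
  qed
qed

text \<open>Tilt by a small slope \<open>- e\<close>: the points where \<open>X\<close> is not below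
  the tilted line form a compact set, and beyond its last point the Dini bound would still add
  points, unless that point is \<open>b\<close>.\<close>

lemma lower_rderiv_nonneg_imp_le:
  assumes "a \<le> b" and cont: "continuous_on {a..b} X"
    and lower_rderiv: "\<And>t. a \<le> t \<Longrightarrow> t < b \<Longrightarrow> lower_rderiv X t 0"
  shows "X a \<le> X b"
proof (rule field_le_epsilon)
  fix e' :: real assume "e' > 0"
  \<comment> \<open>The \<open>+ 1\<close> keeps the denominator positive when
    \<open>a = b\<close>.\<close>
  define e where "e = e' / (b - a + 1)"
  have e: "e > 0" using \<open>e' > 0\<close> \<open>a \<le> b\<close> by (simp add: e_def)
  have eb: "e * (b - a) \<le> e'"
  proof -
    have "e * (b - a) \<le> e * (b - a + 1)" using e by (intro mult_left_mono) auto
    then show ?thesis using \<open>a \<le> b\<close> by (simp add: e_def)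
  qed
  define S where "S = {t \<in> {a..b}. X a - e * (t - a) \<le> X t}"
  have "closed S"
    unfolding S_def by (rule continuous_on_closed_Collect_le) (auto intro!: continuous_intros cont)
  moreover have "bounded S" unfolding S_def by (rule bounded_subset[of "{a..b}"]) auto
  ultimately have "compact S" by (simp add: compact_eq_bounded_closed)
  moreover have "a \<in> S" using \<open>a \<le> b\<close> by (simp add: S_def)
  ultimately obtain z where z: "z \<in> S" "\<And>t. t \<in> S \<Longrightarrow> t \<le> z"
    using compact_attains_sup[of S] by auto
  have "z = b"
  proof (rule ccontr)
    assume "z \<noteq> b"
    then have "a \<le> z" "z < b" using z by (auto simp: S_def)
    then have "\<forall>\<^sub>F s in at_right z. (- e) * (s - z) \<le> X s - X z"
      using lower_rderiv[of z, unfolded lower_rderiv_def, rule_format, of "- e"] e by simp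
    moreover have "\<forall>\<^sub>F s in at_right z. s < b" "\<forall>\<^sub>F s in at_right z. z < s"
      using \<open>z < b\<close> by (auto simp: eventually_at_right_less eventually_at_right_real intro:
          eventually_at_rightI[of z b])
    ultimately have "\<forall>\<^sub>F s in at_right z. s \<in> S \<and> z < s"
    proof eventually_elim
      case (elim s)
      have "X a - e * (z - a) \<le> X z" using z by (simp add: S_def)
      then show ?case using elim \<open>a \<le> z\<close> by (auto simp: S_def algebra_simps)
    qed
    then obtain s where "s \<in> S" "z < s"
      using eventually_happens trivial_limit_at_right_real by blast
    then show False using z(2) by fastforce
  qed
  then show "X a \<le> X b + e'" using z(1) eb by (simp add: S_def)
qed

text \<open>The factor of \<open>\<bar>V t\<bar> powr p\<close> is a Hoelder weight
  \<open>K powr (1 - p)\<close>, with \<open>K\<close> a constant times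
  \<open>t powr \<nu> * exp (phi_m m t)\<close>. The interval is closed; its end \<open>T\<close>
  will be an arbitrary time before the end of the existence interval. The two conditions on
  \<open>\<kappa>\<close> start and propagate the comparison of \<open>V\<close> with
  \<open>\<kappa> * t powr m * U\<close>.\<close>

locale glassey_ode =
  fixes m \<mu> p \<kappa> B \<nu> T :: real and U V :: "real \<Rightarrow> real"
  assumes m: "m \<ge> 0" and mu: "\<mu> \<ge> 0" and p: "p > 1" and T: "T \<ge> 1" and B: "B > 0"
    and \<kappa>: "\<kappa> > 0" "\<kappa> * (\<kappa> + m + \<mu>) \<le> 1" "\<kappa> * U 1 \<le> V 1"
    and U: "\<And>t. 1 \<le> t \<Longrightarrow> t \<le> T \<Longrightarrow> (U has_real_derivative V t) (at t within {1..T})"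
    and V: "continuous_on {1..T} V"
    and pos: "U 1 > 0" "V 1 > 0"
    and lrdV: "\<And>t. 1 \<le> t \<Longrightarrow> t < T \<Longrightarrow>
      lower_rderiv V t (t powr (2 * m) * U t - \<mu> / t * V t + B * (t powr \<nu> * exp (phi_m m t)) powr (1 - p) * \<bar>V
          t\<bar> powr p)"
begin

abbreviation "a t \<equiv> B * (t powr \<nu> * exp (phi_m m t)) powr (1 - p)"

lemma U_continuous: "continuous_on {1..T} U"
  using U by (intro DERIV_continuous_on) auto

lemma at_right_le: "1 \<le> t \<Longrightarrow> t < T \<Longrightarrow> at_right t \<le> at t within {1..T}"
  using at_le[of "{t..T}" "{1..T}" t] by (simp add: at_within_Icc_at_right)

lemma lower_rderiv_deriv_Icc:
  assumes "1 \<le> t" "t < T" "(X has_real_derivative d) (at t within {1..T})"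
  shows "lower_rderiv X t d"
proof (rule lower_rderiv_deriv)
  show "(X has_real_derivative d) (at_right t)"
    using assms(3) tendsto_mono[OF at_right_le[OF assms(1,2)]] unfolding has_field_derivative_iff by blast
qed

lemma U_lower_rderiv: "1 \<le> t \<Longrightarrow> t < T \<Longrightarrow> lower_rderiv U t (V t)"
  by (intro lower_rderiv_deriv_Icc U) auto

text \<open>Consider the first time \<open>z\<close> with \<open>V z \<le> 0\<close>. Up to
  \<open>z\<close> the function \<open>U\<close> has increased and is positive, so
  \<open>s powr \<mu> * V s\<close> is nondecreasing on \<open>{1..z}\<close>, which contradicts
  \<open>V 1 > 0\<close>.\<close>

lemma V_pos: "1 \<le> t \<Longrightarrow> t \<le> T \<Longrightarrow> 0 < V t"
proof (rule ccontr)
  assume t: "1 \<le> t" "t \<le> T" and neg: "\<not> 0 < V t"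
  define S where "S = {s \<in> {1..T}. V s \<le> 0}"
  have "closed S"
    unfolding S_def by (rule continuous_on_closed_Collect_le) (auto intro!: continuous_intros V)
  moreover have "bounded S" unfolding S_def by (rule bounded_subset[of "{1..T}"]) auto
  ultimately have "compact S" by (simp add: compact_eq_bounded_closed)
  moreover have "t \<in> S" using t neg by (simp add: S_def)
  ultimately obtain z where z: "z \<in> S" "\<And>t. t \<in> S \<Longrightarrow> z \<le> t"
    using compact_attains_inf[of S] by auto
  have z1: "1 \<le> z" "z \<le> T" "V z \<le> 0" using z by (auto simp: S_def)
  have Vp: "0 < V s" if "1 \<le> s" "s < z" for s
    using z(2)[of s] that z1 by (force simp: S_def)
  have Up: "0 < U s" if "1 \<le> s" "s < z" for s
  proof -
    have "U 1 \<le> U s"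
    proof (rule lower_rderiv_nonneg_imp_le[where X = U])
      show "continuous_on {1..s} U" using U_continuous by (rule continuous_on_subset) (use that z1 in auto)
      show "lower_rderiv U r 0" if "1 \<le> r" "r < s" for r
        by (rule lower_rderiv_le[OF U_lower_rderiv]) (use that \<open>s < z\<close> z1 Vp[of r] in auto)
    qed (use that in auto)
    then show ?thesis using pos by linarith
  qed
  \<comment> \<open>The factor \<open>s powr \<mu>\<close> absorbs the damping term, so that only
    nonnegative terms remain.\<close>
  have "1 powr \<mu> * V 1 \<le> z powr \<mu> * V z"
  proof (rule lower_rderiv_nonneg_imp_le[where X = "\<lambda>s. s powr \<mu> * V s"])
    show "continuous_on {1..z} (\<lambda>s. s powr \<mu> * V s)"
      by (intro continuous_intros continuous_on_subset[OF V]) (use z1 in auto)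
    fix r assume r: "1 \<le> r" "r < z"
    have 1: "((\<lambda>s. s powr \<mu>) has_real_derivative \<mu> * r powr (\<mu> - 1)) (at_right r)"
      using r by (auto intro!: derivative_eq_intros)
    have 2: "lower_rderiv (\<lambda>s. s powr \<mu> * V s) r (r powr \<mu> * (r powr (2 * m) * U r - \<mu> / r * V r + a r * \<bar>V r\<bar>
        powr p)
        + \<mu> * r powr (\<mu> - 1) * V r)" (is "lower_rderiv _ _ ?d")
      by (rule lower_rderiv_mult[OF 1]) (use r z1 lrdV in auto)
    have "?d = r powr \<mu> * (r powr (2 * m) * U r + a r * \<bar>V r\<bar> powr p)"
      using r by (simp add: algebra_simps powr_diff)
    also have "\<dots> \<ge> 0" using Up[of r] r B by simp
    finally show "lower_rderiv (\<lambda>s. s powr \<mu> * V s) r 0" using lower_rderiv_le[OF 2] by simp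
  qed (use z1 in auto)
  then show False using pos z1 mult_nonneg_nonpos[of "z powr \<mu>" "V z"] by simp
qed

lemma U_pos: "1 \<le> t \<Longrightarrow> t \<le> T \<Longrightarrow> 0 < U t"
proof -
  assume t: "1 \<le> t" "t \<le> T"
  have "U 1 \<le> U t"
  proof (rule lower_rderiv_nonneg_imp_le[where X = U])
    show "continuous_on {1..t} U" using U_continuous by (rule continuous_on_subset) (use t in auto)
    show "lower_rderiv U r 0" if "1 \<le> r" "r < t" for r
      by (rule lower_rderiv_le[OF U_lower_rderiv]) (use that t V_pos[of r] in auto)
  qed (use t in auto)
  then show ?thesis using pos by linarith
qed

lemma phi_m_deriv: "t > 0 \<Longrightarrow> (phi_m m has_real_derivative t powr m) (at t within S)"
  unfolding phi_m_def[abs_def] using m by (auto intro!: derivative_eq_intros)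

text \<open>The integrating factor \<open>exp (\<kappa> * phi_m m t) * t powr \<mu>\<close> removes
  all terms linear in \<open>V\<close> from the inequality for
  \<open>V - \<kappa> * t powr m * U\<close>; the coefficient of \<open>U\<close> that remains is
  nonnegative by the condition on \<open>\<kappa>\<close>. This is what allows the nonlinear term, a
  power of \<open>V\<close>, to be bounded below by a power of \<open>Z\<close>.\<close>

lemma V_ge_U: "1 \<le> t \<Longrightarrow> t \<le> T \<Longrightarrow> \<kappa> * t powr m * U t \<le> V t"
proof -
  assume t: "1 \<le> t" "t \<le> T"
  let ?k = "\<lambda>s. exp (\<kappa> * phi_m m s) * s powr \<mu>"
  let ?D = "\<lambda>s. V s + (- \<kappa> * s powr m) * U s"
  have phic: "continuous_on {1..t} (phi_m m)"
    by (rule DERIV_continuous_on[OF phi_m_deriv]) auto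
  have "?k 1 * ?D 1 \<le> ?k t * ?D t"
  proof (rule lower_rderiv_nonneg_imp_le[where X = "\<lambda>s. ?k s * ?D s"])
    show "continuous_on {1..t} (\<lambda>s. ?k s * ?D s)"
      by (intro continuous_intros continuous_on_subset[OF V] continuous_on_subset[OF U_continuous] phic) (use t
          in auto)
    fix r assume r: "1 \<le> r" "r < t"
    have rT: "r < T" using r t by auto
    have 1: "(?k has_real_derivative ?k r * (\<kappa> * r powr m + \<mu> / r)) (at_right r)"
      using r by (auto intro!: derivative_eq_intros phi_m_deriv simp: powr_diff field_simps)
    have "((\<lambda>s. (- \<kappa> * s powr m) * U s) has_real_derivative
        (- \<kappa> * r powr m) * V r + (- \<kappa> * m * r powr (m - 1)) * U r) (at r within {1..T})"
    proof (rule DERIV_cong)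
      have "((\<lambda>s. s powr m) has_real_derivative m * r powr (m - 1)) (at r within {1..T})"
        using r by (intro has_real_derivative_powr[THEN has_field_derivative_at_within]) auto
      from DERIV_mult[OF DERIV_cmult[OF this, of "- \<kappa>"] U[of r]] r rT
      show "((\<lambda>s. (- \<kappa> * s powr m) * U s) has_real_derivative
          - \<kappa> * (m * r powr (m - 1)) * U r + V r * (- \<kappa> * r powr m)) (at r within {1..T})"
        by simp
    qed (simp add: algebra_simps)
    then have "lower_rderiv (\<lambda>s. (- \<kappa> * s powr m) * U s) r ((- \<kappa> * r powr m) * V r + (- \<kappa> * m * r powr (m - 1))
        * U r)"
      by (rule lower_rderiv_deriv_Icc[OF r(1) rT])
    note 2 = lower_rderiv_add[OF lrdV[OF r(1) rT] this]
    have 3: "lower_rderiv (\<lambda>s. ?k s * ?D s) r (?k r * (r powr (2 * m) * U r - \<mu> / r * V r + a r * \<bar>V r\<bar> powr p +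
       ((- \<kappa> * r powr m) * V r + (- \<kappa> * m * r powr (m - 1)) * U r)) + ?k r * (\<kappa> * r powr m + \<mu> / r) * ?D r)"
      (is "lower_rderiv _ _ ?d")
      by (rule lower_rderiv_mult[OF 1 _ 2]) (use r in auto)
    define y where "y = r powr m"
    have y: "y \<ge> 1" using r m by (simp add: y_def ge_one_powr_ge_zero)
    have yy: "r powr (2 * m) = y * y" "r powr (m - 1) = y / r"
      using r by (auto simp: y_def powr_add[symmetric] powr_diff)
    have "?d = ?k r * (a r * \<bar>V r\<bar> powr p + U r * (y * y - \<kappa> * m * y / r - \<kappa> * y * (\<kappa> * y + \<mu> / r)))"
      unfolding yy y_def[symmetric] by (simp add: algebra_simps add_divide_distrib diff_divide_distrib)
    also have "\<dots> \<ge> 0"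
    proof -
      have "\<kappa> * m * y / r + \<kappa> * y * (\<kappa> * y + \<mu> / r) = y * (\<kappa> * (m / r + \<mu> / r + \<kappa> * y))"
        by (simp add: algebra_simps add_divide_distrib)
      \<comment> \<open>Since \<open>1 / r \<le> 1 \<le> y\<close>, the lower-order terms are traded
        for multiples of \<open>y\<close>, after which every term carries
        \<open>y * y\<close>.\<close>
      also have "\<dots> \<le> y * (\<kappa> * (m * y + \<mu> * y + \<kappa> * y))"
      proof -
        have "m / r \<le> m * y" "\<mu> / r \<le> \<mu> * y"
        proof -
          have "1 / r \<le> 1" using r by simp
          then have "1 / r \<le> y" using y by linarith
          then show "m / r \<le> m * y" "\<mu> / r \<le> \<mu> * y"
            using m mu mult_left_mono[of "1 / r" y] by auto
        qed
        then show ?thesis using y \<kappa> by (intro mult_left_mono add_mono) auto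
      qed
      also have "\<dots> = (y * y) * (\<kappa> * (\<kappa> + m + \<mu>))" by (simp add: algebra_simps)
      also have "\<dots> \<le> (y * y) * 1" using \<kappa> by (intro mult_left_mono) auto
      finally have "0 \<le> y * y - \<kappa> * m * y / r - \<kappa> * y * (\<kappa> * y + \<mu> / r)" by simp
      then show ?thesis
        using U_pos[of r] r rT B by (intro mult_nonneg_nonneg add_nonneg_nonneg) auto
    qed
    finally show "lower_rderiv (\<lambda>s. ?k s * ?D s) r 0" using lower_rderiv_le[OF 3] by simp
  qed (use t in auto)
  moreover have "?k 1 * ?D 1 \<ge> 0" using \<kappa> by simp
  ultimately have "?k t * ?D t \<ge> 0" by linarith
  moreover have "?k t > 0" using t by simp
  ultimately have "?D t \<ge> 0" by (simp add: zero_le_mult_iff)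
  then show ?thesis by simp
qed

text \<open>\<open>t powr m + \<delta> / t\<close> is, in WKB approximation, minus the logarithmic derivative of the decaying solution
  of the linear equation, so that \<open>Z\<close> nearly annihilates that solution; \<open>c0\<close> absorbs its error, of order \<open>t powr
      (- 2 - m)\<close>, which is integrable.\<close>

definition "\<delta> = (m + \<mu>) / 2"
definition "c0 = max 0 (\<delta> * (\<delta> + 1 - \<mu>))"
definition "weight t = exp (- phi_m m t - c0 / (1 + m) * t powr (- 1 - m)) * t powr ((\<mu> - m) / 2)"
definition "Z t = V t + (t powr m + \<delta> / t) * U t"
definition "w t = weight t * Z t"
definition "c3 = 1 / (1 + (1 + \<delta>) / \<kappa>)"

lemma delta_nonneg: "\<delta> \<ge> 0" using m mu by (simp add: \<delta>_def)

lemma c3_pos: "c3 > 0" using delta_nonneg \<kappa> by (simp add: c3_def add_pos_nonneg)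

lemma weight_pos: "t \<ge> 1 \<Longrightarrow> weight t > 0" by (simp add: weight_def)

lemma Z_pos: "1 \<le> t \<Longrightarrow> t \<le> T \<Longrightarrow> 0 < Z t"
  unfolding Z_def using U_pos[of t] V_pos[of t] delta_nonneg
      by (intro add_pos_nonneg mult_nonneg_nonneg add_nonneg_nonneg) auto

lemma w_pos: "1 \<le> t \<Longrightarrow> t \<le> T \<Longrightarrow> 0 < w t"
  unfolding w_def using weight_pos Z_pos by simp

text \<open>\<open>V_ge_U\<close> bounds \<open>t powr m * U t\<close> by
  \<open>V t / \<kappa>\<close>, and \<open>\<delta> / t \<le> \<delta> * t powr m\<close>. Together
  \<open>Z t \<le> (1 + (1 + \<delta>) / \<kappa>) * V t\<close>, and \<open>c3\<close> is the
  reciprocal of this constant.\<close>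

lemma V_ge_Z: "1 \<le> t \<Longrightarrow> t \<le> T \<Longrightarrow> c3 * Z t \<le> V t"
proof -
  assume t: "1 \<le> t" "t \<le> T"
  have "\<delta> / t \<le> \<delta> * t powr m"
  proof -
    have "\<delta> / t \<le> \<delta> * 1" using t delta_nonneg divide_left_mono[of 1 t \<delta>] by simp
    also have "\<dots> \<le> \<delta> * t powr m" using t delta_nonneg m by (intro mult_left_mono ge_one_powr_ge_zero) auto
    finally show ?thesis .
  qed
  then have "(t powr m + \<delta> / t) * U t \<le> ((1 + \<delta>) * t powr m) * U t"
    using U_pos[OF t] by (intro mult_right_mono) (auto simp: algebra_simps)
  also have "\<dots> = (1 + \<delta>) / \<kappa> * (\<kappa> * t powr m * U t)" using \<kappa> by simp
  also have "\<dots> \<le> (1 + \<delta>) / \<kappa> * V t"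
    using V_ge_U[OF t] \<kappa> delta_nonneg by (intro mult_left_mono) auto
  finally have "Z t \<le> (1 + (1 + \<delta>) / \<kappa>) * V t" by (simp add: Z_def algebra_simps)
  then show ?thesis using delta_nonneg \<kappa> unfolding c3_def
    by (subst pos_divide_le_eq[symmetric] | simp add: field_simps add_pos_nonneg)+
qed

text \<open>The logarithmic derivative of \<open>weight\<close> is matched to \<open>Z\<close>: in
  the linear part, \<open>V\<close> retains only a \<open>c0\<close> term, and the coefficient of
  \<open>U\<close> loses its orders \<open>t powr (2 * m)\<close> and \<open>t powr (m - 1)\<close>.
  The remainder is nonnegative and is dropped.\<close>

lemma w_lower_rderiv: "1 \<le> t \<Longrightarrow> t < T \<Longrightarrow> lower_rderiv w t (weight t * (a t * V t powr p))"
proof -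
  assume t: "1 \<le> t" "t < T"
  have k: "(weight has_real_derivative weight t * (- (t powr m) + c0 * t powr (- 2 - m) + (\<mu> - m) / 2 / t))
      (at_right t)"
  proof -
    let ?h = "\<lambda>s. - phi_m m s - c0 / (1 + m) * s powr (- 1 - m)"
    have "((\<lambda>s. s powr (- 1 - m)) has_real_derivative (- 1 - m) * t powr (- 1 - m - 1)) (at t within {t<..})"
      using t by (intro has_real_derivative_powr[THEN has_field_derivative_at_within]) auto
    from DERIV_cmult[OF this, of "c0 / (1 + m)"] have "((\<lambda>s. c0 / (1 + m) * s powr (- 1 - m))
        has_real_derivative - c0 * t powr (- 2 - m)) (at_right t)"
    proof (rule DERIV_cong)
      have 1: "- 1 - m - 1 = - 2 - m" by simp
      have "c0 / (1 + m) * (- 1 - m) = - c0" using m by (simp add: field_simps)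
      then show "c0 / (1 + m) * ((- 1 - m) * t powr (- 1 - m - 1)) = - c0 * t powr (- 2 - m)"
        unfolding 1 mult.assoc[symmetric] by (rule arg_cong)
    qed
    then have h: "(?h has_real_derivative (- (t powr m) + c0 * t powr (- 2 - m))) (at_right t)"
      by (intro DERIV_cong[OF DERIV_diff[OF DERIV_minus[OF phi_m_deriv]]]) (use t in auto)
    have "(weight has_real_derivative exp (?h t) * (- (t powr m) + c0 * t powr (- 2 - m)) * t powr ((\<mu> - m) / 2)
        + (\<mu> - m) / 2 * t powr ((\<mu> - m) / 2 - 1) * exp (?h t)) (at_right t)"
      unfolding weight_def[abs_def]
      by (rule DERIV_mult[OF DERIV_chain2[OF DERIV_exp h] has_real_derivative_powr[THEN
          has_field_derivative_at_within]]) (use t in auto)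
    then show ?thesis by (rule DERIV_cong) (use t in \<open>simp add: weight_def powr_diff algebra_simps\<close>)
  qed
  have "((\<lambda>s. (s powr m + \<delta> / s) * U s) has_real_derivative
        (t powr m + \<delta> / t) * V t + (m * t powr (m - 1) - \<delta> / t\<^sup>2) * U t) (at t within {1..T})"
    using U[of t] t by (auto intro!: derivative_eq_intros simp: power2_eq_square)
  then have "lower_rderiv (\<lambda>s. (s powr m + \<delta> / s) * U s) t ((t powr m + \<delta> / t) * V t + (m * t powr (m - 1) - \<delta> /
      t\<^sup>2) * U t)"
    by (rule lower_rderiv_deriv_Icc[OF t])
  note 2 = lower_rderiv_add[OF lrdV[OF t] this]
  have 3: "lower_rderiv w t (weight t * (t powr (2 * m) * U t - \<mu> / t * V t + a t * \<bar>V t\<bar> powr p +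
       ((t powr m + \<delta> / t) * V t + (m * t powr (m - 1) - \<delta> / t\<^sup>2) * U t))
       + weight t * (- (t powr m) + c0 * t powr (- 2 - m) + (\<mu> - m) / 2 / t) * Z t)"
    (is "lower_rderiv _ _ ?d") 
    using lower_rderiv_mult[OF k weight_pos[OF t(1)] 2] by (simp add: w_def[abs_def] Z_def)
  define y where "y = t powr m"
  have y: "y > 0" using t by (simp add: y_def)
  have yy: "t powr (2 * m) = y * y" "t powr (m - 1) = y / t" "t powr (- 2 - m) = 1 / (y * t\<^sup>2)"
    using t by (auto simp: y_def powr_add[symmetric] powr_diff powr_minus field_simps)
  \<comment> \<open>With \<open>\<delta> = (m + \<mu>) / 2\<close> both
    \<open>- \<mu> + \<delta> + (\<mu> - m) / 2\<close> and
    \<open>m - \<delta> + (\<mu> - m) / 2\<close> vanish, which gives the cancellation. The maximum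
    defining \<open>c0\<close> then makes the coefficient of \<open>U\<close> at order
    \<open>1 / t\<^sup>2\<close> nonnegative.\<close>
  have "?d - weight t * (a t * \<bar>V t\<bar> powr p) = weight t * (V t * (c0 / (y * t\<^sup>2))
      + U t * ((\<delta> * (\<mu> - m) / 2 - \<delta> + c0) / t\<^sup>2 + c0 * \<delta> / (y * t^3)))"
    unfolding yy y_def[symmetric] Z_def using y t
    by (simp add: \<delta>_def field_simps power2_eq_square power3_eq_cube)
  also have "\<dots> \<ge> 0"
  proof -
    have "\<delta> * (\<mu> - m) / 2 - \<delta> + c0 \<ge> 0"
      unfolding c0_def by (simp add: \<delta>_def max_def field_simps)
    then have "0 \<le> (\<delta> * (\<mu> - m) / 2 - \<delta> + c0) / t\<^sup>2" by simp
    moreover have "c0 \<ge> 0" by (simp add: c0_def)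
    then have "0 \<le> c0 / (y * t\<^sup>2)" "0 \<le> c0 * \<delta> / (y * t ^ 3)" using y t delta_nonneg by simp_all
    ultimately show ?thesis
      using weight_pos[OF t(1)] V_pos[of t] U_pos[of t] t by (intro mult_nonneg_nonneg add_nonneg_nonneg) auto
  qed
  finally show ?thesis using lower_rderiv_le[OF 3] V_pos[of t] t by simp
qed

text \<open>Bernoulli's substitution: \<open>w powr (1 - p)\<close> decreases at least at the rate
  \<open>(p - 1) * c3 powr p * B * t powr (- \<theta>)\<close>, with
  \<open>\<theta> = (p - 1) * (\<nu> + (\<mu> - m) / 2)\<close>, but stays nonnegative, so the
  accumulated decrease cannot exceed its initial value. The abstract primitive \<open>G\<close>
  serves the power and the logarithmic case alike, and the solution enters the bound only through
  \<open>V 1\<close>.\<close>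

lemma lifespan_estimate:
  assumes G: "\<And>t. t > 0 \<Longrightarrow> (G has_real_derivative t powr (- ((p - 1) * (\<nu> + (\<mu> - m) / 2)))) (at t)" "G 1 = 0"
  shows "(p - 1) * c3 powr p * B * G T \<le> (exp (- (1 + c0) / (1 + m)) * V 1) powr (1 - p)"
proof -
  let ?X = "\<lambda>t. - (w t powr (1 - p)) + (- ((p - 1) * c3 powr p * B)) * G t"
  have zc: "continuous_on {1..T} weight"
    unfolding weight_def[abs_def]
    by (intro continuous_intros DERIV_continuous_on[OF phi_m_deriv]) auto
  have wc: "continuous_on {1..T} w"
    unfolding w_def[abs_def] Z_def[abs_def]
    by (intro continuous_intros V U_continuous zc) auto
  have "?X 1 \<le> ?X T"
  proof (rule lower_rderiv_nonneg_imp_le[OF T, where X = ?X])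
    have "continuous_on {1..T} G" by (rule DERIV_continuous_on[OF has_field_derivative_at_within[OF G(1)]]) auto
    then show "continuous_on {1..T} ?X"
      by (intro continuous_intros wc) (use w_pos in \<open>auto simp: less_imp_neq[symmetric]\<close>)
    fix t assume t: "1 \<le> t" "t < T"
    have wt: "w t > 0" using w_pos t by simp
    have mono: "mono_on {0<..} (\<lambda>x. - (x powr (1 - p)))"
    proof (rule mono_onI)
      fix x y :: real assume "x \<in> {0<..}" "y \<in> {0<..}" "x \<le> y"
      then show "- (x powr (1 - p)) \<le> - (y powr (1 - p))" using p by (simp add: powr_mono2')
    qed
    have w': "((\<lambda>x. - (x powr (1 - p))) has_real_derivative (p - 1) * w t powr - p) (at (w t))"
    proof (rule DERIV_cong)
      show "((\<lambda>x. - (x powr (1 - p))) has_real_derivative - ((1 - p) * w t powr (1 - p - 1))) (at (w t))"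
        by (intro DERIV_minus has_real_derivative_powr wt)
    qed (simp add: algebra_simps)
    have 1: "lower_rderiv (\<lambda>t. - (w t powr (1 - p))) t (((p - 1) * w t powr (- p)) * (weight t * (a t * V t powr
        p)))"
      by (rule lower_rderiv_compose[where X = w, OF mono w' _ w_lower_rderiv[OF t] wt]) (use wt p in simp)
    have 2: "lower_rderiv (\<lambda>t. (- ((p - 1) * c3 powr p * B)) * G t) t
       ((- ((p - 1) * c3 powr p * B)) * t powr (- ((p - 1) * (\<nu> + (\<mu> - m) / 2))))"
      by (intro lower_rderiv_deriv has_field_derivative_at_within[OF DERIV_cmult] G) (use t in simp)
    have "w t powr (- p) * (weight t * (a t * V t powr p)) \<ge> c3 powr p * B * t powr (- ((p - 1) * (\<nu> + (\<mu> - m) /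
        2)))"
    proof -
      have kp: "weight t > 0" using weight_pos t by simp
      have zp: "Z t > 0" using Z_pos t by simp
      have "c3 powr p * Z t powr p \<le> V t powr p"
        using V_ge_Z[of t] t c3_pos zp p by (subst powr_mult[symmetric]) (auto intro!: powr_mono2)
      then have A: "w t powr (- p) * (weight t * (a t * (c3 powr p * Z t powr p))) \<le> w t powr (- p) * (weight t
          * (a t * V t powr p))"
        using kp B by (intro mult_left_mono) auto
      have C: "w t powr (- p) * (weight t * (a t * (c3 powr p * Z t powr p))) = c3 powr p * (a t * weight t powr
          (1 - p))"
      proof -
        have "w t powr (- p) = weight t powr (- p) * Z t powr (- p)" using kp zp by (simp add: w_def powr_mult)
        moreover have "Z t powr (- p) * Z t powr p = 1" using zp by (simp add: powr_add[symmetric])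
        moreover have "weight t powr (- p) * weight t = weight t powr (1 - p)" using kp
            by (simp add: powr_mult_base mult.commute)
        moreover have "(X * Y) * (k * (A * (c * z))) = c * (A * (X * k) * (Y * z))" for X Y k A c z :: real
          by (simp add: algebra_simps)
        ultimately show ?thesis by (simp only: mult_1_right)
      qed
      have "a t * weight t powr (1 - p) \<ge> B * t powr (- ((p - 1) * (\<nu> + (\<mu> - m) / 2)))"
      proof -
        \<comment> \<open>The exponential growth of the mass bound meets the decay of
          \<open>weight\<close>; a power of \<open>t\<close> and a factor at most 1 survive. As
          \<open>1 - p < 0\<close>, omitting that factor gives a lower bound for the power.\<close>
        have *: "(t powr \<nu> * exp (phi_m m t)) * weight t
            = t powr (\<nu> + (\<mu> - m) / 2) * exp (- (c0 / (1 + m) * t powr (- 1 - m)))"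
        proof -
          have "exp (phi_m m t) * exp (- phi_m m t - c0 / (1 + m) * t powr (- 1 - m))
            = exp (- (c0 / (1 + m) * t powr (- 1 - m)))" by (simp add: exp_add[symmetric])
          then show ?thesis by (simp add: weight_def powr_add)
        qed
        have "((t powr \<nu> * exp (phi_m m t)) * weight t) powr (1 - p) \<ge> (t powr (\<nu> + (\<mu> - m) / 2)) powr (1 - p)"
        proof (rule powr_mono2')
          have "c0 / (1 + m) * t powr (- 1 - m) \<ge> 0" using m by (simp add: c0_def)
          then show "t powr \<nu> * exp (phi_m m t) * weight t \<le> t powr (\<nu> + (\<mu> - m) / 2)"
            unfolding * by (intro mult_left_le) auto
        qed (use t p kp in auto)
        note ge = this
        show ?thesis
        proof -
          have "(t powr \<nu> * exp (phi_m m t) * weight t) powr (1 - p) = (t powr \<nu> * exp (phi_m m t)) powr (1 - p)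
              * weight t powr (1 - p)"
            using t kp by (simp add: powr_mult)
          moreover have "(t powr (\<nu> + (\<mu> - m) / 2)) powr (1 - p) = t powr (- ((p - 1) * (\<nu> + (\<mu> - m) / 2)))"
          proof -
            have "A * (1 - p) = - ((p - 1) * A)" for A by (simp add: algebra_simps)
            then show ?thesis by (simp only: powr_powr)
          qed
          ultimately show ?thesis
            using B mult_left_mono[of "t powr (- ((p - 1) * (\<nu> + (\<mu> - m) / 2)))" _ B] ge
                by (simp add: mult.assoc)
        qed
      qed
      then have "c3 powr p * (B * t powr (- ((p - 1) * (\<nu> + (\<mu> - m) / 2)))) \<le> c3 powr p * (a t * weight t powr
          (1 - p))"
        by (rule mult_left_mono) simp
      with A C show ?thesis unfolding mult.assoc[of "c3 powr p"] by linarith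
    qed
    then have "(p - 1) * (c3 powr p * B * t powr (- ((p - 1) * (\<nu> + (\<mu> - m) / 2)))) \<le> (p - 1) * (w t powr (- p)
        * (weight t * (a t * V t powr p)))"
      using p by (intro mult_left_mono) auto
    then show "lower_rderiv ?X t 0"
      by (intro lower_rderiv_le[OF lower_rderiv_add[OF 1 2]]) (simp add: algebra_simps)
  qed
  then have "(p - 1) * c3 powr p * B * G T \<le> w 1 powr (1 - p)" 
    by (simp add: G(2)) (use powr_ge_zero[of "w T" "1 - p"] in linarith)
  \<comment> \<open>Dropping the nonnegative contribution of \<open>U 1\<close> to
    \<open>Z 1\<close> decreases \<open>w 1\<close> and hence increases its power with exponent
    \<open>1 - p\<close>.\<close>
  also have "\<dots> \<le> (exp (- (1 + c0) / (1 + m)) * V 1) powr (1 - p)"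
  proof (rule powr_mono2')
    have "weight 1 = exp (- (1 + c0) / (1 + m))" using m by (simp add: weight_def phi_m_def diff_divide_distrib)
    then show "exp (- (1 + c0) / (1 + m)) * V 1 \<le> w 1"
      using pos delta_nonneg unfolding w_def Z_def by (intro mult_mono) auto
  qed (use pos p in auto)
  finally show ?thesis .
qed

end

section \<open>Radial eigenfunctions of the Laplacian\<close>

text \<open>With \<open>y = r\<^sup>2\<close> the series is the radial solution of
  \<open>\<Delta> f = f\<close> in dimension \<open>n\<close> that is regular at the origin, with
  value 1 there: a multiple of \<open>r powr (1 - n / 2)\<close> times the modified Bessel function
  of the first kind of order \<open>n / 2 - 1\<close>.\<close>

primrec bessel_coeff :: "nat \<Rightarrow> nat \<Rightarrow> real" where
  "bessel_coeff n 0 = 1"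
| "bessel_coeff n (Suc k) = bessel_coeff n k / ((2 * real k + 2) * (2 * real k + real n))"

lemma bessel_coeff_pos: "n \<ge> 1 \<Longrightarrow> bessel_coeff n k > 0"
  by (induction k) (auto intro!: divide_pos_pos mult_pos_pos add_nonneg_pos)

lemma bessel_coeff_summable:
  assumes "n \<ge> 1"
  shows "summable (\<lambda>k. bessel_coeff n k * x ^ k)"
proof (rule summable_ratio_test[of "1 / 2" "nat \<lceil>\<bar>x\<bar>\<rceil>"])
  fix k assume "k \<ge> nat \<lceil>\<bar>x\<bar>\<rceil>"
  then have k: "\<bar>x\<bar> \<le> real k" by linarith
  let ?d = "(2 * real k + 2) * (2 * real k + real n)"
  have "2 * \<bar>x\<bar> \<le> (2 * real k + 2) * 1" using k by simp
  also have "\<dots> \<le> ?d" using assms by (intro mult_left_mono) auto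
  finally have le: "2 * \<bar>x\<bar> \<le> ?d" .
  have d: "?d > 0" using assms by (intro mult_pos_pos add_nonneg_pos) auto
  have "\<bar>x\<bar> / ?d \<le> 1 / 2" using le d by (simp add: pos_divide_le_eq)
  then have "(\<bar>x\<bar> / ?d) * (\<bar>bessel_coeff n k\<bar> * \<bar>x\<bar> ^ k) \<le> 1 / 2 * (\<bar>bessel_coeff n k\<bar> * \<bar>x\<bar> ^ k)"
    by (intro mult_right_mono) auto
  moreover have "norm (bessel_coeff n (Suc k) * x ^ Suc k) = (\<bar>x\<bar> / ?d) * (\<bar>bessel_coeff n k\<bar> * \<bar>x\<bar> ^ k)"
    using d by (simp add: abs_mult power_abs)
  ultimately show "norm (bessel_coeff n (Suc k) * x ^ Suc k) \<le> 1 / 2 * norm (bessel_coeff n k * x ^ k)"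
    by (simp add: abs_mult power_abs mult.left_commute mult.assoc)
qed simp

definition bessel :: "nat \<Rightarrow> real \<Rightarrow> real" where "bessel n y = (\<Sum>k. bessel_coeff n k * y ^ k)"
definition bessel1 :: "nat \<Rightarrow> real \<Rightarrow> real" where "bessel1 n y = (\<Sum>k. diffs (bessel_coeff n) k * y ^ k)"
definition bessel2 :: "nat \<Rightarrow> real \<Rightarrow> real" where "bessel2 n y = (\<Sum>k. diffs (diffs (bessel_coeff n)) k * y ^ k)"

context
  fixes n :: nat assumes n: "n \<ge> 1"
begin

lemma bessel1_summable: "summable (\<lambda>k. diffs (bessel_coeff n) k * x ^ k)"
  by (rule termdiff_converges_all[OF bessel_coeff_summable[OF n]])

lemma bessel2_summable: "summable (\<lambda>k. diffs (diffs (bessel_coeff n)) k * x ^ k)"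
  by (rule termdiff_converges_all[OF bessel1_summable])

lemma bessel_deriv: "(bessel n has_real_derivative bessel1 n y) (at y)"
  unfolding bessel_def[abs_def] bessel1_def
      by (rule termdiffs_strong_converges_everywhere[OF bessel_coeff_summable[OF n]])

lemma bessel1_deriv: "(bessel1 n has_real_derivative bessel2 n y) (at y)"
  unfolding bessel1_def[abs_def] bessel2_def
      by (rule termdiffs_strong_converges_everywhere[OF bessel1_summable])

lemma smooth_on_bessel: "smooth_on UNIV (bessel n)"
  unfolding bessel_def[abs_def] by (rule smooth_on_power_series[OF bessel_coeff_summable[OF n]])

text \<open>Comparison of coefficients gives exactly the recursion of \<open>bessel_coeff\<close>.
  The left-hand side is the Laplacian in dimension \<open>n\<close>, written for a function of the
  squared radius.\<close>

lemma bessel_ode: "4 * y * bessel2 n y + 2 * n * bessel1 n y = bessel n y"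
proof -
  have "(\<lambda>k. real k * diffs (bessel_coeff n) k * y ^ (k - Suc 0)) sums bessel2 n y"
    unfolding bessel2_def by (rule diffs_equiv[OF bessel2_summable])
  from sums_mult[OF this, of "4 * y"]
  have 1: "(\<lambda>k. 4 * (real k * diffs (bessel_coeff n) k * y ^ k)) sums (4 * y * bessel2 n y)"
  proof (rule sums_cong[THEN iffD1, rotated])
    \<comment> \<open>At \<open>k = 0\<close> the truncated exponent \<open>k - Suc 0\<close> is
      harmless because of the factor \<open>real k\<close>.\<close>
    fix k show "4 * y * (real k * diffs (bessel_coeff n) k * y ^ (k - Suc 0)) = 4 * (real k * diffs
        (bessel_coeff n) k * y ^ k)"
      by (cases k) auto
  qed
  have "(\<lambda>k. diffs (bessel_coeff n) k * y ^ k) sums bessel1 n y"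
    unfolding bessel1_def by (rule summable_sums[OF bessel1_summable])
  from sums_add[OF 1 sums_mult[OF this, of "2 * n"]]
  have "(\<lambda>k. bessel_coeff n k * y ^ k) sums (4 * y * bessel2 n y + 2 * n * bessel1 n y)"
  proof (rule sums_cong[THEN iffD1, rotated])
    fix k
    let ?d = "(2 * real k + 2) * (2 * real k + real n)"
    have d: "?d > 0" using n by (intro mult_pos_pos add_nonneg_pos) auto
    have "4 * (real k * diffs (bessel_coeff n) k * y ^ k) + real (2 * n) * (diffs (bessel_coeff n) k * y ^ k)
      = ?d * bessel_coeff n (Suc k) * y ^ k"
      unfolding diffs_def by (simp add: algebra_simps del: bessel_coeff.simps)
    also have "?d * bessel_coeff n (Suc k) = bessel_coeff n k"
        unfolding bessel_coeff.simps times_divide_eq_right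
      by (rule nonzero_mult_div_cancel_left) (use d in linarith)
    finally show "4 * (real k * diffs (bessel_coeff n) k * y ^ k) + real (2 * n) * (diffs (bessel_coeff n) k * y
        ^ k) = bessel_coeff n k * y ^ k" .
  qed
  then show ?thesis unfolding bessel_def using sums_unique by blast
qed

text \<open>The first two terms of a series with positive coefficients. Linear growth already makes
  \<open>1 / (bessel n y)\<^sup>2\<close> integrable at infinity, on which the boundedness of the
  factor \<open>Q\<close> of the second solution rests.\<close>

lemma bessel_ge: "y \<ge> 0 \<Longrightarrow> bessel n y \<ge> 1 + y / (2 * n)"
proof -
  assume y: "y \<ge> 0"
  have "sum (\<lambda>k. bessel_coeff n k * y ^ k) {..<2} \<le> bessel n y"
    unfolding bessel_def
    by (rule sum_le_suminf[OF bessel_coeff_summable[OF n]]) (use less_imp_le[OF bessel_coeff_pos[OF n]] y in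
        \<open>auto intro!: mult_nonneg_nonneg\<close>)
  then show ?thesis by (simp add: numeral_2_eq_2)
qed

lemma bessel_pos: "y \<ge> 0 \<Longrightarrow> bessel n y > 0"
proof -
  assume "y \<ge> 0"
  then have "0 \<le> y / (2 * n)" by simp
  then show ?thesis using bessel_ge[OF \<open>y \<ge> 0\<close>] by linarith
qed

lemma bessel1_nonneg: "y \<ge> 0 \<Longrightarrow> bessel1 n y \<ge> 0"
  unfolding bessel1_def
  by (rule suminf_nonneg[OF bessel1_summable])
    (use less_imp_le[OF bessel_coeff_pos[OF n]] in \<open>auto simp: diffs_def simp del: bessel_coeff.simps intro!:
        mult_nonneg_nonneg\<close>)

text \<open>For \<open>g r = r powr \<kappa> * bessel n (r\<^sup>2)\<close> the equation reads \<open>g'' = (1 + \<kappa> (\<kappa> - 1) / r\<^sup>2) g\<close>; in the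
  proof, \<open>A = g + g'\<close>.\<close>

lemma bessel_growth: "\<exists>K>0. \<forall>r\<ge>1. bessel n (r\<^sup>2) \<le> K * exp r * r powr (- ((real n - 1) / 2))"
proof -
  define \<kappa> where "\<kappa> = (real n - 1) / 2"
  have \<kappa>: "\<kappa> \<ge> 0" using n by (simp add: \<kappa>_def)
  define f where "f r = bessel n (r\<^sup>2)" for r
  define f1 where "f1 r = 2 * r * bessel1 n (r\<^sup>2)" for r
  define f2 where "f2 r = 2 * bessel1 n (r\<^sup>2) + 4 * r\<^sup>2 * bessel2 n (r\<^sup>2)" for r
  have f: "(f has_real_derivative f1 r) (at r)" for r
    unfolding f_def[abs_def] f1_def
    by (rule DERIV_cong[OF DERIV_chain2[OF bessel_deriv DERIV_power[OF DERIV_ident]]]) simp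
  have f1: "(f1 has_real_derivative f2 r) (at r)" for r
  proof -
    have "((\<lambda>r. bessel1 n (r\<^sup>2)) has_real_derivative bessel2 n (r\<^sup>2) * (2 * r)) (at r)"
      by (rule DERIV_cong[OF DERIV_chain2[OF bessel1_deriv DERIV_power[OF DERIV_ident]]]) simp
    from DERIV_mult[OF DERIV_cmult[OF DERIV_ident, of 2] this]
    show ?thesis unfolding f1_def[abs_def] f2_def
      by (rule DERIV_cong) (simp add: power2_eq_square)
  qed
  have ode: "r > 0 \<Longrightarrow> f2 r + 2 * \<kappa> / r * f1 r = f r" for r
  proof -
    assume "r > 0"
    then have "2 * \<kappa> / r * f1 r = 4 * \<kappa> * bessel1 n (r\<^sup>2)" by (simp add: f1_def)
    moreover have "4 * \<kappa> * bessel1 n (r\<^sup>2) = 2 * n * bessel1 n (r\<^sup>2) - 2 * bessel1 n (r\<^sup>2)"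
    proof -
      have "4 * \<kappa> = 2 * real n - 2" by (simp add: \<kappa>_def)
      then show ?thesis by (simp only: left_diff_distrib)
    qed
    ultimately show ?thesis using bessel_ode[of "r\<^sup>2"] unfolding f_def f2_def by linarith
  qed
  define A where "A r = \<kappa> * r powr (\<kappa> - 1) * f r + r powr \<kappa> * f1 r + r powr \<kappa> * f r" for r
  have fpos: "f r > 0" "f1 r \<ge> 0" if "r > 0" for r
    using that by (auto simp: f_def f1_def intro!: bessel_pos bessel1_nonneg mult_nonneg_nonneg)
  have A': "(A has_real_derivative (\<kappa> * (\<kappa> - 1) * r powr (\<kappa> - 2) * f r + 2 * \<kappa> * r powr (\<kappa> - 1) * f1 r
     + r powr \<kappa> * f2 r + \<kappa> * r powr (\<kappa> - 1) * f r + r powr \<kappa> * f1 r)) (at r)" (is "(_ has_real_derivative ?d)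
         _")
    if "r > 0" for r
  proof -
    have p: "((\<lambda>r. r powr a) has_real_derivative a * r powr (a - 1)) (at r)" for a
      by (rule has_real_derivative_powr[OF that])
    have e: "\<kappa> - 1 - 1 = \<kappa> - 2" by simp
    from DERIV_add[OF DERIV_add[OF DERIV_mult[OF DERIV_cmult[OF p[of "\<kappa> - 1"], of \<kappa>] f]
       DERIV_mult[OF p f1]] DERIV_mult[OF p f]]
    show ?thesis unfolding A_def[abs_def] by (rule DERIV_cong) (simp add: e algebra_simps)
  qed
  \<comment> \<open>By the equation for \<open>g\<close>, the right side minus the left side is
    \<open>\<kappa> / r\<^sup>2 * g + \<kappa>\<^sup>2 / r\<^sup>2 * g'\<close>, and both
    \<open>g\<close> and \<open>g'\<close> are nonnegative.\<close>
  have A'le: "\<kappa> * (\<kappa> - 1) * r powr (\<kappa> - 2) * f r + 2 * \<kappa> * r powr (\<kappa> - 1) * f1 r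
     + r powr \<kappa> * f2 r + \<kappa> * r powr (\<kappa> - 1) * f r + r powr \<kappa> * f1 r \<le> (1 + \<kappa>\<^sup>2 / r\<^sup>2) * A r"
    if "r > 0" for r
  proof -
    define P where "P = r powr \<kappa>"
    have P: "P > 0" using that by (simp add: P_def)
    have pw: "r powr (\<kappa> - 2) = P / r\<^sup>2" "r powr (\<kappa> - 1) = P / r"
      using that by (auto simp: P_def powr_diff)
    have f2: "f2 r = f r - 2 * \<kappa> / r * f1 r" using ode[OF that] by simp
    have "(1 + \<kappa>\<^sup>2 / r\<^sup>2) * A r - (\<kappa> * (\<kappa> - 1) * r powr (\<kappa> - 2) * f r + 2 * \<kappa> * r powr (\<kappa> - 1) * f1 r
      + r powr \<kappa> * f2 r + \<kappa> * r powr (\<kappa> - 1) * f r + r powr \<kappa> * f1 r)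
      = P * (\<kappa> / r\<^sup>2 * f r + \<kappa>\<^sup>2 / r\<^sup>2 * (\<kappa> / r * f r + f1 r))"
      unfolding A_def pw P_def[symmetric] f2 using that
      by (simp add: field_simps power2_eq_square)
    also have "\<dots> \<ge> 0"
      using P \<kappa> fpos[OF that] that by (intro mult_nonneg_nonneg add_nonneg_nonneg divide_nonneg_nonneg) auto
    finally show ?thesis by simp
  qed
  \<comment> \<open>\<open>\<kappa>\<^sup>2 / r - r\<close> is minus a primitive of the rate
    \<open>1 + \<kappa>\<^sup>2 / r\<^sup>2\<close>, so \<open>H\<close> is nonincreasing; its part
    \<open>\<kappa>\<^sup>2 / r\<close> is nonnegative and can be omitted in the final
    bound.\<close>
  define H where "H r = exp (\<kappa>\<^sup>2 / r - r) * A r" for r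
  have H: "H r \<le> H 1" if "r \<ge> 1" for r
  proof (rule DERIV_nonpos_imp_nonincreasing[OF that])
    fix x :: real assume x: "1 \<le> x" "x \<le> r"
    let ?D = "\<kappa> * (\<kappa> - 1) * x powr (\<kappa> - 2) * f x + 2 * \<kappa> * x powr (\<kappa> - 1) * f1 x
     + x powr \<kappa> * f2 x + \<kappa> * x powr (\<kappa> - 1) * f x + x powr \<kappa> * f1 x"
    have "((\<lambda>r. exp (\<kappa>\<^sup>2 / r - r)) has_real_derivative exp (\<kappa>\<^sup>2 / x - x) * (- \<kappa>\<^sup>2 / x\<^sup>2 - 1)) (at x)"
      using x by (auto intro!: derivative_eq_intros simp: power2_eq_square)
    from DERIV_mult[OF this A'[of x]] x
    have "(H has_real_derivative exp (\<kappa>\<^sup>2 / x - x) * (- \<kappa>\<^sup>2 / x\<^sup>2 - 1) * A x + ?D * exp (\<kappa>\<^sup>2 / x - x)) (at x)"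
      by (simp add: H_def[abs_def])
    moreover have "exp (\<kappa>\<^sup>2 / x - x) * (- \<kappa>\<^sup>2 / x\<^sup>2 - 1) * A x + ?D * exp (\<kappa>\<^sup>2 / x - x) \<le> 0"
    proof -
      have "exp (\<kappa>\<^sup>2 / x - x) * ?D \<le> exp (\<kappa>\<^sup>2 / x - x) * ((1 + \<kappa>\<^sup>2 / x\<^sup>2) * A x)"
        using A'le[of x] x by (intro mult_left_mono) auto
      moreover have "exp (\<kappa>\<^sup>2 / x - x) * (- \<kappa>\<^sup>2 / x\<^sup>2 - 1) * A x = - (exp (\<kappa>\<^sup>2 / x - x) * ((1 + \<kappa>\<^sup>2 / x\<^sup>2) * A
          x))"
        by (simp add: algebra_simps)
      moreover have "?D * exp (\<kappa>\<^sup>2 / x - x) = exp (\<kappa>\<^sup>2 / x - x) * ?D" by (rule mult.commute)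
      ultimately show ?thesis by linarith
    qed
    ultimately show "\<exists>y. (H has_real_derivative y) (at x) \<and> y \<le> 0" by blast
  qed
  have Ap: "r powr \<kappa> * f r \<le> A r" "0 < A r" if "r > 0" for r
  proof -
    have "0 \<le> \<kappa> * r powr (\<kappa> - 1) * f r" "0 \<le> r powr \<kappa> * f1 r" "0 < r powr \<kappa> * f r"
      using \<kappa> fpos[OF that] that by (auto intro!: mult_nonneg_nonneg mult_pos_pos)
    then show "r powr \<kappa> * f r \<le> A r" "0 < A r" unfolding A_def by linarith+
  qed
  have "bessel n (r\<^sup>2) \<le> H 1 * exp r * r powr (- ((real n - 1) / 2))" if r: "r \<ge> 1" for r
  proof -
    have "exp (- r) * A r \<le> H r"
      unfolding H_def using Ap[of r] r by (intro mult_right_mono) auto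
    then have "exp (- r) * A r \<le> H 1" using H[OF r] by simp
    then have "A r \<le> H 1 * exp r" by (simp add: exp_minus field_simps)
    then have "r powr \<kappa> * f r \<le> H 1 * exp r" using Ap(1)[of r] r by simp
    then show ?thesis using r by (simp add: f_def \<kappa>_def[symmetric] powr_minus field_simps)
  qed
  moreover have "H 1 > 0" unfolding H_def using Ap(2)[of 1] by simp
  ultimately show ?thesis by blast
qed

text \<open>Reduction of order gives the second solution, normalised to vanish at \<open>1\<close>. The argument of \<open>F\<close> is the
  squared radius, which makes \<open>\<lambda>x. F (x \<bullet> x)\<close> smooth.\<close>

lemma radial_eigenfunction:
  "\<exists>F. smooth_on {0<..} F \<and> F 1 = 0 \<and> (\<forall>y>1. F y > 0) \<and>
     (\<forall>y>0. 4 * y * deriv (deriv F) y + 2 * n * deriv F y = F y) \<and>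
     (\<exists>K>0. \<forall>r\<ge>1. F (r\<^sup>2) \<le> K * exp r * r powr (- ((real n - 1) / 2)))"
proof -
  \<comment> \<open>Wronskian formula: in the radius \<open>r\<close> the integrand is
    \<open>r powr (1 - n)\<close> over the square of the first solution. Substituting
    \<open>y = r\<^sup>2\<close> turns the power into \<open>y powr (- n / 2)\<close> and
    contributes the factor 1/2.\<close>
  define q where "q y = y powr (- (real n / 2)) * inverse (2 * (bessel n y * bessel n y))" for y
  have q_smooth: "smooth_on {0<..} q"
    unfolding q_def[abs_def]
    by (intro smooth_on_mult smooth_on_powr smooth_on_inverse smooth_on_const
        smooth_on_subset[OF smooth_on_bessel]) (auto intro!: mult_pos_pos bessel_pos)
  have q_pos: "q y > 0" if "y > 0" for y
    using that bessel_pos[of y] by (auto simp: q_def)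
  \<comment> \<open>The oriented integral of \<open>q\<close> from 1 to \<open>y\<close>; for each
    \<open>y\<close> one of the two integrals runs over an empty or one-point interval.\<close>
  define Q where "Q y = integral {1..y} q - integral {y..1} q" for y
  have Q1: "Q 1 = 0" by (simp add: Q_def)
  have Q': "(Q has_real_derivative q y) (at y)" if "y > 0" for y
  proof -
    define a where "a = min (y / 2) (1 / 2)"
    define b where "b = max (y + 1) 2"
    have ab: "0 < a" "a < y" "a < 1" "y < b" "1 < b" using that by (auto simp: a_def b_def min_def max_def)
    have qc: "continuous_on {a..b} q"
      by (rule continuous_on_subset[OF smooth_on_imp_continuous_on[OF q_smooth]]) (use ab in auto)
    have qi: "q integrable_on {c..d}" if "a \<le> c" "d \<le> b" for c d
      by (rule integrable_continuous_real[OF continuous_on_subset[OF qc]]) (use that in auto)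
    have eq: "Q x = integral {a..x} q - integral {a..1} q" if "a \<le> x" "x \<le> b" for x
    proof (cases "x \<le> 1")
      case True
      then have "integral {a..x} q + integral {x..1} q = integral {a..1} q"
        using that ab by (intro Henstock_Kurzweil_Integration.integral_combine qi) auto
      moreover have "integral {1..x} q = 0" using True by (cases "x = 1") auto
      ultimately show ?thesis by (simp add: Q_def)
    next
      case False
      then have "integral {a..1} q + integral {1..x} q = integral {a..x} q"
        using that ab by (intro Henstock_Kurzweil_Integration.integral_combine qi) auto
      then show ?thesis using False by (simp add: Q_def)
    qed
    have "((\<lambda>x. integral {a..x} q) has_real_derivative q y) (at y within {a..b})"
      by (rule integral_has_real_derivative[OF qc]) (use ab in auto)
    then have "((\<lambda>x. integral {a..x} q) has_real_derivative q y) (at y)"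
      using ab by (simp add: at_within_Icc_at)
    then have "((\<lambda>x. integral {a..x} q - integral {a..1} q) has_real_derivative q y) (at y)"
      using DERIV_diff[OF _ DERIV_const, of _ "q y" y UNIV "integral {a..1} q"] by simp
    then show ?thesis
      by (rule has_field_derivative_transform_within_open[of _ _ _ "{a<..<b}"]) (use ab eq in auto)
  qed
  have Qpos: "Q y > 0" if "y > 1" for y
  proof -
    have "Q 1 < Q y"
      using that Q' q_pos by (intro DERIV_pos_imp_increasing[OF that]) (meson less_le_trans zero_less_one)
    then show ?thesis using Q1 by simp
  qed
  have Qle: "Q y \<le> n" if "y \<ge> 1" for y
  proof -
    \<comment> \<open>For \<open>y \<ge> 1\<close> the added term decreases at rate
      \<open>1 / (2 * (1 + y / (2 * n))\<^sup>2)\<close>, which dominates \<open>q\<close> by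
      \<open>bessel_ge\<close>; its value at 1 is at most \<open>n\<close>.\<close>
    let ?h = "\<lambda>y. Q y + n / (1 + y / (2 * n))"
    have "?h y \<le> ?h 1"
    proof (rule DERIV_nonpos_imp_nonincreasing[OF that])
      fix x :: real assume x: "1 \<le> x" "x \<le> y"
      let ?w = "1 + x / (2 * n)"
      have w: "?w > 0" using x by (intro add_pos_nonneg) auto
      have "((\<lambda>y. n / (1 + y / (2 * n))) has_real_derivative - (1 / 2) * inverse (?w * ?w)) (at x)"
        using w n by (auto intro!: derivative_eq_intros simp: field_simps)
      from DERIV_add[OF Q'[of x] this] x
      have "(?h has_real_derivative q x + - (1 / 2) * inverse (?w * ?w)) (at x)" by simp
      moreover have "q x \<le> 1 / 2 * inverse (?w * ?w)"
      proof -
        have e: "bessel n x \<ge> ?w" using bessel_ge[of x] x by simp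
        have "?w * ?w \<le> bessel n x * bessel n x" using e w by (intro mult_mono) auto
        then have "inverse (2 * (bessel n x * bessel n x)) \<le> inverse (2 * (?w * ?w))"
          using w by (intro le_imp_inverse_le) (auto intro: mult_pos_pos)
        moreover have "x powr (- (real n / 2)) \<le> x powr 0" using x by (intro powr_mono) auto
        ultimately have "q x \<le> 1 * inverse (2 * (?w * ?w))"
          unfolding q_def using x by (intro mult_mono) auto
        then show ?thesis by simp
      qed
      ultimately show "\<exists>d. (?h has_real_derivative d) (at x) \<and> d \<le> 0"
        by (intro exI[of _ "q x + - (1 / 2) * inverse (?w * ?w)"]) simp
    qed
    moreover have "n / (1 + 1 / (2 * n)) \<le> n" using n by (simp add: field_simps)
    moreover have "n / (1 + y / (2 * n)) \<ge> 0" using that by (intro divide_nonneg_nonneg add_nonneg_nonneg) auto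
    ultimately show ?thesis using Q1 by simp
  qed
  define F where "F y = bessel n y * Q y" for y
  have Q_smooth: "smooth_on {0<..} Q"
    by (rule smooth_on_antiderivative[OF Q' q_smooth]) auto
  have F_smooth: "smooth_on {0<..} F"
    unfolding F_def[abs_def] by (intro smooth_on_mult Q_smooth smooth_on_subset[OF smooth_on_bessel]) auto
  have F1: "(F has_real_derivative bessel1 n y * Q y + q y * bessel n y) (at y)" if "y > 0" for y
    unfolding F_def[abs_def] by (rule DERIV_mult[OF bessel_deriv Q'[OF that]])
  have q': "(q has_real_derivative q y * (- (n / 2) / y - 2 * bessel1 n y / bessel n y)) (at y)"
      if "y > 0" for y
  proof -
    have e: "bessel n y > 0" using bessel_pos that by simp
    have 1: "((\<lambda>y. y powr (- (real n / 2))) has_real_derivative - (real n / 2) * y powr (- (real n / 2) - 1))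
        (at y)"
      by (rule has_real_derivative_powr[OF that])
    have 2: "((\<lambda>y. 2 * (bessel n y * bessel n y)) has_real_derivative 2 * (bessel1 n y * bessel n y + bessel1 n
        y * bessel n y)) (at y)"
      by (intro DERIV_cmult DERIV_mult bessel_deriv)
    have 3: "((\<lambda>y. inverse (2 * (bessel n y * bessel n y))) has_real_derivative
        - (inverse (2 * (bessel n y * bessel n y)) * (2 * (bessel1 n y * bessel n y + bessel1 n y * bessel n y))
            * inverse (2 * (bessel n y * bessel n y)))) (at y)"
      using DERIV_inverse'[OF 2] e by simp
    show ?thesis unfolding q_def[abs_def]
    proof (rule DERIV_cong[OF DERIV_mult[OF 1 3]])
      have w: "y powr (- (real n / 2) - 1) = y powr (- (real n / 2)) / y"
        using that by (simp add: powr_diff)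
      show "- (real n / 2) * y powr (- (real n / 2) - 1) * inverse (2 * (bessel n y * bessel n y)) +
        - (inverse (2 * (bessel n y * bessel n y)) * (2 * (bessel1 n y * bessel n y + bessel1 n y * bessel n y))
            *
        inverse (2 * (bessel n y * bessel n y))) * y powr (- (real n / 2)) =
        y powr (- (real n / 2)) * inverse (2 * (bessel n y * bessel n y)) * (- (real n / 2) / y - 2 * bessel1 n
            y / bessel n y)"
        unfolding w using that e by (simp add: field_simps)
    qed
  qed
  have dF: "deriv F y = bessel1 n y * Q y + q y * bessel n y" if "y > 0" for y
    using F1[OF that] by (rule DERIV_imp_deriv)
  have ddF: "deriv (deriv F) y = (bessel2 n y * Q y + q y * bessel1 n y) + (q y * (- (n / 2) / y - 2 * bessel1 n
      y / bessel n y) * bessel n y + bessel1 n y * q y)"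
    if "y > 0" for y
  proof (rule DERIV_imp_deriv)
    have "((\<lambda>y. bessel1 n y * Q y + q y * bessel n y) has_real_derivative
      (bessel2 n y * Q y + q y * bessel1 n y) + (q y * (- (n / 2) / y - 2 * bessel1 n y / bessel n y) * bessel n
          y + bessel1 n y * q y)) (at y)"
      by (intro DERIV_add DERIV_mult bessel1_deriv bessel_deriv Q' q' that)
    then show "(deriv F has_real_derivative
      (bessel2 n y * Q y + q y * bessel1 n y) + (q y * (- (n / 2) / y - 2 * bessel1 n y / bessel n y) * bessel n
          y + bessel1 n y * q y)) (at y)"
      by (rule has_field_derivative_transform_within_open[of _ _ _ "{0<..}"]) (use that dF in auto)
  qed
  have ode: "4 * y * deriv (deriv F) y + 2 * n * deriv F y = F y" if "y > 0" for y
  proof -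
    have e: "bessel n y > 0" using bessel_pos that by simp
    \<comment> \<open>All terms containing \<open>q\<close> cancel, since its logarithmic derivative
      is the one prescribed by reduction of order.\<close>
    have "4 * y * deriv (deriv F) y + 2 * n * deriv F y = (4 * y * bessel2 n y + 2 * n * bessel1 n y) * Q y"
      unfolding dF[OF that] ddF[OF that] using that e by (simp add: field_simps)
    then show ?thesis using bessel_ode[of y] by (simp add: F_def)
  qed
  obtain K where K: "K > 0" "\<And>r. r \<ge> 1 \<Longrightarrow> bessel n (r\<^sup>2) \<le> K * exp r * r powr (- ((real n - 1) / 2))"
    using bessel_growth by blast
  have "F (r\<^sup>2) \<le> (n * K) * exp r * r powr (- ((real n - 1) / 2))" if r: "r \<ge> 1" for r
  proof -
    have "1 \<le> r\<^sup>2" using r by simp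
    then have "F (r\<^sup>2) \<le> bessel n (r\<^sup>2) * n"
      unfolding F_def using Qle bessel_pos[of "r\<^sup>2"] by (intro mult_left_mono) auto
    also have "\<dots> \<le> (K * exp r * r powr (- ((real n - 1) / 2))) * n"
      using K(2)[OF r] by (intro mult_right_mono) auto
    finally show ?thesis by (simp add: algebra_simps)
  qed
  moreover have "n * K > 0" using n K by simp
  moreover have "F y > 0" if "y > 1" for y
    using Qpos[OF that] bessel_pos[of y] that by (simp add: F_def)
  moreover have "F 1 = 0" by (simp add: F_def Q1)
  ultimately show ?thesis using F_smooth ode by blast
qed

end

section \<open>Exponentially weighted integrals over balls\<close>

lemma shell_volume_le:
  fixes L :: real
  assumes "L \<ge> 1"
  shows "measure lborel {x::'a::euclidean_space. L - 1 \<le> norm x \<and> norm x \<le> L}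
    \<le> unit_ball_vol (real DIM('a)) * (real DIM('a) * L ^ (DIM('a) - 1))"
proof -
  let ?n = "DIM('a)" and ?w = "unit_ball_vol (real DIM('a))"
  have eq: "{x::'a. L - 1 \<le> norm x \<and> norm x \<le> L} = cball 0 L - ball 0 (L - 1)" by auto
  have "measure lborel (cball (0::'a) L - ball 0 (L - 1)) = measure lborel (cball (0::'a) L) - measure lborel
      (ball (0::'a) (L - 1))"
    using assms by (intro measure_Diff) (auto simp: emeasure_cball emeasure_lborel_ball_finite)
  also have "\<dots> = ?w * L ^ ?n - ?w * (L - 1) ^ ?n"
    using assms by (simp add: content_cball content_ball)
  also have "\<dots> = ?w * (L ^ ?n - (L - 1) ^ ?n)" by (simp add: algebra_simps)
  also have "\<dots> \<le> ?w * (real ?n * L ^ (?n - 1))"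
  proof (rule mult_left_mono)
    \<comment> \<open>Bernoulli's inequality for \<open>(1 - 1 / L) ^ n\<close>; it applies because
      \<open>L \<ge> 1\<close>.\<close>
    have "1 + real ?n * (- 1 / L) \<le> (1 + (- 1 / L)) ^ ?n"
      using assms by (intro Bernoulli_inequality) (simp add: field_simps)
    then have "L ^ ?n * (1 - real ?n / L) \<le> L ^ ?n * (1 - 1 / L) ^ ?n"
      using assms by (intro mult_left_mono) auto
    also have "\<dots> = (L - 1) ^ ?n"
      using assms by (simp add: power_mult_distrib[symmetric] algebra_simps)
    finally have "L ^ ?n - (L - 1) ^ ?n \<le> L ^ ?n * (real ?n / L)" by (simp add: algebra_simps)
    also have "L ^ ?n * (real ?n / L) = real ?n * L ^ (?n - 1)"
    proof -
      have "L ^ ?n = L * L ^ (?n - 1)" by (metis DIM_positive Suc_diff_1 power_Suc)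
      then show ?thesis using assms by simp
    qed
    finally show "L ^ ?n - (L - 1) ^ ?n \<le> real ?n * L ^ (?n - 1)" .
  qed simp
  finally show ?thesis by (simp add: eq)
qed

text \<open>Peel off shells of thickness 1. The one at radius \<open>L\<close> contributes at most a
  constant times \<open>L powr (- \<kappa>) * L ^ (n - 1) * exp L\<close>, which is
  \<open>L powr \<kappa> * exp L\<close>; since \<open>exp\<close> drops at least by the factor 2
  from one shell to the next inner one, the outermost shell dominates.\<close>

lemma exp_weight_integral_le:
  fixes \<kappa> :: real
  assumes \<kappa>: "\<kappa> = (real DIM('a::euclidean_space) - 1) / 2"
  shows "\<exists>K>0. \<forall>L\<ge>1. (\<integral>x. indicator {x::'a. 1 \<le> norm x \<and> norm x \<le> L} x * (exp (norm x) * norm x powr (- \<kappa>))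
      \<partial>lborel)
    \<le> K * (L powr \<kappa> * exp L)"
proof -
  let ?n = "DIM('a)" and ?w = "unit_ball_vol (real DIM('a))"
  let ?S = "\<lambda>a b. {x::'a. a \<le> norm x \<and> norm x \<le> b}"
  let ?h = "\<lambda>x::'a. exp (norm x) * norm x powr (- \<kappa>)"
  define J where "J L = (\<integral>x. indicator (?S 1 L) x * ?h x \<partial>lborel)" for L
  have k0: "\<kappa> \<ge> 0" unfolding \<kappa> using DIM_positive[where 'a='a] by (simp add: Suc_le_eq)
  have comp: "compact (?S a b)" for a b
  proof -
    have "?S a b = cball 0 b \<inter> - ball 0 a" by auto
    then show ?thesis by (metis closed_Compl compact_Int_closed compact_cball open_ball)
  qed
  have int: "integrable lborel (\<lambda>x. indicator (?S a b) x * ?h x)" if "a \<ge> 1" for a b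
  proof -
    have "continuous_on (?S a b) ?h" using that by (intro continuous_intros) auto
    from borel_integrable_compact[OF comp this] show ?thesis by simp
  qed
  have bound: "(\<integral>x. indicator (?S a b) x * ?h x \<partial>lborel) \<le> M * measure lborel (?S a b)"
    if "a \<ge> 1" "\<And>x. x \<in> ?S a b \<Longrightarrow> ?h x \<le> M" for a b M
  proof -
    have fin: "emeasure lborel (?S a b) < \<infinity>" by (rule emeasure_compact_finite[OF comp])
    have ms: "?S a b \<in> sets lborel" using comp[of a b] by (simp add: borel_compact)
    have "(\<integral>x. indicator (?S a b) x * ?h x \<partial>lborel) \<le> (\<integral>x. indicator (?S a b) x * M \<partial>lborel)"
    proof (intro integral_mono int that(1) integrable_mult_left integrable_real_indicator ms fin)
      show "indicator (?S a b) x * ?h x \<le> indicator (?S a b) x * M" for x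
        using that(2)[of x] by (auto simp: indicator_def)
    qed
    also have "\<dots> = M * measure lborel (?S a b)" using ms by simp
    finally show ?thesis .
  qed
  define K0 where "K0 = exp 2 * (?w * 2 ^ ?n)"
  define K1 where "K1 = 2 powr \<kappa> * (?w * real ?n)"
  \<comment> \<open>\<open>K0\<close> covers radii up to 2, \<open>K1\<close> a single shell. The
    induction step needs \<open>K / 2 + K1 \<le> K\<close>, that is \<open>2 * K1 \<le> K\<close>;
    the \<open>+ 1\<close> makes \<open>K\<close> positive.\<close>
  define K where "K = max K0 (2 * K1) + 1"
  have K01: "K0 \<ge> 0" "K1 \<ge> 0" by (simp_all add: K0_def K1_def)
  have K: "K > 0" "K0 \<le> K" "2 * K1 \<le> K" using K01 by (auto simp: K_def)
  have J2: "J L \<le> K * (L powr \<kappa> * exp L)" if L: "1 \<le> L" "L \<le> 2" for L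
  proof -
    have "J L \<le> exp 2 * measure lborel (?S 1 L)"
      unfolding J_def
    proof (rule bound)
      fix x assume x: "x \<in> ?S 1 L"
      have "norm x powr (- \<kappa>) \<le> 1" using x k0 powr_mono[of "- \<kappa>" 0 "norm x"] by (auto split: if_splits)
      then have "?h x \<le> exp 2 * 1" using x L by (intro mult_mono) auto
      then show "?h x \<le> exp 2" by simp
    qed simp
    also have "measure lborel (?S 1 L) \<le> measure lborel (cball (0::'a) 2)"
      using L comp[of 1 L] by (intro measure_mono_fmeasurable) (auto simp: borel_compact fmeasurable_compact)
    also have "\<dots> = ?w * 2 ^ ?n" by (simp add: content_cball)
    finally have "J L \<le> K0" by (simp add: K0_def)
    also have "\<dots> \<le> K * (1 * 1)" using K by simp
    also have "\<dots> \<le> K * (L powr \<kappa> * exp L)"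
      using K L k0 by (intro mult_left_mono mult_mono ge_one_powr_ge_zero) auto
    finally show ?thesis .
  qed
  have Jstep: "J L \<le> J (L - 1) + K1 * (L powr \<kappa> * exp L)" if L: "L \<ge> 2" for L
  proof -
    have "J L \<le> (\<integral>x. indicator (?S 1 (L - 1)) x * ?h x + indicator (?S (L - 1) L) x * ?h x \<partial>lborel)"
      unfolding J_def using L by (intro integral_mono int Bochner_Integration.integrable_add)
        (auto simp: indicator_def)
    also have "\<dots> = J (L - 1) + (\<integral>x. indicator (?S (L - 1) L) x * ?h x \<partial>lborel)"
      unfolding J_def using L by (intro Bochner_Integration.integral_add int) auto
    also have "(\<integral>x. indicator (?S (L - 1) L) x * ?h x \<partial>lborel)
       \<le> (2 powr \<kappa> * (exp L * L powr (- \<kappa>))) * measure lborel (?S (L - 1) L)"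
    proof (rule bound)
      fix x assume x: "x \<in> ?S (L - 1) L"
      \<comment> \<open>On the shell \<open>norm x \<ge> L - 1 \<ge> L / 2\<close>, because
        \<open>L \<ge> 2\<close>.\<close>
      have "norm x powr (- \<kappa>) \<le> (L / 2) powr (- \<kappa>)" using x L k0 by (intro powr_mono2') auto
      also have "\<dots> = 2 powr \<kappa> * L powr (- \<kappa>)" using L by (simp add: powr_divide powr_minus field_simps)
      finally have "?h x \<le> exp L * (2 powr \<kappa> * L powr (- \<kappa>))" using x by (intro mult_mono) auto
      then show "?h x \<le> 2 powr \<kappa> * (exp L * L powr (- \<kappa>))" by (simp add: algebra_simps)
    qed (use L in auto)
    also have "\<dots> \<le> (2 powr \<kappa> * (exp L * L powr (- \<kappa>))) * (?w * (real ?n * L ^ (?n - 1)))"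
      using shell_volume_le[of L, where 'a='a] L by (intro mult_left_mono) auto
    also have "\<dots> = K1 * ((L powr (- \<kappa>) * L ^ (?n - 1)) * exp L)" by (simp add: K1_def algebra_simps)
    also have "L powr (- \<kappa>) * L ^ (?n - 1) = L powr \<kappa>"
    proof -
      have "real (?n - 1) = 2 * \<kappa>" unfolding \<kappa> using DIM_positive[where 'a='a]
          by (simp add: Suc_le_eq of_nat_diff)
      then show ?thesis using L by (simp add: powr_realpow[symmetric] powr_add[symmetric])
    qed
    finally show ?thesis by simp
  qed
  \<comment> \<open>The radius is real, so the induction runs over a natural bound for it.\<close>
  have "\<forall>L. 1 \<le> L \<longrightarrow> L \<le> real k + 2 \<longrightarrow> J L \<le> K * (L powr \<kappa> * exp L)" for k
  proof (induction k)
    case 0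
    then show ?case using J2 by auto
  next
    case (Suc k)
    show ?case
    proof (intro allI impI)
      fix L assume L: "1 \<le> L" "L \<le> real (Suc k) + 2"
      show "J L \<le> K * (L powr \<kappa> * exp L)"
      proof (cases "L \<le> 2")
        case True
        then show ?thesis using J2 L by simp
      next
        case False
        have e: "exp (L - 1) \<le> exp L / 2"
        proof -
          have "(2::real) \<le> exp 1" using exp_ge_add_one_self[of 1] by simp
          then have "2 * exp (L - 1) \<le> exp 1 * exp (L - 1)" by (intro mult_right_mono) auto
          then show ?thesis by (simp add: exp_add[symmetric])
        qed
        have "J (L - 1) \<le> K * ((L - 1) powr \<kappa> * exp (L - 1))" using Suc L False by auto
        also have "\<dots> \<le> K * (L powr \<kappa> * (exp L / 2))"
          using K e False k0 by (intro mult_left_mono mult_mono powr_mono2) auto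
        finally have "J L \<le> K / 2 * (L powr \<kappa> * exp L) + K1 * (L powr \<kappa> * exp L)"
          using Jstep[of L] False by simp
        also have "\<dots> = (K / 2 + K1) * (L powr \<kappa> * exp L)" by (simp add: algebra_simps)
        also have "\<dots> \<le> K * (L powr \<kappa> * exp L)" using K by (intro mult_right_mono) auto
        finally show ?thesis .
      qed
    qed
  qed
  then have "J L \<le> K * (L powr \<kappa> * exp L)" if "1 \<le> L" for L
    using that real_arch_simple[of L] by (metis add.commute add_increasing zero_le_numeral)
  then show ?thesis using K(1) unfolding J_def by blast
qed

section \<open>Square-integrable functions on the exterior domain\<close>

text \<open>Spheres are negligible, so \<open>Ext\<close> and its interior are interchangeable under
  integrals, and pointwise conditions are imposed only for \<open>norm x > 1\<close>.\<close>

lemma sphere_null: "AE x in lborel. norm (x::'a::euclidean_space) \<noteq> r"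
proof -
  have "sphere (0::'a) r \<in> null_sets lborel"
    using negligible_sphere[of 0 r] by (auto simp: null_sets_completion_iff negligible_iff_null_sets)
  then show ?thesis by (rule AE_I') auto
qed

lemma Ext_sets [measurable, simp]: "(Ext :: 'a::euclidean_space set) \<in> sets borel"
  unfolding Ext_def by auto

lemma Ext_iff: "x \<in> Ext \<longleftrightarrow> norm x \<ge> 1"
  by (auto simp: Ext_def)

lemma interior_Ext: "interior (Ext :: 'a::euclidean_space set) = {x. norm x > 1}"
proof -
  have "interior (- ball (0::'a) 1) = - cball 0 1"
    by (simp add: interior_complement)
  then show ?thesis by (auto simp: Ext_def Compl_eq_Diff_UNIV[symmetric])
qed

lemma borel_imp_LExt:
  fixes f :: "'a::euclidean_space \<Rightarrow> 'b::topological_space"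
  shows "f \<in> borel_measurable borel \<Longrightarrow> f \<in> borel_measurable LExt"
  by (intro measurable_restrict_space1) (simp add: measurable_completion)

lemma LExt_integral:
  fixes f :: "'a::euclidean_space \<Rightarrow> 'b::{banach,second_countable_topology}"
  assumes "f \<in> borel_measurable borel"
  shows "integral\<^sup>L LExt f = (\<integral>x. indicator Ext x *\<^sub>R f x \<partial>lborel)"
    and "integrable LExt f \<longleftrightarrow> integrable lborel (\<lambda>x. indicator Ext x *\<^sub>R f x)"
proof -
  have m: "(\<lambda>x. indicator Ext x *\<^sub>R f x) \<in> borel_measurable lborel" using assms by simp
  show "integral\<^sup>L LExt f = (\<integral>x. indicator Ext x *\<^sub>R f x \<partial>lborel)"
    using integral_completion[OF m] by (subst integral_restrict_space) auto
  show "integrable LExt f \<longleftrightarrow> integrable lborel (\<lambda>x. indicator Ext x *\<^sub>R f x)"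
    using integrable_completion[OF m] by (subst integrable_restrict_space) auto
qed

lemma AE_LExt: "(AE x in LExt. P x) \<longleftrightarrow> (AE x in lborel. (x::'a::euclidean_space) \<in> Ext \<longrightarrow> P x)"
  by (subst AE_restrict_space_iff) (auto simp: AE_completion_iff)

lemma AE_LExt_norm: "AE x::'a::euclidean_space in LExt. norm x > 1"
  unfolding AE_LExt using sphere_null[of 1] by eventually_elim (auto simp: Ext_iff)

lemma integrable_LExt_cont:
  fixes f :: "'a::euclidean_space \<Rightarrow> real"
  assumes "continuous_on UNIV f" "compact K" "\<And>x. norm x > 1 \<Longrightarrow> x \<notin> K \<Longrightarrow> f x = 0"
  shows "integrable LExt f"
proof -
  have fm: "f \<in> borel_measurable borel" using assms(1) by (rule borel_measurable_continuous_onI)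
  have 1: "integrable lborel (\<lambda>x. indicator K x *\<^sub>R f x)"
    by (rule borel_integrable_compact[OF assms(2) continuous_on_subset[OF assms(1)]]) simp
  have "integrable lborel (\<lambda>x. indicator Ext x *\<^sub>R f x)"
  proof (rule Bochner_Integration.integrable_bound[OF 1])
    show "AE x in lborel. norm (indicator Ext x *\<^sub>R f x) \<le> norm (indicator K x *\<^sub>R f x)"
      using sphere_null[of 1]
      by eventually_elim (use assms(3) in \<open>auto simp: indicator_def Ext_iff\<close>)
  qed (use fm in simp)
  then show ?thesis using LExt_integral(2)[OF fm] by simp
qed

lemma L2_cont:
  fixes f :: "'a::euclidean_space \<Rightarrow> 'b::euclidean_space"
  assumes "continuous_on UNIV f" "compact K" "\<And>x. norm x > 1 \<Longrightarrow> x \<notin> K \<Longrightarrow> f x = 0"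
  shows "f \<in> L2"
proof -
  have "integrable LExt (\<lambda>x. (norm (f x))\<^sup>2)"
    by (rule integrable_LExt_cont[OF _ assms(2)]) (use assms in \<open>auto intro!: continuous_intros\<close>)
  then show ?thesis
    unfolding L2_def using borel_imp_LExt[OF borel_measurable_continuous_onI[OF assms(1)]] by simp
qed

text \<open>Translation invariance makes every difference quotient in direction \<open>b\<close>
  integrate to 0, and dominated convergence passes this on to the derivative.\<close>

lemma integral_directional_derivative_eq_0:
  fixes F :: "'a::euclidean_space \<Rightarrow> real"
  assumes F: "\<And>x. (F has_derivative F' x) (at x)" and G: "continuous_on UNIV (\<lambda>x. F' x b)"
    and 0: "\<And>x. norm x > r \<Longrightarrow> F x = 0"
  shows "(\<integral>x. F' x b \<partial>lborel) = 0"
proof -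
  define G where "G x = F' x b" for x
  have Gc: "continuous_on UNIV G" using G by (simp add: G_def[abs_def])
  have Fc: "continuous_on UNIV F" by (rule has_derivative_continuous_on[OF has_derivative_at_withinI[OF F]])
  have G0: "G x = 0" if "norm x > r" for x
  proof -
    have "open {x::'a. norm x > r}" by (intro open_Collect_less continuous_intros)
    from has_derivative_transform_within_open[OF F this, where g = "\<lambda>_. 0"] that 0
    have "((\<lambda>x. 0) has_derivative F' x) (at x)" by simp
    from has_derivative_unique[OF this has_derivative_const] have "F' x = (\<lambda>x. 0)" by simp
    then show ?thesis by (simp add: G_def)
  qed
  \<comment> \<open>All difference quotients vanish outside this radius, since the step lengths are
    at most 1.\<close>
  define c where "c = r + norm b"
  have "compact (G ` cball 0 r)" by (intro compact_continuous_image continuous_on_subset[OF Gc]) auto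
  then have "bounded (G ` cball 0 r)" by (rule compact_imp_bounded)
  then obtain M where "\<forall>y\<in>G ` cball 0 r. norm y \<le> M" unfolding bounded_iff by blast
  then have M: "\<And>x. x \<in> cball 0 r \<Longrightarrow> \<bar>G x\<bar> \<le> M" by auto
  define M' where "M' = max M 0"
  have GM: "\<bar>G x\<bar> \<le> M'" for x using M[of x] G0[of x] by (cases "norm x > r") (auto simp: M'_def)
  define D where "D n x = (F (x + inverse (real (Suc n)) *\<^sub>R b) - F x) / inverse (real (Suc n))" for n x
  have line: "((\<lambda>s. F (x + s *\<^sub>R b)) has_real_derivative G (x + s *\<^sub>R b)) (at s)" for x s
  proof -
    have "((\<lambda>s. x + s *\<^sub>R b) has_derivative (\<lambda>s. s *\<^sub>R b)) (at s)"
      by (auto intro!: derivative_eq_intros)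
    from has_derivative_compose[OF this F]
    have "((\<lambda>s. F (x + s *\<^sub>R b)) has_derivative (\<lambda>t. F' (x + s *\<^sub>R b) (t *\<^sub>R b))) (at s)" .
    then show ?thesis
      unfolding has_field_derivative_def G_def
      by (rule has_derivative_eq_rhs)
        (use linear_cmul[OF has_derivative_linear[OF F]] in \<open>auto simp: fun_eq_iff\<close>)
  qed
  have Fi: "integrable lborel F"
  proof -
    have "(\<lambda>x. indicator (cball 0 r) x *\<^sub>R F x) = F" using 0 by (auto simp: indicator_def fun_eq_iff)
    then show ?thesis
      using borel_integrable_compact[OF compact_cball continuous_on_subset[OF Fc], of 0 r] by simp
  qed
  have Fm: "F \<in> borel_measurable borel" using Fc by (rule borel_measurable_continuous_onI)
  have trans: "(\<integral>x. F (x + h) \<partial>lborel) = (\<integral>x. F x \<partial>lborel)" "integrable lborel (\<lambda>x. F (x + h))" for h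
  proof -
    have "(\<integral>x. F x \<partial>lborel) = (\<integral>x. F x \<partial>distr lborel borel ((+) h))" by (simp add: lborel_distr_plus)
    also have "\<dots> = (\<integral>x. F (h + x) \<partial>lborel)" by (rule integral_distr) (use Fm in auto)
    finally show "(\<integral>x. F (x + h) \<partial>lborel) = (\<integral>x. F x \<partial>lborel)" by (simp add: add.commute)
    have "integrable (distr lborel borel ((+) h)) F" using Fi by (simp add: lborel_distr_plus)
    then have "integrable lborel (\<lambda>x. F (h + x))" by (subst (asm) integrable_distr_eq) (use Fm in auto)
    then show "integrable lborel (\<lambda>x. F (x + h))" by (simp add: add.commute)
  qed
  have D0: "(\<integral>x. D n x \<partial>lborel) = 0" for n
    unfolding D_def using trans Fi by simp
  have "(\<lambda>n. \<integral>x. D n x \<partial>lborel) \<longlonglongrightarrow> (\<integral>x. G x \<partial>lborel)"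
  proof (rule integral_dominated_convergence)
    show "G \<in> borel_measurable lborel" using borel_measurable_continuous_onI[OF Gc] by simp
    show "D n \<in> borel_measurable lborel" for n unfolding D_def[abs_def] using Fm by measurable
    show "integrable lborel (\<lambda>x::'a. indicator (cball 0 c) x * M')"
      using emeasure_compact_finite[of "cball (0::'a) c"]
      by (intro integrable_mult_left integrable_real_indicator) auto
    show "AE x in lborel. (\<lambda>n. D n x) \<longlonglongrightarrow> G x"
    proof (rule AE_I2)
      fix x
      have "(\<lambda>h. (F (x + h *\<^sub>R b) - F x) / h) \<midarrow>0\<rightarrow> G x"
        using line[of x 0] by (simp add: DERIV_def)
      moreover have "filterlim (\<lambda>n. inverse (real (Suc n))) (at 0) sequentially"
        by (intro filterlim_atI LIMSEQ_inverse_real_of_nat) auto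
      ultimately show "(\<lambda>n. D n x) \<longlonglongrightarrow> G x"
        unfolding D_def by (rule filterlim_compose)
    qed
    show "AE x in lborel. norm (D n x) \<le> indicator (cball 0 c) x * M'" for n
    proof (rule AE_I2)
      fix x
      let ?h = "inverse (real (Suc n))"
      have h: "0 < ?h" "?h \<le> 1" by (auto simp: field_simps)
      obtain z where z: "0 < z" "z < ?h" "F (x + ?h *\<^sub>R b) - F (x + 0 *\<^sub>R b) = (?h - 0) * G (x + z *\<^sub>R b)"
        using MVT2[OF h(1), of "\<lambda>s. F (x + s *\<^sub>R b)" "\<lambda>s. G (x + s *\<^sub>R b)"] line by blast
      then have D: "D n x = G (x + z *\<^sub>R b)" using h unfolding D_def by simp
      show "norm (D n x) \<le> indicator (cball 0 c) x * M'"
      proof (cases "norm x \<le> c")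
        case True
        then show ?thesis using GM D by (simp add: indicator_def)
      next
        case False
        have "norm x \<le> norm (x + z *\<^sub>R b) + norm (z *\<^sub>R b)"
            by (metis add_diff_cancel_right' norm_triangle_ineq4)
        also have "norm (z *\<^sub>R b) \<le> norm b" using z h by (simp add: mult_left_le_one_le)
        finally have "norm (x + z *\<^sub>R b) > r" using False by (simp add: c_def)
        then show ?thesis using D G0 False by simp
      qed
    qed
  qed
  then have "(\<integral>x. G x \<partial>lborel) = 0" unfolding D0 using LIMSEQ_unique tendsto_const by blast
  then show ?thesis by (simp add: G_def)
qed

section \<open>Test functions, the Cauchy-Schwarz inequality and weak gradients\<close>

lemma grad_inner_Basis: "b \<in> Basis \<Longrightarrow> grad f x \<bullet> b = frechet_derivative f (at x) b"
  unfolding grad_def by (rule inner_sum_left_Basis)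

lemma frechet_derivative_eq_0_off:
  assumes "smooth f" "open S" "\<And>y. y \<in> S \<Longrightarrow> f y = 0" "x \<in> S"
  shows "frechet_derivative f (at x) v = 0"
proof -
  from has_derivative_transform_within_open[OF smooth_imp_has_derivative[OF assms(1)] assms(2,4), where g = "\<lambda>_.
      0"] assms(3)
  have "((\<lambda>x. 0) has_derivative frechet_derivative f (at x)) (at x)" by simp
  from has_derivative_unique[OF this has_derivative_const]
  have "frechet_derivative f (at x) = (\<lambda>x. 0)" by simp
  then show ?thesis by simp
qed

lemma smooth_continuous: "smooth f \<Longrightarrow> continuous_on UNIV f"
  by (simp add: smooth_iff_smooth_on smooth_on_imp_continuous_on)

lemma smooth_frechet_continuous: "smooth f \<Longrightarrow> continuous_on UNIV (\<lambda>x. frechet_derivative f (at x) v)"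
  by (intro smooth_continuous smooth_frechet_derivative)

text \<open>Membership in \<open>C0_infty S\<close> leaves the values off \<open>S\<close> free, so
  vanishing is stated for \<open>norm x > 1\<close> only. The derivative vanishes as well because
  \<open>{x. norm x > 1} - K\<close> is open.\<close>

lemma C0_infty_D:
  assumes "f \<in> C0_infty S" "{x. norm x > 1} \<subseteq> S"
  shows "\<exists>K. smooth f \<and> compact K \<and> K \<subseteq> S \<and>
    (\<forall>x. norm (x::'a::euclidean_space) > 1 \<longrightarrow> x \<notin> K \<longrightarrow> f x = 0 \<and> (\<forall>v. frechet_derivative f (at x) v = 0))"
proof -
  obtain K where K: "smooth f" "compact K" "K \<subseteq> S" "\<And>x. x \<in> S - K \<Longrightarrow> f x = 0"
    using assms(1) unfolding C0_infty_def by auto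
  have "open ({x::'a. norm x > 1} - K)"
    using K(2) by (intro open_Diff compact_imp_closed open_Collect_less continuous_intros) auto
  then have "frechet_derivative f (at x) v = 0" if "norm x > 1" "x \<notin> K" for x v
    using frechet_derivative_eq_0_off[OF K(1), of "{x. norm x > 1} - K" x v] K(4) assms(2) that by blast
  then show ?thesis using K assms(2) by (intro exI[of _ K]) auto
qed

lemma Ext_superset: "{x. norm x > 1} \<subseteq> Ext" "{x. norm x > 1} \<subseteq> interior Ext"
  by (auto simp: Ext_iff interior_Ext)

lemma C0_infty_interior_L2:
  fixes \<phi> :: "'a::euclidean_space \<Rightarrow> real"
  assumes "\<phi> \<in> C0_infty (interior Ext)"
  shows "\<phi> \<in> L2" "(\<lambda>x. frechet_derivative \<phi> (at x) v) \<in> L2"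
proof -
  obtain K where "smooth \<phi>" "compact K" "K \<subseteq> interior Ext" "\<And>x. norm x > 1 \<Longrightarrow> x \<notin> K \<Longrightarrow> \<phi> x = 0"
    "\<And>x v. norm x > 1 \<Longrightarrow> x \<notin> K \<Longrightarrow> frechet_derivative \<phi> (at x) v = 0"
    using C0_infty_D[OF assms Ext_superset(2)] by auto
  then show "\<phi> \<in> L2" "(\<lambda>x. frechet_derivative \<phi> (at x) v) \<in> L2"
    by (auto intro!: L2_cont[of _ K] smooth_continuous smooth_frechet_continuous)
qed

lemma C0_infty_Ext_L2:
  fixes w :: "'a::euclidean_space \<Rightarrow> real"
  assumes "w \<in> C0_infty Ext"
  shows "w \<in> L2" "grad w \<in> L2"
proof -
  obtain K where "smooth w" "compact K" "K \<subseteq> Ext" "\<And>x. norm x > 1 \<Longrightarrow> x \<notin> K \<Longrightarrow> w x = 0"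
    "\<And>x v. norm x > 1 \<Longrightarrow> x \<notin> K \<Longrightarrow> frechet_derivative w (at x) v = 0"
    using C0_infty_D[OF assms Ext_superset(1)] by auto
  then show "w \<in> L2" "grad w \<in> L2"
    by (auto intro!: L2_cont[of _ K] smooth_continuous smooth_frechet_continuous continuous_intros simp:
        grad_def[abs_def])
qed

lemma L2_mult_integrable:
  fixes f g :: "'a::euclidean_space \<Rightarrow> real"
  assumes "f \<in> L2" "g \<in> L2"
  shows "integrable LExt (\<lambda>x. f x * g x)"
proof (rule Bochner_Integration.integrable_bound)
  show "integrable LExt (\<lambda>x. (norm (f x))\<^sup>2 + (norm (g x))\<^sup>2)"
    using assms by (auto simp: L2_def)
  show "(\<lambda>x. f x * g x) \<in> borel_measurable LExt" using assms by (auto simp: L2_def)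
  show "AE x in LExt. norm (f x * g x) \<le> norm ((norm (f x))\<^sup>2 + (norm (g x))\<^sup>2)"
  proof (rule AE_I2)
    fix x
    have "2 * (\<bar>f x\<bar> * \<bar>g x\<bar>) \<le> \<bar>f x\<bar>\<^sup>2 + \<bar>g x\<bar>\<^sup>2" using sum_squares_bound[of "\<bar>f x\<bar>" "\<bar>g x\<bar>"] by simp
    moreover have "0 \<le> \<bar>f x\<bar> * \<bar>g x\<bar>" by simp
    ultimately have "\<bar>f x\<bar> * \<bar>g x\<bar> \<le> \<bar>f x\<bar>\<^sup>2 + \<bar>g x\<bar>\<^sup>2" by linarith
    then show "norm (f x * g x) \<le> norm ((norm (f x))\<^sup>2 + (norm (g x))\<^sup>2)" by (simp add: abs_mult)
  qed
qed

lemma L2_diff: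
  fixes f g :: "'a::euclidean_space \<Rightarrow> 'b::euclidean_space"
  assumes "f \<in> L2" "g \<in> L2"
  shows "(\<lambda>x. f x - g x) \<in> L2"
proof -
  have m: "(\<lambda>x. f x - g x) \<in> borel_measurable LExt" using assms by (auto simp: L2_def)
  have "integrable LExt (\<lambda>x. (norm (f x - g x))\<^sup>2)"
  proof (rule Bochner_Integration.integrable_bound)
    show "integrable LExt (\<lambda>x. 2 * (norm (f x))\<^sup>2 + 2 * (norm (g x))\<^sup>2)"
      using assms by (auto simp: L2_def)
    show "AE x in LExt. norm ((norm (f x - g x))\<^sup>2) \<le> norm (2 * (norm (f x))\<^sup>2 + 2 * (norm (g x))\<^sup>2)"
    proof (rule AE_I2)
      fix x
      have "(norm (f x - g x))\<^sup>2 \<le> (norm (f x) + norm (g x))\<^sup>2" by (intro power_mono norm_triangle_ineq4) auto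
      also have "\<dots> \<le> 2 * (norm (f x))\<^sup>2 + 2 * (norm (g x))\<^sup>2"
        using sum_squares_bound[of "norm (f x)" "norm (g x)"] by (simp add: power2_sum)
      finally show "norm ((norm (f x - g x))\<^sup>2) \<le> norm (2 * (norm (f x))\<^sup>2 + 2 * (norm (g x))\<^sup>2)" by simp
    qed
  qed (use m in measurable)
  then show ?thesis using m by (simp add: L2_def)
qed

lemma L2_norm_nonneg: "L2_norm f \<ge> 0"
  by (simp add: L2_norm_def)

lemma L2_norm_sq: "(L2_norm f)\<^sup>2 = (\<integral>x. (norm (f x))\<^sup>2 \<partial>LExt)"
  by (simp add: L2_norm_def)

text \<open>The integral of \<open>(f x - t * g x)\<^sup>2\<close> is a nonnegative quadratic in
  \<open>t\<close>, evaluated at its minimiser; if the leading coefficient is 0, then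
  \<open>g\<close> vanishes almost everywhere.\<close>

lemma L2_Cauchy_Schwarz:
  fixes f g :: "'a::euclidean_space \<Rightarrow> real"
  assumes "f \<in> L2" "g \<in> L2"
  shows "\<bar>\<integral>x. f x * g x \<partial>LExt\<bar> \<le> L2_norm f * L2_norm g"
proof -
  define I where "I = (\<integral>x. f x * g x \<partial>LExt)"
  have fi: "integrable LExt (\<lambda>x. (f x)\<^sup>2)" and gi: "integrable LExt (\<lambda>x. (g x)\<^sup>2)"
    using assms by (auto simp: L2_def)
  have fg: "integrable LExt (\<lambda>x. f x * g x)" by (rule L2_mult_integrable[OF assms])
  have q: "0 \<le> (L2_norm f)\<^sup>2 - 2 * t * I + t\<^sup>2 * (L2_norm g)\<^sup>2" for t
  proof -
    have "0 \<le> (\<integral>x. (f x - t * g x)\<^sup>2 \<partial>LExt)" by simp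
    also have "\<dots> = (\<integral>x. (f x)\<^sup>2 - 2 * t * (f x * g x) + t\<^sup>2 * (g x)\<^sup>2 \<partial>LExt)"
      by (intro Bochner_Integration.integral_cong) (auto simp: power2_eq_square algebra_simps)
    also have "\<dots> = (L2_norm f)\<^sup>2 - 2 * t * I + t\<^sup>2 * (L2_norm g)\<^sup>2"
      using fi gi fg by (simp add: L2_norm_sq I_def)
    finally show ?thesis .
  qed
  show ?thesis
  proof (cases "L2_norm g = 0")
    case True
    then have "(\<integral>x. (g x)\<^sup>2 \<partial>LExt) = 0" using L2_norm_sq[of g] by simp
    then have "AE x in LExt. (g x)\<^sup>2 = 0" using gi by (subst (asm) integral_nonneg_eq_0_iff_AE) auto
    then have "AE x in LExt. f x * g x = 0" by eventually_elim auto
    then have "(\<integral>x. f x * g x \<partial>LExt) = 0" by (rule integral_eq_zero_AE)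
    then show ?thesis using True by simp
  next
    case False
    then have b: "(L2_norm g)\<^sup>2 > 0" by simp
    have "A - 2 * (I / B) * I + (I / B)\<^sup>2 * B = A - I\<^sup>2 / B" if "B > 0" for A B
      using that by (simp add: field_simps power2_eq_square)
    then have "0 \<le> (L2_norm f)\<^sup>2 - I\<^sup>2 / (L2_norm g)\<^sup>2"
      using q[of "I / (L2_norm g)\<^sup>2"] b by (simp only:)
    then have "I\<^sup>2 \<le> (L2_norm f * L2_norm g)\<^sup>2" using b by (simp add: field_simps power_mult_distrib)
    then show ?thesis unfolding I_def[symmetric]
      by (metis abs_le_square_iff abs_of_nonneg L2_norm_nonneg mult_nonneg_nonneg)
  qed
qed

text \<open>The product of \<open>w\<close> with a test function supported away from the sphere
  extends by 0 across the ball, and directional derivatives of the extension integrate to 0. Thus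
  the approximants in \<open>has_trace\<close> lie in \<open>H1\<close>, with their classical
  gradient as a weak gradient.\<close>

lemma C0_infty_Ext_has_weak_grad:
  fixes w :: "'a::euclidean_space \<Rightarrow> real"
  assumes "w \<in> C0_infty Ext"
  shows "has_weak_grad w (grad w)"
  unfolding has_weak_grad_def
proof (intro ballI)
  fix \<phi> :: "'a \<Rightarrow> real" and b :: 'a
  assume \<phi>: "\<phi> \<in> C0_infty (interior Ext)" and b: "b \<in> Basis"
  let ?w = "\<lambda>x. frechet_derivative w (at x)" and ?p = "\<lambda>x. frechet_derivative \<phi> (at x)"
  have w: "smooth w" using assms by (simp add: C0_infty_def)
  obtain K where K: "smooth \<phi>" "compact K" "K \<subseteq> interior Ext" "\<And>x. norm x > 1 \<Longrightarrow> x \<notin> K \<Longrightarrow> \<phi> x = 0"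
    "\<And>x v. norm x > 1 \<Longrightarrow> x \<notin> K \<Longrightarrow> ?p x v = 0"
    using C0_infty_D[OF \<phi> Ext_superset(2)] by auto
  let ?O = "{x::'a. norm x > 1}"
  have O: "open ?O" by (intro open_Collect_less continuous_intros)
  have K': "open (- K)" using K(2) by (simp add: compact_imp_closed open_Compl)
  have UN: "?O \<union> - K = UNIV" using K(3) by (auto simp: interior_Ext)
  \<comment> \<open>The case distinction overrides the values of \<open>\<phi>\<close> inside the
    ball, which are unconstrained.\<close>
  define F where "F x = (if norm x > 1 then w x * \<phi> x else 0)" for x
  define F' where "F' x v = (if norm x > 1 then w x * ?p x v + ?w x v * \<phi> x else 0)" for x v
  have F0: "F x = 0" if "x \<notin> K" for x using K(4)[of x] that by (auto simp: F_def)
  have der: "(F has_derivative F' x) (at x)" for x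
  proof (cases "norm x > 1")
    case True
    have "((\<lambda>x. w x * \<phi> x) has_derivative (\<lambda>v. w x * ?p x v + ?w x v * \<phi> x)) (at x)"
      by (intro has_derivative_mult smooth_imp_has_derivative w K)
    then have "(F has_derivative (\<lambda>v. w x * ?p x v + ?w x v * \<phi> x)) (at x)"
      by (rule has_derivative_transform_within_open[OF _ O]) (use True in \<open>auto simp: F_def\<close>)
    then show ?thesis using True by (simp add: F'_def[abs_def])
  next
    case False
    then have "x \<notin> K" using UN K(3) by (auto simp: interior_Ext)
    have "((\<lambda>x. 0) has_derivative (\<lambda>v. 0)) (at x)" by simp
    then have "(F has_derivative (\<lambda>v. 0)) (at x)"
      by (rule has_derivative_transform_within_open[OF _ K']) (use \<open>x \<notin> K\<close> F0 in auto)
    then show ?thesis using False by (simp add: F'_def[abs_def])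
  qed
  have "continuous_on (?O \<union> - K) (\<lambda>x. F' x b)"
  proof (rule continuous_on_open_Un[OF O K'])
    have "continuous_on ?O (\<lambda>x. w x * ?p x b + ?w x b * \<phi> x)"
      by (intro continuous_intros continuous_on_subset[OF smooth_continuous] continuous_on_subset[OF
          smooth_frechet_continuous] w K) auto
    then show "continuous_on ?O (\<lambda>x. F' x b)"
        by (rule continuous_on_cong[THEN iffD1, rotated 2]) (auto simp: F'_def)
    have "continuous_on (- K) (\<lambda>x. 0)" by simp
    then show "continuous_on (- K) (\<lambda>x. F' x b)"
        by (rule continuous_on_cong[THEN iffD1, rotated 2]) (use K in \<open>auto simp: F'_def\<close>)
  qed
  then have cont: "continuous_on UNIV (\<lambda>x. F' x b)" by (simp only: UN)
  obtain r where "\<forall>x\<in>K. norm x \<le> r" using compact_imp_bounded[OF K(2)] unfolding bounded_iff by blast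
  then have r: "K \<subseteq> cball 0 r" by auto
  have "F x = 0" if "norm x > r" for x
    by (rule F0) (use r that in auto)
  from integral_directional_derivative_eq_0[OF der cont this]
  have "(\<integral>x. F' x b \<partial>lborel) = 0" by blast
  also have "(\<integral>x. F' x b \<partial>lborel) = (\<integral>x. indicator Ext x *\<^sub>R (w x * ?p x b + ?w x b * \<phi> x) \<partial>lborel)"
  proof (rule integral_cong_AE)
    show "(\<lambda>x. F' x b) \<in> borel_measurable lborel" using borel_measurable_continuous_onI[OF cont] by simp
    have "(\<lambda>x. w x * ?p x b + ?w x b * \<phi> x) \<in> borel_measurable borel"
      by (intro borel_measurable_continuous_onI continuous_intros smooth_continuous smooth_frechet_continuous w
          K)
    then show "(\<lambda>x. indicator Ext x *\<^sub>R (w x * ?p x b + ?w x b * \<phi> x)) \<in> borel_measurable lborel" by simp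
    show "AE x in lborel. F' x b = indicator Ext x *\<^sub>R (w x * ?p x b + ?w x b * \<phi> x)"
      using sphere_null[of 1] by eventually_elim (auto simp: F'_def indicator_def Ext_iff)
  qed
  also have "\<dots> = (\<integral>x. w x * ?p x b + ?w x b * \<phi> x \<partial>LExt)"
    by (rule LExt_integral(1)[symmetric])
      (intro borel_measurable_continuous_onI continuous_intros smooth_continuous smooth_frechet_continuous w K)
  also have "\<dots> = (\<integral>x. w x * ?p x b \<partial>LExt) + (\<integral>x. ?w x b * \<phi> x \<partial>LExt)"
  proof (rule Bochner_Integration.integral_add)
    show "integrable LExt (\<lambda>x. w x * ?p x b)"
      by (intro L2_mult_integrable C0_infty_Ext_L2 C0_infty_interior_L2 assms \<phi>)
    show "integrable LExt (\<lambda>x. ?w x b * \<phi> x)"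
    proof (rule integrable_LExt_cont[of _ K])
      show "continuous_on UNIV (\<lambda>x. ?w x b * \<phi> x)"
        by (intro continuous_on_mult smooth_continuous[OF K(1)] smooth_frechet_continuous w)
    qed (use K in auto)
  qed
  finally show "(\<integral>x. w x * (grad \<phi> x \<bullet> b) \<partial>LExt) = - (\<integral>x. grad w x \<bullet> b * \<phi> x \<partial>LExt)"
    using b by (simp add: grad_inner_Basis)
qed

lemma C0_infty_Ext_H1: "w \<in> C0_infty Ext \<Longrightarrow> w \<in> H1"
  using C0_infty_Ext_has_weak_grad[of w] C0_infty_Ext_L2[of w] by (auto simp: H1_def)

lemma L2_inner:
  fixes G :: "'a::euclidean_space \<Rightarrow> 'b::euclidean_space"
  assumes "G \<in> L2"
  shows "(\<lambda>x. G x \<bullet> c) \<in> L2"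
proof -
  have m: "(\<lambda>x. G x \<bullet> c) \<in> borel_measurable LExt" using assms by (auto simp: L2_def)
  have "integrable LExt (\<lambda>x. (norm (G x \<bullet> c))\<^sup>2)"
  proof (rule Bochner_Integration.integrable_bound)
    show "integrable LExt (\<lambda>x. (norm c)\<^sup>2 * (norm (G x))\<^sup>2)" using assms by (auto simp: L2_def)
    show "AE x in LExt. norm ((norm (G x \<bullet> c))\<^sup>2) \<le> norm ((norm c)\<^sup>2 * (norm (G x))\<^sup>2)"
    proof (rule AE_I2)
      fix x
      have "\<bar>G x \<bullet> c\<bar>\<^sup>2 \<le> (norm (G x) * norm c)\<^sup>2" by (intro power_mono Cauchy_Schwarz_ineq2) auto
      then show "norm ((norm (G x \<bullet> c))\<^sup>2) \<le> norm ((norm c)\<^sup>2 * (norm (G x))\<^sup>2)"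
        by (simp add: power_mult_distrib mult.commute)
    qed
  qed (use m in measurable)
  then show ?thesis using m by (simp add: L2_def)
qed

lemma has_weak_grad_diff:
  assumes "f1 \<in> L2" "f2 \<in> L2" "G1 \<in> L2" "G2 \<in> L2" "has_weak_grad f1 G1" "has_weak_grad f2 G2"
  shows "has_weak_grad (\<lambda>x. f1 x - f2 x) (\<lambda>x. G1 x - G2 x)"
  unfolding has_weak_grad_def
proof (intro ballI)
  fix \<phi> :: "'a \<Rightarrow> real" and b :: 'a
  assume \<phi>: "\<phi> \<in> C0_infty (interior Ext)" and b: "b \<in> Basis"
  have g: "(\<lambda>x. grad \<phi> x \<bullet> b) \<in> L2"
    using C0_infty_interior_L2(2)[OF \<phi>, of b] b by (simp add: grad_inner_Basis)
  have "(\<integral>x. (f1 x - f2 x) * (grad \<phi> x \<bullet> b) \<partial>LExt) = (\<integral>x. f1 x * (grad \<phi> x \<bullet> b) \<partial>LExt) - (\<integral>x. f2 x * (grad \<phi> x \<bullet>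
      b) \<partial>LExt)"
    unfolding left_diff_distrib by (intro Bochner_Integration.integral_diff L2_mult_integrable g assms)
  also have "\<dots> = - ((\<integral>x. (G1 x \<bullet> b) * \<phi> x \<partial>LExt) - (\<integral>x. (G2 x \<bullet> b) * \<phi> x \<partial>LExt))"
    using assms(5,6) \<phi> b by (simp add: has_weak_grad_def)
  also have "\<dots> = - (\<integral>x. (G1 x - G2 x) \<bullet> b * \<phi> x \<partial>LExt)"
    unfolding inner_diff_left left_diff_distrib
    by (subst Bochner_Integration.integral_diff) (auto intro!: L2_mult_integrable L2_inner
        C0_infty_interior_L2(1)[OF \<phi>] assms)
  finally show "(\<integral>x. (f1 x - f2 x) * (grad \<phi> x \<bullet> b) \<partial>LExt) = - (\<integral>x. (G1 x - G2 x) \<bullet> b * \<phi> x \<partial>LExt)" .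
qed

lemma weak_grad:
  assumes "f \<in> H1"
  shows "weak_grad f \<in> L2" "has_weak_grad f (weak_grad f)"
proof -
  have "\<exists>G. G \<in> L2 \<and> has_weak_grad f G" using assms by (auto simp: H1_def)
  then have "weak_grad f \<in> L2 \<and> has_weak_grad f (weak_grad f)"
    unfolding weak_grad_def by (rule someI_ex)
  then show "weak_grad f \<in> L2" "has_weak_grad f (weak_grad f)" by auto
qed

lemma H1_L2: "f \<in> H1 \<Longrightarrow> f \<in> L2"
  by (simp add: H1_def)

lemma H1_diff:
  assumes "f \<in> H1" "g \<in> H1"
  shows "(\<lambda>x. f x - g x) \<in> H1"
  unfolding H1_def
proof (intro CollectI conjI bexI)
  show "has_weak_grad (\<lambda>x. f x - g x) (\<lambda>x. weak_grad f x - weak_grad g x)"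
    by (intro has_weak_grad_diff H1_L2 weak_grad assms)
qed (intro L2_diff H1_L2 weak_grad assms)+

lemma H1_norm_ge: "L2_norm f \<le> H1_norm f" "L2_norm (weak_grad f) \<le> H1_norm f"
  unfolding H1_norm_def by (auto intro!: real_le_rsqrt)

section \<open>Green's formula for functions with zero trace\<close>

lemma smooth_on_sum: "finite I \<Longrightarrow> (\<And>i. i \<in> I \<Longrightarrow> smooth_on S (f i)) \<Longrightarrow> smooth_on S (\<lambda>x. \<Sum>i\<in>I. f i x)"
  by (induction I rule: finite_induct) (auto intro: smooth_on_const smooth_on_add)

lemma smooth_on_inner_self: "smooth_on UNIV (\<lambda>x::'a::euclidean_space. x \<bullet> x)"
proof -
  have "smooth_on UNIV (\<lambda>x::'a. \<Sum>b\<in>Basis. (x \<bullet> b) * (x \<bullet> b))"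
    by (intro smooth_on_sum smooth_on_mult smooth_on_bounded_linear bounded_linear_inner_left) auto
  then show ?thesis by (simp add: euclidean_inner[symmetric])
qed

lemma smooth_radial: "smooth_on UNIV \<eta> \<Longrightarrow> smooth_on UNIV (\<lambda>x::'a::euclidean_space. \<eta> (x \<bullet> x))"
  by (rule smooth_on_compose[OF _ smooth_on_inner_self]) auto

lemma has_derivative_radial:
  fixes x :: "'a::euclidean_space"
  assumes "smooth_on UNIV \<eta>"
  shows "((\<lambda>x. \<eta> (x \<bullet> x)) has_derivative (\<lambda>v. 2 * deriv \<eta> (x \<bullet> x) * (x \<bullet> v))) (at x)"
proof -
  have 1: "((\<lambda>x. x \<bullet> x) has_derivative (\<lambda>v. x \<bullet> v + v \<bullet> x)) (at x)"
    by (auto intro!: derivative_eq_intros)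
  have "(\<eta> has_derivative (\<lambda>t. deriv \<eta> (x \<bullet> x) * t)) (at (x \<bullet> x))"
    using smooth_on_deriv(1)[OF open_UNIV assms, of "x \<bullet> x"] by (simp add: has_field_derivative_def)
  from has_derivative_compose[OF 1 this] show ?thesis
    by (rule has_derivative_eq_rhs) (auto simp: inner_commute algebra_simps)
qed

lemma grad_radial:
  fixes x :: "'a::euclidean_space"
  assumes "smooth_on UNIV \<eta>"
  shows "grad (\<lambda>y. \<eta> (y \<bullet> y)) x = (2 * deriv \<eta> (x \<bullet> x)) *\<^sub>R x"
proof -
  have "frechet_derivative (\<lambda>y. \<eta> (y \<bullet> y)) (at x) = (\<lambda>v. 2 * deriv \<eta> (x \<bullet> x) * (x \<bullet> v))"
    by (rule frechet_derivative_at[OF has_derivative_radial[OF assms], symmetric])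
  then have "grad (\<lambda>y. \<eta> (y \<bullet> y)) x = (\<Sum>b\<in>Basis. (2 * deriv \<eta> (x \<bullet> x)) *\<^sub>R ((x \<bullet> b) *\<^sub>R b))"
    by (simp add: grad_def)
  also have "\<dots> = (2 * deriv \<eta> (x \<bullet> x)) *\<^sub>R x"
    unfolding scaleR_sum_right[symmetric] euclidean_representation ..
  finally show ?thesis .
qed

lemma frechet_radial_mult:
  fixes x b :: "'a::euclidean_space"
  assumes "smooth_on UNIV \<eta>"
  shows "frechet_derivative (\<lambda>x. \<eta> (x \<bullet> x) * (x \<bullet> b)) (at x) v
    = 2 * deriv \<eta> (x \<bullet> x) * (x \<bullet> v) * (x \<bullet> b) + \<eta> (x \<bullet> x) * (v \<bullet> b)"
proof -
  have "((\<lambda>x. x \<bullet> b) has_derivative (\<lambda>v. v \<bullet> b)) (at x)" by (auto intro!: derivative_eq_intros)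
  from has_derivative_mult[OF has_derivative_radial[OF assms] this]
  have "((\<lambda>x. \<eta> (x \<bullet> x) * (x \<bullet> b)) has_derivative
     (\<lambda>v. \<eta> (x \<bullet> x) * (v \<bullet> b) + 2 * deriv \<eta> (x \<bullet> x) * (x \<bullet> v) * (x \<bullet> b))) (at x)" .
  from frechet_derivative_at[OF this, symmetric] show ?thesis by simp
qed

lemma norm_gt_1_iff: "norm (x::'a::euclidean_space) > 1 \<longleftrightarrow> x \<bullet> x > 1"
  by (metis norm_eq_1 norm_eq_sqrt_inner real_sqrt_gt_1_iff)

lemma norm_ge_1_iff: "norm (x::'a::euclidean_space) \<ge> 1 \<longleftrightarrow> x \<bullet> x \<ge> 1"
  by (metis norm_eq_sqrt_inner real_sqrt_ge_1_iff)

section \<open>Thin layers around the unit sphere\<close>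

lemma sgn_measurable: "(sgn :: 'a::euclidean_space \<Rightarrow> 'a) \<in> borel_measurable borel"
proof -
  have "(\<lambda>x::'a. inverse (norm x) *\<^sub>R x) \<in> borel_measurable borel" by measurable
  then show ?thesis by (simp add: sgn_div_norm[abs_def])
qed

text \<open>In this form the layer integrals can be compared with \<^const>\<open>sphere_measure\<close>, which is defined by cones.\<close>

lemma integral_sgn_ball:
  fixes g :: "'a::euclidean_space \<Rightarrow> real"
  assumes g: "g \<in> borel_measurable borel" and a: "a > 0"
  shows "(\<integral>x. indicator (ball 0 a) x * g (sgn x) \<partial>lborel) = a ^ DIM('a) * (\<integral>x. indicator (ball 0 1) x * g (sgn
      x) \<partial>lborel)"
proof -
  note [measurable] = g sgn_measurable
  let ?f = "\<lambda>x. indicator (ball 0 a) x * g (sgn x)"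
  have gs: "(\<lambda>x. g (sgn x)) \<in> borel_measurable borel" by (rule measurable_compose[OF sgn_measurable g])
  have m: "?f \<in> borel_measurable borel" by (intro borel_measurable_times gs borel_measurable_indicator) auto
  have "(\<integral>x. ?f x \<partial>lborel) = (\<integral>x. ?f x \<partial>density (distr lborel borel (\<lambda>x. 0 + a *\<^sub>R x)) (\<lambda>_. \<bar>a\<bar>^DIM('a)))"
    using lborel_affine[of a "0::'a"] a by simp
  also have "\<dots> = (\<integral>x. \<bar>a\<bar>^DIM('a) *\<^sub>R ?f x \<partial>distr lborel borel (\<lambda>x. 0 + a *\<^sub>R x))"
    by (subst integral_density) (use m in auto)
  also have "\<dots> = a^DIM('a) * (\<integral>x. ?f x \<partial>distr lborel borel (\<lambda>x. 0 + a *\<^sub>R x))"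
    using a by simp
  also have "(\<integral>x. ?f x \<partial>distr lborel borel (\<lambda>x. 0 + a *\<^sub>R x)) = (\<integral>x. ?f (0 + a *\<^sub>R x) \<partial>lborel)"
    by (rule integral_distr) (use m in auto)
  \<comment> \<open>Scaling by \<open>a > 0\<close> maps the unit ball onto \<open>ball 0 a\<close>
    and leaves \<open>sgn\<close> unchanged.\<close>
  also have "(\<lambda>x. ?f (0 + a *\<^sub>R x)) = (\<lambda>x::'a. indicator (ball 0 1) x * g (sgn x))"
    using a by (auto simp: fun_eq_iff indicator_def sgn_scaleR)
  finally show ?thesis .
qed

text \<open>By convexity the power lies below its chord over the unit interval, of slope
  \<open>2 ^ n - 1\<close>; the induction establishes this chord bound.\<close>

lemma pow_le_linear:
  fixes d :: real
  assumes "0 \<le> d" "d \<le> 1"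
  shows "(1 + d) ^ n - 1 \<le> d * 2 ^ n"
proof -
  have "(1 + d) ^ n \<le> 1 + d * (2 ^ n - 1)"
  proof (induction n)
    case (Suc n)
    have "(1 + d) ^ Suc n \<le> (1 + d) * (1 + d * (2 ^ n - 1))"
      using Suc assms by (auto intro!: mult_left_mono)
    also have "\<dots> = 1 + d * 2 ^ n + d * d * (2 ^ n - 1)" by (simp add: algebra_simps)
    also have "d * d * (2 ^ n - 1) \<le> d * (2 ^ n - 1)"
      using assms by (intro mult_right_mono mult_left_le) (auto simp: self_le_power)
    finally show ?case by (simp add: algebra_simps)
  qed simp
  also have "\<dots> \<le> 1 + d * 2 ^ n" using assms by (simp add: algebra_simps)
  finally show ?thesis by simp
qed

text \<open>The width \<open>2 / n\<close> matches the transition zone of the cutoff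
  \<open>h n\<close> below, where \<open>n * (x \<bullet> x - 1) \<le> 2\<close>.\<close>

abbreviation "layer n \<equiv> {x. 1 \<le> norm x \<and> norm x < 1 + 2 / real n}"

text \<open>On a thin layer the continuous \<open>w\<close> is uniformly close to its value at the
  radial projection \<open>sgn x\<close>, and a function of \<open>sgn x\<close> integrates over the
  layer to \<open>(1 + 2 / n) ^ DIM('a) - 1\<close> times its integral over the unit ball, a factor
  of order \<open>1 / n\<close>.\<close>

lemma layer_integral_le:
  fixes w :: "'a::euclidean_space \<Rightarrow> real"
  assumes w: "continuous_on UNIV w" and e: "e > 0"
  shows "\<forall>\<^sub>F n in sequentially. real n * (\<integral>x. indicator (layer n) x * \<bar>w x\<bar> \<partial>lborel)
    \<le> 2 * 2 ^ DIM('a) * ((\<integral>x. indicator (ball 0 1) x * \<bar>w (sgn x)\<bar> \<partial>lborel) + e)"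
proof -
  note [measurable] = sgn_measurable
  have wm [measurable]: "w \<in> borel_measurable borel" using w by (rule borel_measurable_continuous_onI)
  define om where "om = measure lborel (ball (0::'a) 1)"
  \<comment> \<open>The oscillation allowed on the layer: its total contribution
    \<open>e1 * om\<close> is then at most \<open>e\<close>.\<close>
  define e1 where "e1 = e / (om + 1)"
  have om: "om \<ge> 0" by (simp add: om_def)
  have e1: "e1 > 0" "e1 * om \<le> e"
  proof -
    have "e1 * om \<le> e1 * (om + 1)" using e om by (intro mult_left_mono) (auto simp: e1_def)
    also have "\<dots> = e" using om by (simp add: e1_def)
    finally show "e1 * om \<le> e" .
  qed (use e om in \<open>simp add: e1_def\<close>)
  have "uniformly_continuous_on (cball 0 2) w"
    by (intro compact_uniformly_continuous continuous_on_subset[OF w]) auto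
  then obtain d where d: "d > 0" "\<And>x y. x \<in> cball 0 2 \<Longrightarrow> y \<in> cball 0 2 \<Longrightarrow> dist y x < d \<Longrightarrow> dist (w y) (w x) < e1"
    unfolding uniformly_continuous_on_def using e1(1) by metis
  have "\<forall>\<^sub>F n in sequentially. real n > max 2 (2 / d)"
    by (intro eventually_compose_filterlim[OF eventually_gt_at_top filterlim_real_sequentially])
  then show ?thesis
  proof eventually_elim
    case (elim n)
    then have n: "real n > 2" "2 / real n < d" "2 / real n \<le> 1" using d(1) by (auto simp: field_simps)
    let ?a = "1 + 2 / real n"
    let ?g = "\<lambda>y. \<bar>w y\<bar> + e1"
    have lay: "(indicator (layer n) x :: real) = indicator (ball 0 ?a) x - indicator (ball 0 1) x" for x :: 'a
    proof -
      have "0 < 2 / real n" using n by simp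
      then have "norm x < 1 \<Longrightarrow> norm x < ?a" by linarith
      then show ?thesis by (auto simp: indicator_def)
    qed
    have ptw: "\<bar>w x\<bar> \<le> \<bar>w (sgn x)\<bar> + e1" if "x \<in> layer n" for x
    proof -
      have x: "norm x \<ge> 1" "norm x < 1 + 2 / real n" using that by auto
      have s: "norm (sgn x) = 1" using x by (auto simp: norm_sgn)
      have "x - sgn x = (norm x - 1) *\<^sub>R sgn x" using x s
          by (cases "x = 0") (auto simp: sgn_div_norm algebra_simps)
      then have "dist x (sgn x) = norm x - 1" using s x by (simp add: dist_norm)
      then have "dist x (sgn x) < d" using x n by linarith
      then have "dist (w x) (w (sgn x)) < e1" 
      proof (intro d)
        have "norm x \<le> 2" using x n by linarith
        then show "x \<in> cball 0 2" by simp
      qed (use s in auto)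
      then show ?thesis by (simp add: dist_real_def)
    qed
    have bnd: "\<exists>B. \<forall>x. \<bar>w (sgn x)\<bar> \<le> B"
    proof -
      have "compact (w ` cball 0 1)" by (intro compact_continuous_image continuous_on_subset[OF w]) auto
      then obtain B where "\<forall>y\<in>w ` cball 0 1. norm y \<le> B" using compact_imp_bounded bounded_iff by metis
      moreover have "sgn x \<in> cball 0 1" for x :: 'a by (simp add: norm_sgn)
      ultimately show ?thesis by (intro exI[of _ B]) auto
    qed
    then obtain B where B: "\<And>x. \<bar>w (sgn x)\<bar> \<le> B" by blast
    have ib: "integrable lborel (\<lambda>x::'a. indicator (ball 0 r) x * c)" for r c :: real
      using emeasure_lborel_ball_finite[of "0::'a" r]
          by (intro integrable_mult_left integrable_real_indicator) auto
    have iw: "integrable lborel (\<lambda>x. indicator (ball 0 r) x * \<bar>w (sgn x)\<bar>)" for r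
      by (rule Bochner_Integration.integrable_bound[OF ib[of r B]]) (use B in \<open>auto simp: indicator_def intro!:
          AE_I2 order_trans[OF B abs_ge_self]\<close>)
    have ig: "integrable lborel (\<lambda>x. indicator (ball 0 r) x * ?g (sgn x))" for r
      using Bochner_Integration.integrable_add[OF iw[of r] ib[of r e1]] by (simp add: distrib_left)
    have "(\<integral>x. indicator (layer n) x * \<bar>w x\<bar> \<partial>lborel) \<le> (\<integral>x. indicator (ball 0 ?a) x * ?g (sgn x) - indicator
        (ball 0 1) x * ?g (sgn x) \<partial>lborel)"
    proof (rule integral_mono')
      show "integrable lborel (\<lambda>x. indicator (ball 0 ?a) x * ?g (sgn x) - indicator (ball 0 1) x * ?g (sgn x))"
        by (intro Bochner_Integration.integrable_diff ig)
      fix x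
      have "indicator (layer n) x * \<bar>w x\<bar> \<le> indicator (layer n) x * ?g (sgn x)"
        using ptw[of x] by (auto simp: indicator_def)
      then show le: "indicator (layer n) x * \<bar>w x\<bar> \<le> indicator (ball 0 ?a) x * ?g (sgn x) - indicator (ball 0 1)
          x * ?g (sgn x)"
        by (simp add: lay left_diff_distrib)
      have "0 \<le> indicator (layer n) x * \<bar>w x\<bar>" by simp
      with le show "0 \<le> indicator (ball 0 ?a) x * ?g (sgn x) - indicator (ball 0 1) x * ?g (sgn x)"
        by (rule order_trans[rotated])
    qed
    also have "\<dots> = (?a ^ DIM('a) - 1) * (\<integral>x. indicator (ball 0 1) x * ?g (sgn x) \<partial>lborel)"
    proof -
      have "(\<integral>x. indicator (ball 0 ?a) x * ?g (sgn x) \<partial>lborel) = ?a ^ DIM('a) * (\<integral>x. indicator (ball 0 1) x * ?g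
          (sgn x) \<partial>lborel)"
        by (rule integral_sgn_ball) (use n in \<open>auto simp: add_pos_pos\<close>)
      then show ?thesis by (simp only: Bochner_Integration.integral_diff[OF ig ig] left_diff_distrib mult_1)
    qed
    also have "\<dots> \<le> (2 / real n * 2 ^ DIM('a)) * (\<integral>x. indicator (ball 0 1) x * ?g (sgn x) \<partial>lborel)"
      using n e1 by (intro mult_right_mono pow_le_linear integral_nonneg_AE) (auto intro!: AE_I2
          mult_nonneg_nonneg)
    also have "(\<integral>x. indicator (ball 0 1) x * ?g (sgn x) \<partial>lborel) = (\<integral>x. indicator (ball 0 1) x * \<bar>w (sgn x)\<bar>
        \<partial>lborel) + e1 * om"
      using Bochner_Integration.integral_add[OF iw[of 1] ib[of 1 e1]] by (simp add: distrib_left om_def)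
    also have "(2 / real n * 2 ^ DIM('a)) * ((\<integral>x. indicator (ball 0 1) x * \<bar>w (sgn x)\<bar> \<partial>lborel) + e1 * om)
      \<le> (2 / real n * 2 ^ DIM('a)) * ((\<integral>x. indicator (ball 0 1) x * \<bar>w (sgn x)\<bar> \<partial>lborel) + e)"
      using e1 by (intro mult_left_mono) auto
    finally have "(\<integral>x. indicator (layer n) x * \<bar>w x\<bar> \<partial>lborel) \<le> (2 / real n * 2 ^ DIM('a)) * ((\<integral>x. indicator
        (ball 0 1) x * \<bar>w (sgn x)\<bar> \<partial>lborel) + e)"
 .
    then have "real n * (\<integral>x. indicator (layer n) x * \<bar>w x\<bar> \<partial>lborel) \<le> real n * ((2 / real n * 2 ^ DIM('a)) *
        ((\<integral>x. indicator (ball 0 1) x * \<bar>w (sgn x)\<bar> \<partial>lborel) + e))"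
      by (intro mult_left_mono) auto
    then show ?case using n by simp
  qed
qed

lemma sphere_integral:
  fixes f :: "'a::euclidean_space \<Rightarrow> real"
  assumes [measurable]: "f \<in> borel_measurable borel"
  shows "(\<integral>x. f x \<partial>sphere_measure) = real DIM('a) * (\<integral>x. indicator (ball 0 1) x * f (sgn x) \<partial>lborel)"
proof -
  note [measurable] = sgn_measurable
  let ?M = "distr (restrict_space lborel (ball 0 1)) borel (sgn :: 'a \<Rightarrow> 'a)"
  have "scale_measure (of_nat DIM('a)) ?M = density ?M (\<lambda>_. ennreal (real DIM('a)))"
    by (rule measure_eqI) (auto simp: emeasure_density_const ennreal_of_nat_eq_real_of_nat)
  then have "(\<integral>x. f x \<partial>sphere_measure) = (\<integral>x. f x \<partial>density ?M (\<lambda>_. ennreal (real DIM('a))))"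
    by (simp add: sphere_measure_def)
  also have "\<dots> = (\<integral>x. real DIM('a) *\<^sub>R f x \<partial>?M)" by (rule integral_density) auto
  also have "\<dots> = real DIM('a) * (\<integral>x. f x \<partial>?M)" by simp
  also have "(\<integral>x. f x \<partial>?M) = (\<integral>x. f (sgn x) \<partial>restrict_space lborel (ball 0 1))"
    by (rule integral_distr) (auto intro!: measurable_restrict_space1 simp: sgn_measurable)
  also have "\<dots> = (\<integral>x. indicator (ball 0 1) x * f (sgn x) \<partial>lborel)"
    by (subst integral_restrict_space) auto
  finally show ?thesis .
qed

text \<open>Pointwise \<open>\<bar>a\<bar> \<le> e + a\<^sup>2 / e\<close>, which converts the
  \<open>L2\<close> smallness of the trace into the \<open>L1\<close> smallness required for layer
  integrals; \<open>e\<close> stays fixed while the trace term tends to 0. The factor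
  \<open>DIM('a)\<close> in \<open>sphere_measure\<close> is at least 1 and may be inserted.\<close>

lemma sphere_L1_le:
  fixes w :: "'a::euclidean_space \<Rightarrow> real"
  assumes w: "continuous_on UNIV w" and e: "e > 0"
  shows "(\<integral>x. indicator (ball 0 1) x * \<bar>w (sgn x)\<bar> \<partial>lborel)
    \<le> e * measure lborel (ball (0::'a) 1) + (\<integral>x. (w x)\<^sup>2 \<partial>sphere_measure) / e"
proof -
  note [measurable] = sgn_measurable
  have wm [measurable]: "w \<in> borel_measurable borel" using w by (rule borel_measurable_continuous_onI)
  have "compact (w ` cball 0 1)" by (intro compact_continuous_image continuous_on_subset[OF w]) auto
  then obtain B where B0: "\<forall>y\<in>w ` cball 0 1. norm y \<le> B" using compact_imp_bounded bounded_iff by metis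
  have B: "\<bar>w (sgn x)\<bar> \<le> B" for x
  proof -
    have "sgn x \<in> cball 0 1" by (simp add: norm_sgn)
    then show ?thesis using B0 by auto
  qed
  have B2: "(w (sgn x))\<^sup>2 \<le> B\<^sup>2" for x
    using power_mono[OF B[of x], of 2] by simp
  have ib: "integrable lborel (\<lambda>x::'a. indicator (ball 0 1) x * c)" for c :: real
    using emeasure_lborel_ball_finite[of "0::'a" 1]
        by (intro integrable_mult_left integrable_real_indicator) auto
  have iw: "integrable lborel (\<lambda>x. indicator (ball 0 1) x * (w (sgn x))\<^sup>2)"
    by (rule Bochner_Integration.integrable_bound[OF ib[of "B\<^sup>2"]]) (use B2 in \<open>auto simp: indicator_def intro!:
        AE_I2\<close>)
  have "(\<integral>x. indicator (ball 0 1) x * \<bar>w (sgn x)\<bar> \<partial>lborel)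
     \<le> (\<integral>x. indicator (ball 0 1) x * e + indicator (ball 0 1) x * (w (sgn x))\<^sup>2 / e \<partial>lborel)"
  proof (rule integral_mono')
    show "integrable lborel (\<lambda>x. indicator (ball 0 1) x * e + indicator (ball 0 1) x * (w (sgn x))\<^sup>2 / e)"
      by (intro Bochner_Integration.integrable_add integrable_divide ib iw)
    fix x :: 'a
    have "\<bar>w (sgn x)\<bar> \<le> e + (w (sgn x))\<^sup>2 / e"
    proof (cases "\<bar>w (sgn x)\<bar> \<le> e")
      case True
      have "(w (sgn x))\<^sup>2 / e \<ge> 0" using e by simp
      then show ?thesis using True by linarith
    next
      case False
      then have "\<bar>w (sgn x)\<bar> * e \<le> \<bar>w (sgn x)\<bar> * \<bar>w (sgn x)\<bar>" by (intro mult_left_mono) auto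
      then have "\<bar>w (sgn x)\<bar> \<le> (w (sgn x))\<^sup>2 / e" using e by (simp add: field_simps power2_eq_square)
      then show ?thesis using e by linarith
    qed
    then show "indicator (ball 0 1) x * \<bar>w (sgn x)\<bar> \<le> indicator (ball 0 1) x * e + indicator (ball 0 1) x * (w
        (sgn x))\<^sup>2 / e"
      by (auto simp: indicator_def)
    show "0 \<le> indicator (ball 0 1) x * e + indicator (ball 0 1) x * (w (sgn x))\<^sup>2 / e"
      using e by (auto simp: indicator_def)
  qed
  also have "\<dots> = e * measure lborel (ball (0::'a) 1) + (\<integral>x. indicator (ball 0 1) x * (w (sgn x))\<^sup>2 \<partial>lborel) / e"
    using Bochner_Integration.integral_add[OF ib[of e] integrable_divide[OF iw, of e]] by simp
  also have "(\<integral>x. indicator (ball 0 1) x * (w (sgn x))\<^sup>2 \<partial>lborel) \<le> (\<integral>x. (w x)\<^sup>2 \<partial>sphere_measure)"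
  proof -
    have "0 \<le> (\<integral>x. indicator (ball 0 1) x * (w (sgn x))\<^sup>2 \<partial>lborel)" by (intro integral_nonneg_AE) auto
    moreover have "1 \<le> real DIM('a)" using DIM_positive[where 'a='a] by linarith
    ultimately have "1 * (\<integral>x. indicator (ball 0 1) x * (w (sgn x))\<^sup>2 \<partial>lborel) \<le> real DIM('a) * (\<integral>x. indicator
        (ball 0 1) x * (w (sgn x))\<^sup>2 \<partial>lborel)"
      by (intro mult_right_mono)
    then show ?thesis by (subst sphere_integral) auto
  qed
  finally show ?thesis using e by (simp add: divide_right_mono)
qed


lemma cutoff_deriv_0: "z \<notin> {0..1} \<Longrightarrow> deriv cutoff z = 0"
proof -
  assume z: "z \<notin> {0..1}"
  have c: "(cutoff has_real_derivative deriv cutoff z) (at z)"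
    using smooth_on_deriv(1)[OF open_UNIV smooth_on_cutoff] by auto
  show ?thesis
  proof (cases "z < 0")
    case True
    have "((\<lambda>y. 0) has_real_derivative deriv cutoff z) (at z)"
      by (rule has_field_derivative_transform_within_open[OF c, of "{..<0}"]) (use True cutoff_0 in auto)
    then show ?thesis using DERIV_unique[OF _ DERIV_const] by blast
  next
    case False
    have "((\<lambda>y. 1) has_real_derivative deriv cutoff z) (at z)"
      by (rule has_field_derivative_transform_within_open[OF c, of "{1<..}"]) (use False z cutoff_1 in auto)
    then show ?thesis using DERIV_unique[OF _ DERIV_const] by blast
  qed
qed

text \<open>The weak gradient may only be tested with functions supported away from the unit sphere. Testing it with
  \<open>h n\<close> times the components of the gradient of \<open>\<lambda>x. P (x \<bullet> x)\<close> produces an extra term \<open>r n\<close> that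
  concentrates on a layer of width \<open>O(1 / n)\<close> around the sphere, where the trace controls it.\<close>

locale radial_test =
  fixes P :: "real \<Rightarrow> real" and M :: real
  assumes P: "smooth_on UNIV P" and M: "M \<ge> 1" and P0: "\<And>y. y > M \<Longrightarrow> P y = 0"
begin

definition "P1 = deriv P"
definition "P2 = deriv P1"

lemma P1: "smooth_on UNIV P1" "(P has_real_derivative P1 y) (at y)"
  unfolding P1_def using smooth_on_deriv[OF open_UNIV P] by auto

lemma P2: "smooth_on UNIV P2" "(P1 has_real_derivative P2 y) (at y)"
  unfolding P2_def using smooth_on_deriv[OF open_UNIV P1(1)] by auto

lemma deriv_eq_0_above:
  assumes "(f has_real_derivative d) (at y)" "y > M" "\<And>y. y > M \<Longrightarrow> f y = 0"
  shows "d = 0"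
proof -
  have "((\<lambda>y. 0) has_real_derivative d) (at y)"
    by (rule has_field_derivative_transform_within_open[OF assms(1), of "{M<..}"]) (use assms in auto)
  then show ?thesis using DERIV_unique[OF _ DERIV_const] by blast
qed

lemma P1_0: "y > M \<Longrightarrow> P1 y = 0"
  by (rule deriv_eq_0_above[OF P1(2)]) (use P0 in auto)

lemma P2_0: "y > M \<Longrightarrow> P2 y = 0"
  by (rule deriv_eq_0_above[OF P2(2)]) (use P1_0 in auto)

lemma inner_gt_M:
  assumes "(x::'a::euclidean_space) \<notin> cball 0 M" shows "x \<bullet> x > M"
proof -
  have n: "norm x > M" using assms by simp
  then have "M * 1 < norm x * norm x" using M by (intro mult_strict_mono) auto
  then show ?thesis by (simp add: norm_eq_sqrt_inner)
qed

lemma radial_continuous: "smooth_on UNIV \<eta> \<Longrightarrow> continuous_on UNIV (\<lambda>x::'a::euclidean_space. \<eta> (x \<bullet> x))"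
  by (intro smooth_on_imp_continuous_on smooth_radial)

text \<open>The Laplacian of \<open>\<lambda>x. P (x \<bullet> x)\<close>.\<close>

definition lap :: "'a::euclidean_space \<Rightarrow> real" where
  "lap x = 4 * P2 (x \<bullet> x) * (x \<bullet> x) + 2 * real DIM('a) * P1 (x \<bullet> x)"

text \<open>The shift by 1 keeps the support off the sphere: for \<open>n \<ge> 1\<close>,
  \<open>h n\<close> vanishes up to \<open>x \<bullet> x = 1 + 1 / n\<close> and equals 1 from
  \<open>1 + 2 / n\<close> on.\<close>

definition h :: "nat \<Rightarrow> 'a::euclidean_space \<Rightarrow> real" where
  "h n x = cutoff (real n * (x \<bullet> x - 1) - 1)"

text \<open>The inner product of the gradient of \<open>h n\<close> with \<open>g\<close>, the part
  of the divergence of \<open>h n x *\<^sub>R g x\<close> in which the cutoff is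
  differentiated.\<close>

definition r :: "nat \<Rightarrow> 'a::euclidean_space \<Rightarrow> real" where
  "r n x = 4 * real n * deriv cutoff (real n * (x \<bullet> x - 1) - 1) * P1 (x \<bullet> x) * (x \<bullet> x)"

definition g :: "'a::euclidean_space \<Rightarrow> 'a" where
  "g x = (2 * P1 (x \<bullet> x)) *\<^sub>R x"

lemma grad_eq_g: "grad (\<lambda>y. P (y \<bullet> y)) x = g x"
  unfolding g_def P1_def by (rule grad_radial[OF P])

lemma g_cont: "continuous_on UNIV g"
  unfolding g_def[abs_def] by (intro continuous_intros radial_continuous P1)

lemma g_L2: "g \<in> L2"
  by (rule L2_cont[OF g_cont compact_cball[of 0 M]]) (auto simp: g_def P1_0 inner_gt_M)

lemma lap_cont: "continuous_on UNIV lap"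
  unfolding lap_def[abs_def] by (intro continuous_intros radial_continuous P1 P2)

lemma lap_L2: "lap \<in> L2"
  by (rule L2_cont[OF lap_cont compact_cball[of 0 M]]) (auto simp: lap_def P1_0 P2_0 inner_gt_M)

lemma cutoff_affine: "smooth_on UNIV (\<lambda>y. cutoff (real n * (y - 1) - 1))"
  "((\<lambda>y. cutoff (real n * (y - 1) - 1)) has_real_derivative real n * deriv cutoff (real n * (y - 1) - 1)) (at
      y)"
proof -
  have "smooth_on UNIV (\<lambda>y. cutoff (real n * y + (- real n - 1)))"
    by (rule smooth_on_compose[OF smooth_on_cutoff])
     (auto intro!: smooth_on_add smooth_on_mult smooth_on_const smooth_on_bounded_linear[OF
         bounded_linear_ident])
  moreover have "real n * y + (- real n - 1) = real n * (y - 1) - 1" for y by (simp add: algebra_simps)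
  ultimately show "smooth_on UNIV (\<lambda>y. cutoff (real n * (y - 1) - 1))" by simp
  have c: "(cutoff has_real_derivative deriv cutoff z) (at z)" for z
    using smooth_on_deriv(1)[OF open_UNIV smooth_on_cutoff] by auto
  have "((\<lambda>y. real n * (y - 1) - 1) has_real_derivative real n) (at y)"
    by (auto intro!: derivative_eq_intros)
  from DERIV_chain2[OF c this]
  show "((\<lambda>y. cutoff (real n * (y - 1) - 1)) has_real_derivative real n * deriv cutoff (real n * (y - 1) - 1))
      (at y)"
    by (simp add: mult.commute)
qed

text \<open>The radial profile for which \<open>eta n (x \<bullet> x) *\<^sub>R x\<close> is the
  cut-off gradient \<open>h n x *\<^sub>R g x\<close>.\<close>

definition eta :: "nat \<Rightarrow> real \<Rightarrow> real" where
  "eta n y = cutoff (real n * (y - 1) - 1) * (2 * P1 y)"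

lemma eta_smooth: "smooth_on UNIV (eta n)"
  unfolding eta_def[abs_def] by (intro smooth_on_mult smooth_on_const cutoff_affine P1)

lemma eta_deriv: "deriv (eta n) y = 2 * real n * deriv cutoff (real n * (y - 1) - 1) * P1 y
   + 2 * cutoff (real n * (y - 1) - 1) * P2 y"
proof (rule DERIV_imp_deriv)
  show "(eta n has_real_derivative 2 * real n * deriv cutoff (real n * (y - 1) - 1) * P1 y
   + 2 * cutoff (real n * (y - 1) - 1) * P2 y) (at y)"
    unfolding eta_def[abs_def]
    by (rule DERIV_cong[OF DERIV_mult[OF cutoff_affine(2) DERIV_cmult[OF P2(2)]]]) (simp add: algebra_simps)
qed

lemma eta_test:
  assumes "n \<ge> 1"
  shows "(\<lambda>x::'a::euclidean_space. eta n (x \<bullet> x) * (x \<bullet> b)) \<in> C0_infty (interior Ext)"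
proof -
  let ?K = "{x::'a. 1 + 1 / real n \<le> x \<bullet> x} \<inter> cball 0 M"
  have "closed {x::'a. 1 + 1 / real n \<le> x \<bullet> x}" by (intro closed_Collect_le continuous_intros)
  then have "compact ?K" by (intro closed_Int_compact) auto
  moreover have "?K \<subseteq> interior Ext"
  proof
    fix x :: 'a assume "x \<in> ?K"
    moreover have "1 / real n > 0" using assms by simp
    ultimately have "x \<bullet> x > 1" by (auto intro: less_le_trans[of 1 "1 + 1 / real n"])
    then show "x \<in> interior Ext" by (simp add: interior_Ext norm_gt_1_iff)
  qed
  moreover have "eta n (x \<bullet> x) * (x \<bullet> b) = 0" if "x \<notin> ?K" for x
  proof (cases "x \<in> cball 0 M")
    case True
    then have "x \<bullet> x < 1 + 1 / real n" using that by auto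
    then have "real n * (x \<bullet> x - 1) \<le> 1" using assms by (simp add: field_simps)
    then show ?thesis by (simp add: eta_def cutoff_0)
  next
    case False
    then show ?thesis using P1_0[OF inner_gt_M[OF False]] by (simp add: eta_def)
  qed
  moreover have "smooth (\<lambda>x::'a. eta n (x \<bullet> x) * (x \<bullet> b))"
    unfolding smooth_iff_smooth_on
    by (intro smooth_on_mult smooth_radial eta_smooth smooth_on_bounded_linear bounded_linear_inner_left)
  ultimately show ?thesis unfolding C0_infty_def by blast
qed

text \<open>The weak gradient is tested with the components of \<open>h n x *\<^sub>R g x\<close>
  one at a time. Summed over the basis, the derivatives give the divergence
  \<open>h n x * lap x + r n x\<close>, and the other sides the inner product with
  \<open>G\<close>.\<close>

lemma cutoff_identity:
  fixes f :: "'a::euclidean_space \<Rightarrow> real"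
  assumes f: "f \<in> L2" and G: "G \<in> L2" "has_weak_grad f G" and n: "n \<ge> 1"
  shows "(\<integral>x. f x * (h n x * lap x + r n x) \<partial>LExt) = - (\<integral>x. h n x * (G x \<bullet> g x) \<partial>LExt)"
proof -
  let ?\<phi> = "\<lambda>b x::'a. eta n (x \<bullet> x) * (x \<bullet> b)"
  have gr: "grad (?\<phi> b) x \<bullet> b = 2 * deriv (eta n) (x \<bullet> x) * (x \<bullet> b) * (x \<bullet> b) + eta n (x \<bullet> x)"
      if "b \<in> Basis" for b x
    using that by (simp add: grad_inner_Basis frechet_radial_mult[OF eta_smooth])
  have S1: "h n x * lap x + r n x = (\<Sum>b\<in>Basis. grad (?\<phi> b) x \<bullet> b)" for x
  proof -
    have "(\<Sum>b\<in>Basis. grad (?\<phi> b) x \<bullet> b) = (\<Sum>b\<in>Basis. 2 * deriv (eta n) (x \<bullet> x) * ((x \<bullet> b) * (x \<bullet> b)) + eta n (x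
        \<bullet> x))"
      using gr by (intro sum.cong) (auto simp: mult.assoc)
    also have "\<dots> = 2 * deriv (eta n) (x \<bullet> x) * (\<Sum>b\<in>Basis. (x \<bullet> b) * (x \<bullet> b)) + real DIM('a) * eta n (x \<bullet> x)"
      by (simp add: sum.distrib sum_distrib_left)
    also have "(\<Sum>b\<in>Basis. (x \<bullet> b) * (x \<bullet> b)) = x \<bullet> x" by (rule euclidean_inner[symmetric])
    finally show ?thesis
      unfolding eta_deriv by (simp add: h_def lap_def r_def eta_def algebra_simps)
  qed
  have S2: "h n x * (G x \<bullet> g x) = (\<Sum>b\<in>Basis. (G x \<bullet> b) * ?\<phi> b x)" for x
  proof -
    have "(\<Sum>b\<in>Basis. (G x \<bullet> b) * ?\<phi> b x) = eta n (x \<bullet> x) * (\<Sum>b\<in>Basis. (G x \<bullet> b) * (x \<bullet> b))"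
      by (simp add: sum_distrib_left algebra_simps)
    also have "(\<Sum>b\<in>Basis. (G x \<bullet> b) * (x \<bullet> b)) = G x \<bullet> x" by (rule euclidean_inner[symmetric])
    finally show ?thesis by (simp add: h_def g_def eta_def)
  qed
  have L: "(\<lambda>x. grad (?\<phi> b) x \<bullet> b) \<in> L2" if "b \<in> Basis" for b
    using C0_infty_interior_L2(2)[OF eta_test[OF n, of b], of b] that by (simp add: grad_inner_Basis)
  have "(\<integral>x. f x * (h n x * lap x + r n x) \<partial>LExt) = (\<integral>x. (\<Sum>b\<in>Basis. f x * (grad (?\<phi> b) x \<bullet> b)) \<partial>LExt)"
    by (simp add: S1 sum_distrib_left)
  also have "\<dots> = (\<Sum>b\<in>Basis. \<integral>x. f x * (grad (?\<phi> b) x \<bullet> b) \<partial>LExt)"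
    by (intro Bochner_Integration.integral_sum L2_mult_integrable f L)
  also have "\<dots> = (\<Sum>b\<in>Basis. - (\<integral>x. (G x \<bullet> b) * ?\<phi> b x \<partial>LExt))"
    using G(2) eta_test[OF n] by (intro sum.cong) (auto simp: has_weak_grad_def)
  also have "\<dots> = - (\<Sum>b\<in>Basis. \<integral>x. (G x \<bullet> b) * ?\<phi> b x \<partial>LExt)" by (simp add: sum_negf)
  also have "(\<Sum>b\<in>Basis. \<integral>x. (G x \<bullet> b) * ?\<phi> b x \<partial>LExt) = (\<integral>x. (\<Sum>b\<in>Basis. (G x \<bullet> b) * ?\<phi> b x) \<partial>LExt)"
    by (intro Bochner_Integration.integral_sum[symmetric] L2_mult_integrable L2_inner G
        C0_infty_interior_L2(1)[OF eta_test[OF n]])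
  finally show ?thesis by (simp add: S2)
qed

lemma h_bounds: "0 \<le> h n x" "h n x \<le> 1"
  by (auto simp: h_def cutoff_ge_0 cutoff_le_1)

lemma h_cont: "continuous_on UNIV (h n)"
  unfolding h_def[abs_def] using radial_continuous[OF cutoff_affine(1)[of n]] by simp

lemma h_lim: "norm x > 1 \<Longrightarrow> (\<lambda>n. h n x) \<longlonglongrightarrow> 1"
proof (rule tendsto_eventually)
  assume "norm x > 1"
  then have x: "x \<bullet> x - 1 > 0" by (simp add: norm_gt_1_iff)
  have "\<forall>\<^sub>F n in sequentially. real n > 2 / (x \<bullet> x - 1)"
    by (intro eventually_compose_filterlim[OF eventually_gt_at_top filterlim_real_sequentially])
  then show "\<forall>\<^sub>F n in sequentially. h n x = 1"
  proof eventually_elim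
    case (elim n)
    then have "2 \<le> real n * (x \<bullet> x - 1)" using x by (simp add: field_simps)
    then show ?case by (simp add: h_def cutoff_1)
  qed
qed

lemma h_dominated:
  fixes F :: "'a::euclidean_space \<Rightarrow> real"
  assumes F: "integrable LExt F"
  shows "(\<lambda>n. \<integral>x. h n x * F x \<partial>LExt) \<longlonglongrightarrow> (\<integral>x. F x \<partial>LExt)" "integrable LExt (\<lambda>x. h n x * F x)"
proof -
  have hm: "h n \<in> borel_measurable LExt" for n
    by (rule borel_imp_LExt[OF borel_measurable_continuous_onI[OF h_cont]])
  have Fm: "F \<in> borel_measurable LExt" using F by simp
  have l: "AE x in LExt. (\<lambda>n. h n x * F x) \<longlonglongrightarrow> F x"
    using AE_LExt_norm
  proof eventually_elim
    case (elim x)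
    show ?case using tendsto_mult[OF h_lim[OF elim] tendsto_const[of "F x"]] by simp
  qed
  have b: "AE x in LExt. norm (h n x * F x) \<le> norm (F x)" for n
    by (intro AE_I2) (auto simp: abs_mult abs_of_nonneg h_bounds intro!: mult_left_le_one_le)
  show "(\<lambda>n. \<integral>x. h n x * F x \<partial>LExt) \<longlonglongrightarrow> (\<integral>x. F x \<partial>LExt)"
    by (rule integral_dominated_convergence[OF Fm borel_measurable_times[OF hm Fm] integrable_norm[OF F] l b])
  show "integrable LExt (\<lambda>x. h n x * F x)"
    by (rule integrable_dominated_convergence2[OF Fm borel_measurable_times[OF hm Fm] integrable_norm[OF F] l
        b])
qed

lemma Gg_integrable:
  assumes "G \<in> L2"
  shows "integrable LExt (\<lambda>x. G x \<bullet> g x)"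
proof -
  have "integrable LExt (\<lambda>x. \<Sum>b\<in>Basis. (G x \<bullet> b) * (g x \<bullet> b))"
    by (intro Bochner_Integration.integrable_sum L2_mult_integrable L2_inner assms g_L2)
  then show ?thesis by (simp add: euclidean_inner[symmetric])
qed

lemma cutoff_deriv_bounded: "\<exists>C. \<forall>z. \<bar>deriv cutoff z\<bar> \<le> C"
proof -
  have s: "(cutoff has_real_derivative deriv cutoff z) (at z)" "smooth_on UNIV (deriv cutoff)" for z
    using smooth_on_deriv[OF open_UNIV smooth_on_cutoff] by auto
  have "compact (deriv cutoff ` {0..1})"
    by (intro compact_continuous_image continuous_on_subset[OF smooth_on_imp_continuous_on[OF s(2)]]) auto
  then obtain C where C: "\<forall>y\<in>deriv cutoff ` {0..1}. norm y \<le> C" using compact_imp_bounded bounded_iff by metis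
  have "\<bar>deriv cutoff z\<bar> \<le> max C 0" for z
  proof (cases "z \<in> {0..1}")
    case True
    then show ?thesis using C by force
  next
    case False
    then show ?thesis using cutoff_deriv_0 by auto
  qed
  then show ?thesis by blast
qed

text \<open>Where the derivative of the cutoff is nonzero,
  \<open>x \<bullet> x \<le> 1 + 2 / n \<le> 3\<close>; hence only \<open>P1\<close> on
  \<open>{1..3}\<close> matters, and \<open>norm x \<ge> 1\<close> places the point in
  \<open>layer n\<close>. The growth in \<open>n\<close> is balanced by the volume of the
  layer.\<close>

lemma r_bound: "\<exists>C\<ge>0. \<forall>n\<ge>1. \<forall>x::'a::euclidean_space. norm x \<ge> 1 \<longrightarrow> \<bar>r n x\<bar> \<le> C * real n * indicator (layer n) x"
proof -
  obtain C1 where C1: "\<And>z. \<bar>deriv cutoff z\<bar> \<le> C1" using cutoff_deriv_bounded by blast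
  have "compact (P1 ` {1..3})"
    by (intro compact_continuous_image continuous_on_subset[OF smooth_on_imp_continuous_on[OF P1(1)]]) auto
  then obtain C2 where C2: "\<forall>y\<in>P1 ` {1..3}. norm y \<le> C2" using compact_imp_bounded bounded_iff by metis
  have C0: "0 \<le> C1" "0 \<le> C2" using C1[of 0] C2 by force+
  have "\<bar>r n x\<bar> \<le> (4 * C1 * C2 * 3) * real n * indicator (layer n) x"
      if n: "n \<ge> 1" and x: "norm x \<ge> 1" for n and x :: 'a
  proof (cases "deriv cutoff (real n * (x \<bullet> x - 1) - 1) = 0")
    case True
    then show ?thesis using C0 by (simp add: r_def)
  next
    case False
    then have "real n * (x \<bullet> x - 1) \<le> 2" using cutoff_deriv_0[of "real n * (x \<bullet> x - 1) - 1"] by force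
    then have le: "x \<bullet> x \<le> 1 + 2 / real n" using n by (simp add: field_simps)
    have "2 / real n \<le> 2" using n by (simp add: field_simps)
    then have y: "x \<bullet> x \<le> 3" "1 \<le> x \<bullet> x" using le x by (auto simp: norm_ge_1_iff)
    have np: "0 < 2 / real n" using n by simp
    have "norm x < 1 + 2 / real n"
    proof (rule ccontr)
      assume "\<not> norm x < 1 + 2 / real n"
      then have n1: "1 + 2 / real n \<le> norm x" by simp
      then have "1 < norm x" using np by linarith
      then have "(1 + 2 / real n) * 1 < norm x * norm x"
        using n1 add_pos_pos[OF zero_less_one np] by (intro mult_le_less_imp_less) linarith+
      then have "1 + 2 / real n < x \<bullet> x" by (simp add: norm_eq_sqrt_inner)
      then show False using le by simp
    qed
    then have lay: "x \<in> layer n" using x by auto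
    have "\<bar>r n x\<bar> = 4 * real n * (\<bar>deriv cutoff (real n * (x \<bullet> x - 1) - 1)\<bar> * \<bar>P1 (x \<bullet> x)\<bar> * (x \<bullet> x))"
      by (simp add: r_def abs_mult)
    also have "\<dots> \<le> 4 * real n * (C1 * C2 * 3)"
    proof -
      have "\<bar>P1 (x \<bullet> x)\<bar> \<le> C2" using C2 y by auto
      then show ?thesis using C1 y C0 by (intro mult_left_mono mult_mono) auto
    qed
    finally show ?thesis using lay by (simp add: algebra_simps)
  qed
  moreover have "0 \<le> 4 * C1 * C2 * 3" using C0 by simp
  ultimately show ?thesis by blast
qed

lemma r_cont: "continuous_on UNIV (r n)"
proof -
  have s: "smooth_on UNIV (deriv cutoff)" using smooth_on_deriv[OF open_UNIV smooth_on_cutoff] by auto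
  have "continuous_on UNIV (\<lambda>x::'b::euclidean_space. deriv cutoff (real n * (x \<bullet> x - 1) - 1))"
    by (rule continuous_on_compose2[OF smooth_on_imp_continuous_on[OF s]]) (auto intro!: continuous_intros)
  note prod = continuous_on_mult[OF continuous_on_mult[OF continuous_on_mult[OF continuous_on_const this]
      radial_continuous[OF P1(1)]]]
  show ?thesis unfolding r_def[abs_def]
      by (rule prod[OF continuous_on_inner[OF continuous_on_id continuous_on_id]])
qed

lemma r_L2: "r n \<in> L2"
  by (rule L2_cont[OF r_cont compact_cball[of 0 M]]) (auto simp: r_def P1_0 inner_gt_M)

text \<open>As \<open>h n\<close> tends to 1 in the other two integrals of
  \<open>cutoff_identity\<close>, the boundary-layer integrals converge to minus the defect of
  Green's formula. This applies to \<open>u\<close> and to \<open>u - w k\<close> alike.\<close>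

lemma R_limit:
  fixes f :: "'a::euclidean_space \<Rightarrow> real"
  assumes f: "f \<in> L2" and G: "G \<in> L2" "has_weak_grad f G"
  shows "(\<lambda>n. \<integral>x. f x * r n x \<partial>LExt) \<longlonglongrightarrow> - ((\<integral>x. G x \<bullet> g x \<partial>LExt) + (\<integral>x. f x * lap x \<partial>LExt))"
proof -
  have fl: "integrable LExt (\<lambda>x. f x * lap x)" by (intro L2_mult_integrable f lap_L2)
  have fr: "integrable LExt (\<lambda>x. f x * r n x)" for n by (intro L2_mult_integrable f r_L2)
  have "(\<lambda>n. - ((\<integral>x. h n x * (G x \<bullet> g x) \<partial>LExt) + (\<integral>x. h n x * (f x * lap x) \<partial>LExt))) \<longlonglongrightarrow> - ((\<integral>x. G x \<bullet> g x \<partial>LExt)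
      + (\<integral>x. f x * lap x \<partial>LExt))"
    by (intro tendsto_minus tendsto_add h_dominated Gg_integrable G fl)
  moreover have "\<forall>\<^sub>F n in sequentially. - ((\<integral>x. h n x * (G x \<bullet> g x) \<partial>LExt) + (\<integral>x. h n x * (f x * lap x) \<partial>LExt))
      = (\<integral>x. f x * r n x \<partial>LExt)"
    using eventually_ge_at_top[of 1]
  proof eventually_elim
    case (elim n)
    have "(\<integral>x. f x * (h n x * lap x + r n x) \<partial>LExt) = (\<integral>x. h n x * (f x * lap x) + f x * r n x \<partial>LExt)"
      by (simp add: algebra_simps)
    also have "\<dots> = (\<integral>x. h n x * (f x * lap x) \<partial>LExt) + (\<integral>x. f x * r n x \<partial>LExt)"
      by (intro Bochner_Integration.integral_add h_dominated fl fr)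
    finally show ?case using cutoff_identity[OF f G elim] by simp
  qed
  ultimately show ?thesis by (rule Lim_transform_eventually)
qed

text \<open>The Green defect is continuous in the \<open>H1\<close> norm, by Cauchy-Schwarz against
  the fixed functions \<open>g\<close> and \<open>lap\<close>; so the defect of
  \<open>u - w k\<close> will tend to 0.\<close>

lemma functional_bound:
  fixes f :: "'a::euclidean_space \<Rightarrow> real"
  assumes f: "f \<in> H1"
  shows "\<bar>(\<integral>x. weak_grad f x \<bullet> g x \<partial>LExt) + (\<integral>x. f x * lap x \<partial>LExt)\<bar>
    \<le> (L2_norm (g :: 'a \<Rightarrow> 'a) + L2_norm (lap :: 'a \<Rightarrow> real)) * H1_norm f"
proof -
  have nn: "(\<lambda>x. norm (F x)) \<in> L2" "L2_norm (\<lambda>x. norm (F x)) = L2_norm F" if "F \<in> L2" for F :: "'a \<Rightarrow> 'a"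
    using that by (auto simp: L2_def L2_norm_def)
  have G: "weak_grad f \<in> L2" using weak_grad[OF f] by simp
  have "\<bar>\<integral>x. weak_grad f x \<bullet> g x \<partial>LExt\<bar> \<le> (\<integral>x. norm (weak_grad f x) * norm (g x) \<partial>LExt)"
  proof -
    have "\<bar>\<integral>x. weak_grad f x \<bullet> g x \<partial>LExt\<bar> \<le> (\<integral>x. \<bar>weak_grad f x \<bullet> g x\<bar> \<partial>LExt)"
      using integral_norm_bound[of LExt "\<lambda>x. weak_grad f x \<bullet> g x"] by simp
    also have "\<dots> \<le> (\<integral>x. norm (weak_grad f x) * norm (g x) \<partial>LExt)"
      by (intro integral_mono integrable_abs Gg_integrable G L2_mult_integrable nn g_L2 Cauchy_Schwarz_ineq2)
    finally show ?thesis .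
  qed
  also have "\<dots> \<le> L2_norm (weak_grad f) * L2_norm (g :: 'a \<Rightarrow> 'a)"
    using L2_Cauchy_Schwarz[OF nn(1)[OF G] nn(1)[OF g_L2]] by (simp add: nn(2) G g_L2)
  also have "\<dots> \<le> H1_norm f * L2_norm (g :: 'a \<Rightarrow> 'a)"
    by (intro mult_right_mono H1_norm_ge L2_norm_nonneg)
  finally have 1: "\<bar>\<integral>x. weak_grad f x \<bullet> g x \<partial>LExt\<bar> \<le> H1_norm f * L2_norm (g :: 'a \<Rightarrow> 'a)" .
  have "\<bar>\<integral>x. f x * lap x \<partial>LExt\<bar> \<le> L2_norm f * L2_norm (lap :: 'a \<Rightarrow> real)"
    by (intro L2_Cauchy_Schwarz H1_L2 f lap_L2)
  also have "\<dots> \<le> H1_norm f * L2_norm (lap :: 'a \<Rightarrow> real)"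
    by (intro mult_right_mono H1_norm_ge L2_norm_nonneg)
  finally show ?thesis using 1 by (simp add: algebra_simps)
qed

text \<open>The defect \<open>l\<close> of \<open>u\<close> is that of \<open>u - w k\<close>, small
  by \<open>H1\<close> convergence, plus that of \<open>w k\<close>, a limit of layer integrals of a
  continuous function and hence controlled by its \<open>L2\<close> norm on the sphere. With
  \<open>k\<close> tending to infinity for fixed \<open>e\<close>, and then \<open>e\<close> to 0,
  the defect vanishes.\<close>

theorem green_zero_trace:
  fixes u :: "'a::euclidean_space \<Rightarrow> real"
  assumes u: "u \<in> H1" and tr: "has_trace u (\<lambda>_. 0)"
  shows "(\<integral>x. weak_grad u x \<bullet> grad (\<lambda>y. P (y \<bullet> y)) x \<partial>LExt) = - (\<integral>x. u x * lap x \<partial>LExt)"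
proof -
  define l where "l = (\<integral>x. weak_grad u x \<bullet> g x \<partial>LExt) + (\<integral>x. u x * lap x \<partial>LExt)"
  obtain C where C: "C \<ge> 0" "\<And>n x. n \<ge> 1 \<Longrightarrow> norm (x::'a) \<ge> 1 \<Longrightarrow> \<bar>r n x\<bar> \<le> C * real n * indicator (layer n) x"
    using r_bound by blast
  define D where "D = L2_norm (g :: 'a \<Rightarrow> 'a) + L2_norm (lap :: 'a \<Rightarrow> real)"
  have D: "D \<ge> 0" unfolding D_def by (intro add_nonneg_nonneg L2_norm_nonneg)
  obtain w where w: "\<And>k::nat. w k \<in> C0_infty Ext" "(\<lambda>k. H1_norm (\<lambda>x. u x - w k x)) \<longlonglongrightarrow> 0"
    "(\<lambda>k. \<integral>x. (w k x)\<^sup>2 \<partial>sphere_measure) \<longlonglongrightarrow> 0"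
    using tr unfolding has_trace_def by auto
  define om where "om = measure lborel (ball (0::'a) 1)"
  define c where "c = C * (2 * 2 ^ DIM('a))"
  have c: "c \<ge> 0" using C by (simp add: c_def)
  have key: "\<bar>l\<bar> \<le> D * H1_norm (\<lambda>x. u x - w k x) + c * ((e * om + (\<integral>x. (w k x)\<^sup>2 \<partial>sphere_measure) / e) + e)"
    if e: "e > 0" for e k
  proof -
    let ?f = "\<lambda>x. u x - w k x"
    have wH: "w k \<in> H1" by (rule C0_infty_Ext_H1[OF w(1)])
    have fH: "?f \<in> H1" by (rule H1_diff[OF u wH])
    have wc: "continuous_on UNIV (w k)" using w(1)[of k] by (simp add: C0_infty_def smooth_continuous)
    let ?lf = "(\<integral>x. weak_grad ?f x \<bullet> g x \<partial>LExt) + (\<integral>x. ?f x * lap x \<partial>LExt)"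
    have Ru: "(\<lambda>n. \<integral>x. u x * r n x \<partial>LExt) \<longlonglongrightarrow> - l"
      unfolding l_def by (intro R_limit H1_L2 weak_grad u)
    have Rf: "(\<lambda>n. \<integral>x. ?f x * r n x \<partial>LExt) \<longlonglongrightarrow> - ?lf"
      by (intro R_limit H1_L2 weak_grad fH)
    \<comment> \<open>By linearity the layer integrals of \<open>w k\<close> converge too, to a
      difference of two defects.\<close>
    have Rw: "(\<lambda>n. \<integral>x. w k x * r n x \<partial>LExt) \<longlonglongrightarrow> - l - (- ?lf)"
    proof (rule Lim_transform_eventually[OF tendsto_diff[OF Ru Rf]], rule always_eventually, rule allI)
      fix n
      show "(\<integral>x. u x * r n x \<partial>LExt) - (\<integral>x. ?f x * r n x \<partial>LExt) = (\<integral>x. w k x * r n x \<partial>LExt)"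
      proof -
        have "(\<integral>x. u x * r n x \<partial>LExt) - (\<integral>x. ?f x * r n x \<partial>LExt) = (\<integral>x. u x * r n x - ?f x * r n x \<partial>LExt)"
          by (intro Bochner_Integration.integral_diff[symmetric] L2_mult_integrable H1_L2 u fH r_L2)
        then show ?thesis by (simp add: algebra_simps)
      qed
    qed
    let ?S = "\<integral>x. indicator (ball 0 1) x * \<bar>w k (sgn x)\<bar> \<partial>lborel"
    have "\<forall>\<^sub>F n in sequentially. \<bar>\<integral>x. w k x * r n x \<partial>LExt\<bar> \<le> c * (?S + e)"
      using layer_integral_le[OF wc e] eventually_ge_at_top[of 1]
    proof eventually_elim
      case (elim n)
      have wb: "w k \<in> borel_measurable borel" using wc by (rule borel_measurable_continuous_onI)
      have lb: "layer n \<in> sets (borel :: 'a measure)" by measurable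
      have int: "integrable lborel (\<lambda>x. indicator (layer n) x * \<bar>w k x\<bar>)"
      proof -
        have 1: "integrable lborel (\<lambda>x. indicator (cball 0 (1 + 2 / real n)) x *\<^sub>R \<bar>w k x\<bar>)"
          by (rule borel_integrable_compact) (auto intro!: continuous_intros continuous_on_subset[OF wc])
        show ?thesis
          by (rule Bochner_Integration.integrable_bound[OF 1]) (use wb lb in \<open>auto simp: indicator_def intro!:
              AE_I2\<close>)
      qed
      have m1: "(\<lambda>x. \<bar>w k x * r n x\<bar>) \<in> borel_measurable borel"
        using wb borel_measurable_continuous_onI[OF r_cont[of n]] by measurable
      have i1: "integrable LExt (\<lambda>x. \<bar>w k x * r n x\<bar>)"
        by (intro integrable_abs L2_mult_integrable H1_L2 wH r_L2)
      have "\<bar>\<integral>x. w k x * r n x \<partial>LExt\<bar> \<le> (\<integral>x. \<bar>w k x * r n x\<bar> \<partial>LExt)"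
        using integral_norm_bound[of LExt "\<lambda>x. w k x * r n x"] by simp
      also have "\<dots> = (\<integral>x. indicator Ext x *\<^sub>R \<bar>w k x * r n x\<bar> \<partial>lborel)" by (rule LExt_integral(1)[OF m1])
      also have "\<dots> \<le> (\<integral>x. (C * real n) * (indicator (layer n) x * \<bar>w k x\<bar>) \<partial>lborel)"
      proof (rule integral_mono)
        show "integrable lborel (\<lambda>x. indicator Ext x *\<^sub>R \<bar>w k x * r n x\<bar>)" using i1 LExt_integral(2)[OF m1]
            by simp
        show "integrable lborel (\<lambda>x. (C * real n) * (indicator (layer n) x * \<bar>w k x\<bar>))" using int by simp
        fix x :: 'a
        show "indicator Ext x *\<^sub>R \<bar>w k x * r n x\<bar> \<le> (C * real n) * (indicator (layer n) x * \<bar>w k x\<bar>)"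
        proof (cases "x \<in> Ext")
          case True
          have "\<bar>w k x\<bar> * \<bar>r n x\<bar> \<le> \<bar>w k x\<bar> * (C * real n * indicator (layer n) x)"
            using C(2)[OF elim(2), of x] True by (intro mult_left_mono) (auto simp: Ext_iff)
          then show ?thesis using True by (simp add: abs_mult algebra_simps)
        qed (use C(1) in simp)
      qed
      also have "\<dots> = C * (real n * (\<integral>x. indicator (layer n) x * \<bar>w k x\<bar> \<partial>lborel))" by simp
      also have "\<dots> \<le> C * (2 * 2 ^ DIM('a) * (?S + e))" using elim C by (intro mult_left_mono) auto
      finally show ?case by (simp add: c_def mult.assoc)
    qed
    with tendsto_rabs[OF Rw] have "\<bar>- l - (- ?lf)\<bar> \<le> c * (?S + e)"
      by (intro tendsto_upperbound) auto
    also have "\<dots> \<le> c * ((e * om + (\<integral>x. (w k x)\<^sup>2 \<partial>sphere_measure) / e) + e)"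
      unfolding om_def by (intro mult_left_mono add_right_mono sphere_L1_le wc e c)
    finally have "\<bar>l\<bar> \<le> \<bar>?lf\<bar> + c * ((e * om + (\<integral>x. (w k x)\<^sup>2 \<partial>sphere_measure) / e) + e)" by linarith
    then show ?thesis using functional_bound[OF fH] unfolding D_def by linarith
  qed
  have lim: "\<bar>l\<bar> \<le> c * (om + 1) * e" if e: "e > 0" for e
  proof -
    have "(\<lambda>k. D * H1_norm (\<lambda>x. u x - w k x) + c * ((e * om + (\<integral>x. (w k x)\<^sup>2 \<partial>sphere_measure) / e) + e))
      \<longlonglongrightarrow> D * 0 + c * ((e * om + 0 / e) + e)"
      using e by (intro tendsto_intros w) auto
    then have "\<bar>l\<bar> \<le> D * 0 + c * ((e * om + 0 / e) + e)"
      by (rule tendsto_lowerbound) (use key[OF e] in auto)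
    then show ?thesis by (simp add: algebra_simps)
  qed
  have "\<bar>l\<bar> \<le> 0"
  proof (rule field_le_epsilon)
    fix e :: real assume e: "e > 0"
    \<comment> \<open>The \<open>+ 1\<close> keeps the divisor positive when
      \<open>c = 0\<close>.\<close>
    define K where "K = c * (om + 1) + 1"
    have om: "om \<ge> 0" by (simp add: om_def)
    then have cK: "0 \<le> c * (om + 1)" using c by simp
    then have K: "K > 0" by (simp add: K_def)
    have "\<bar>l\<bar> \<le> c * (om + 1) * (e / K)" using e K by (intro lim) simp
    also have "\<dots> \<le> K * (e / K)" using e K by (intro mult_right_mono) (auto simp: K_def)
    also have "\<dots> = e" using K by simp
    finally show "\<bar>l\<bar> \<le> 0 + e" by simp
  qed
  then show ?thesis by (simp add: l_def grad_eq_g)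
qed

end

section \<open>Reduction to the differential inequality\<close>

lemma AE_eq_measurable_lebesgue:
  fixes f g :: "'a::euclidean_space \<Rightarrow> real"
  assumes g: "g \<in> borel_measurable lborel" and ae: "AE x in lborel. f x = g x"
  shows "f \<in> borel_measurable lebesgue"
proof (rule measurableI)
  fix S :: "real set" assume "S \<in> sets borel"
  have 1: "g -` S \<inter> space lebesgue \<in> sets lebesgue"
    using measurable_sets[OF measurable_completion[OF g] \<open>S \<in> sets borel\<close>] by simp
  show "f -` S \<inter> space lebesgue \<in> sets lebesgue"
    by (rule completion.in_sets_AE[OF _ 1]) (use AE_completion[OF ae] in \<open>auto elim: eventually_mono\<close>)
qed simp

text \<open>Lebesgue measure on the product is the completion of a product measure, so Fubini's
  theorem is applied to a Borel representative \<open>g\<close>. Almost every slice of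
  \<open>g\<close> agrees almost everywhere with that of \<open>f\<close>, and measurability of the
  slices of \<open>f\<close> transfers the conclusions.\<close>

lemma Fubini_slices_lebesgue:
  fixes f :: "real \<times> 'a::euclidean_space \<Rightarrow> real"
  assumes int: "integrable (lebesgue_on ({1..t} \<times> Ext)) f"
    and meas: "\<And>s. s \<in> {1..t} \<Longrightarrow> (\<lambda>x. f (s, x)) \<in> borel_measurable LExt"
  shows "AE s in lebesgue. s \<in> {1..t} \<longrightarrow> integrable LExt (\<lambda>x. f (s, x))"
    and "set_integrable lebesgue {1..t} (\<lambda>s. \<integral>x. f (s, x) \<partial>LExt)"
proof -
  let ?S = "{1..t} \<times> (Ext :: 'a set)"
  define F where "F z = indicator ?S z *\<^sub>R f z" for z
  have "closed (Ext :: 'a set)" unfolding Ext_def by (metis Compl_eq_Diff_UNIV closed_Compl open_ball)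
  then have S: "?S \<in> sets lebesgue" by (intro lebesgue_closedin[of _ UNIV] | simp add: closed_Times borel_closed
      sets_completionI_sets)+
  have Fi: "integrable lebesgue F" using int S unfolding F_def by (subst (asm) integrable_restrict_space) auto
  then obtain g where g: "g \<in> borel_measurable lborel" "AE z in lborel. F z = g z"
    using completion_ex_borel_measurable_real[of F lborel] by auto
  have "integrable lebesgue g"
    using Fi g AE_completion[OF g(2)] integrable_cong_AE[of F lebesgue g] measurable_completion[OF g(1)] by auto
  then have gi: "integrable lborel g" using integrable_completion[OF g(1)] by simp
  then have gi': "integrable (lborel \<Otimes>\<^sub>M lborel) g" by (simp add: lborel_prod)
  have "AE z in lborel \<Otimes>\<^sub>M lborel. F z = g z" unfolding lborel_prod by (rule g(2))
  from lborel_pair.AE_pair[OF this] have ae: "AE s in lborel. AE x in lborel. F (s, x) = g (s, x)" .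
  from lborel_pair.AE_integrable_fst'[OF gi'] have gs: "AE s in lborel. integrable lborel (\<lambda>x. g (s, x))" .
  have key: "AE s in lborel. s \<in> {1..t} \<longrightarrow> integrable LExt (\<lambda>x. f (s, x)) \<and> (\<integral>x. f (s, x) \<partial>LExt) = (\<integral>x. g (s, x)
      \<partial>lborel)"
    using ae gs
  proof eventually_elim
    case (elim s)
    show ?case
    proof
      assume s: "s \<in> {1..t}"
      have eq: "(\<lambda>x. F (s, x)) = (\<lambda>x. indicator Ext x *\<^sub>R f (s, x))"
        using s by (auto simp: F_def indicator_def)
      have m: "(\<lambda>x. F (s, x)) \<in> borel_measurable lebesgue"
        using meas[OF s] unfolding eq by (subst (asm) borel_measurable_restrict_space_iff) auto
      have gm: "(\<lambda>x. g (s, x)) \<in> borel_measurable lborel" using elim(2) by simp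
      have gl: "integrable lebesgue (\<lambda>x. g (s, x))" using elim(2) integrable_completion[OF gm] by simp
      have ae': "AE x in lebesgue. F (s, x) = g (s, x)" by (rule AE_completion[OF elim(1)])
      have "integrable lebesgue (\<lambda>x. F (s, x))"
        using integrable_cong_AE[OF m measurable_completion[OF gm] ae'] gl by simp
      moreover have "(\<integral>x. F (s, x) \<partial>lebesgue) = (\<integral>x. g (s, x) \<partial>lebesgue)"
        by (rule integral_cong_AE[OF m measurable_completion[OF gm] ae'])
      ultimately show "integrable LExt (\<lambda>x. f (s, x)) \<and> (\<integral>x. f (s, x) \<partial>LExt) = (\<integral>x. g (s, x) \<partial>lborel)"
        unfolding eq by (simp add: integrable_restrict_space integral_restrict_space integral_completion[OF gm])
    qed
  qed
  then show "AE s in lebesgue. s \<in> {1..t} \<longrightarrow> integrable LExt (\<lambda>x. f (s, x))"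
    by (intro AE_completion) (auto elim: eventually_mono)
  define Q where "Q s = indicator {1..t} s *\<^sub>R (\<integral>x. g (s, x) \<partial>lborel)" for s
  have Qi: "integrable lborel Q"
    unfolding Q_def using lborel_pair.integrable_fst'[OF gi'] by (intro integrable_mult_indicator) auto
  have Qm: "Q \<in> borel_measurable lborel" using Qi by simp
  have aeQ: "AE s in lborel. indicator {1..t} s *\<^sub>R (\<integral>x. f (s, x) \<partial>LExt) = Q s"
    using key by eventually_elim (auto simp: Q_def indicator_def)
  show "set_integrable lebesgue {1..t} (\<lambda>s. \<integral>x. f (s, x) \<partial>LExt)"
    unfolding set_integrable_def
    using integrable_cong_AE[OF AE_eq_measurable_lebesgue[OF Qm aeQ] measurable_completion[OF Qm]
        AE_completion[OF aeQ]]
      Qi integrable_completion[OF Qm] by simp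
qed

text \<open>The left side is the tangent at \<open>a\<close> to a convex function. The inequality is
  Young's, with weights \<open>1 / p\<close> and \<open>1 - 1 / p\<close>, for
  \<open>x powr p\<close> and \<open>a powr p\<close>.\<close>

lemma powr_tangent:
  fixes x a p :: real
  assumes "x \<ge> 0" "a > 0" "p > 1"
  shows "a powr p * (1 - p) + p * a powr (p - 1) * x \<le> x powr p"
proof (cases "x = 0")
  case True
  then show ?thesis using assms by (simp add: mult_nonneg_nonpos)
next
  case False
  then have x: "x > 0" using assms by simp
  have "(x powr p) powr (1 / p) * (a powr p) powr (1 - 1 / p) \<le> 1 / p * x powr p + (1 - 1 / p) * a powr p"
    by (rule Youngs_inequality_0) (use assms x in auto)
  moreover have "(x powr p) powr (1 / p) = x" using x assms by (simp add: powr_powr)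
  moreover have "(a powr p) powr (1 - 1 / p) = a powr (p - 1)"
  proof -
    have "p * (1 - 1 / p) = p - 1" using assms by (simp add: field_simps)
    then show ?thesis by (simp add: powr_powr)
  qed
  ultimately have "x * a powr (p - 1) \<le> 1 / p * x powr p + (1 - 1 / p) * a powr p" by simp
  then have "p * (x * a powr (p - 1)) \<le> p * (1 / p * x powr p + (1 - 1 / p) * a powr p)"
    using assms by (intro mult_left_mono) auto
  also have "\<dots> = x powr p + (p - 1) * a powr p" using assms by (simp add: field_simps)
  finally show ?thesis by (simp add: algebra_simps)
qed

text \<open>Integrate the tangent inequality at \<open>a = V / K\<close> against
  \<open>\<Psi>\<close> over \<open>S\<close>, with \<open>V\<close> the absolute value of the
  integral of \<open>v x * \<Psi> x\<close>. As \<open>1 - p\<close> is negative, replacing the mass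
  of \<open>S\<close> by its upper bound \<open>K\<close> is admissible, and the two terms combine
  to \<open>K * a powr p\<close>.\<close>

lemma Hoelder_support:
  fixes v \<Psi> :: "'b \<Rightarrow> real"
  assumes p: "p > 1" and K: "K > 0"
    and \<Psi>: "AE x in M. \<Psi> x \<ge> 0" and S: "S \<in> sets M" and v0: "AE x in M. x \<notin> S \<longrightarrow> v x = 0"
    and i1: "integrable M (\<lambda>x. \<bar>v x\<bar> powr p * \<Psi> x)" and i2: "integrable M (\<lambda>x. v x * \<Psi> x)"
    and i3: "integrable M (\<lambda>x. indicator S x * \<Psi> x)" "(\<integral>x. indicator S x * \<Psi> x \<partial>M) \<le> K"
  shows "K powr (1 - p) * \<bar>\<integral>x. v x * \<Psi> x \<partial>M\<bar> powr p \<le> (\<integral>x. \<bar>v x\<bar> powr p * \<Psi> x \<partial>M)"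
proof -
  define V where "V = \<bar>\<integral>x. v x * \<Psi> x \<partial>M\<bar>"
  have nn: "0 \<le> (\<integral>x. \<bar>v x\<bar> powr p * \<Psi> x \<partial>M)"
    using \<Psi> by (intro integral_nonneg_AE) (auto elim: eventually_mono)
  show ?thesis
  proof (cases "V = 0")
    case True
    then show ?thesis using nn by (simp add: V_def)
  next
    case False
    then have V: "V > 0" by (simp add: V_def)
    define a where "a = V / K"
    have a: "a > 0" using V K by (simp add: a_def)
    have iv: "integrable M (\<lambda>x. \<bar>v x * \<Psi> x\<bar>)" by (rule integrable_abs[OF i2])
    have Vle: "V \<le> (\<integral>x. \<bar>v x * \<Psi> x\<bar> \<partial>M)"
      unfolding V_def using integral_norm_bound[of M "\<lambda>x. v x * \<Psi> x"] by simp
    have "(\<integral>x. a powr p * (1 - p) * (indicator S x * \<Psi> x) + p * a powr (p - 1) * \<bar>v x * \<Psi> x\<bar> \<partial>M)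
       \<le> (\<integral>x. \<bar>v x\<bar> powr p * \<Psi> x \<partial>M)"
    proof (rule integral_mono_AE)
      show "AE x in M. a powr p * (1 - p) * (indicator S x * \<Psi> x) + p * a powr (p - 1) * \<bar>v x * \<Psi> x\<bar>
        \<le> \<bar>v x\<bar> powr p * \<Psi> x"
        using \<Psi> v0
      proof eventually_elim
        case (elim x)
        show ?case
        proof (cases "x \<in> S")
          case True
          have "(a powr p * (1 - p) + p * a powr (p - 1) * \<bar>v x\<bar>) * \<Psi> x \<le> \<bar>v x\<bar> powr p * \<Psi> x"
            using elim(1) by (intro mult_right_mono powr_tangent a p) auto
          then show ?thesis using True elim(1) by (simp add: abs_mult algebra_simps)
        next
          case False
          then show ?thesis using elim by simp
        qed
      qed
    qed (intro i1 i3 iv Bochner_Integration.integrable_add integrable_mult_right)+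
    also have "(\<integral>x. a powr p * (1 - p) * (indicator S x * \<Psi> x) + p * a powr (p - 1) * \<bar>v x * \<Psi> x\<bar> \<partial>M)
       = a powr p * (1 - p) * (\<integral>x. indicator S x * \<Psi> x \<partial>M) + p * a powr (p - 1) * (\<integral>x. \<bar>v x * \<Psi> x\<bar> \<partial>M)"
      by (subst Bochner_Integration.integral_add) (auto intro!: i3 iv integrable_mult_right simp del: abs_mult)
    finally have A: "a powr p * (1 - p) * (\<integral>x. indicator S x * \<Psi> x \<partial>M) + p * a powr (p - 1) * (\<integral>x. \<bar>v x * \<Psi> x\<bar>
        \<partial>M)
       \<le> (\<integral>x. \<bar>v x\<bar> powr p * \<Psi> x \<partial>M)" .
    have B: "a powr p * (1 - p) * K \<le> a powr p * (1 - p) * (\<integral>x. indicator S x * \<Psi> x \<partial>M)"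
      using p i3(2) by (intro mult_left_mono_neg) (auto simp: mult_nonneg_nonpos)
    have C: "p * a powr (p - 1) * V \<le> p * a powr (p - 1) * (\<integral>x. \<bar>v x * \<Psi> x\<bar> \<partial>M)"
      using p Vle by (intro mult_left_mono) auto
    have "V = a * K" using K by (simp add: a_def)
    then have "p * a powr (p - 1) * V = p * (a powr (p - 1) * a) * K" by simp
    also have "a powr (p - 1) * a = a powr p" using a by (simp add: powr_diff)
    finally have D: "p * a powr (p - 1) * V = p * a powr p * K" .
    have "K powr (1 - p) * V powr p = a powr p * K"
      using K V by (simp add: a_def powr_divide powr_diff)
    also have "\<dots> = a powr p * (1 - p) * K + p * a powr p * K" by (simp add: algebra_simps)
    finally show ?thesis using A B C D unfolding V_def by linarith
  qed
qed

lemma L2_scale: "f \<in> L2 \<Longrightarrow> (\<lambda>x. c * f x) \<in> L2" for f :: "'a::euclidean_space \<Rightarrow> real"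
  by (auto simp: L2_def power_mult_distrib)

context
  fixes m \<mu> p \<epsilon> R :: real and u0 u1 :: "'a::euclidean_space \<Rightarrow> real" and T :: ereal
    and u v :: "real \<Rightarrow> 'a \<Rightarrow> real" and t1 :: real
  assumes m: "m \<ge> 0" and p: "p > 1" and R: "R > 1"
    and t1: "1 < t1" "ereal t1 < T"
    and cH1: "C_H1 T u" and c1: "C1_L2 T u v" and supp: "support_property m R T u"
begin

lemma Icc_Ico: "s \<in> {1..t1} \<Longrightarrow> s \<in> Ico T"
proof -
  assume "s \<in> {1..t1}"
  then have "1 \<le> s" "ereal s \<le> ereal t1" by auto
  from this(1) le_less_trans[OF this(2) t1(2)] show ?thesis unfolding Ico_def by blast
qed

lemma uL2: "s \<in> Ico T \<Longrightarrow> u s \<in> L2" and uH1: "s \<in> Ico T \<Longrightarrow> u s \<in> H1" and vL2: "s \<in> Ico T \<Longrightarrow> v s \<in> L2"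
  using cH1 c1 by (auto simp: C_H1_def C1_L2_def C_L2_def H1_L2)

lemma difference_quotient_L2: "s \<in> Ico T \<Longrightarrow> t \<in> Ico T \<Longrightarrow> (\<lambda>x. (u s x - u t x) / (s - t) - v t x) \<in> L2"
proof -
  assume "s \<in> Ico T" "t \<in> Ico T"
  then have "(\<lambda>x. (1 / (s - t)) * (u s x - u t x) - v t x) \<in> L2"
    by (intro L2_diff L2_scale uL2 vL2)
  then show ?thesis by simp
qed

text \<open>\<open>v s\<close> is an \<open>L2\<close> limit of difference quotients, and those
  taken from the left vanish beyond radius \<open>R + phi_m m s\<close>, because this radius grows
  with time. The argument uses earlier times, hence \<open>s > 1\<close>.\<close>

lemma v_support:
  assumes s: "s \<in> {1<..t1}"
  shows "AE x in LExt. norm x > R + phi_m m s \<longrightarrow> v s x = 0"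
proof -
  have sI: "s \<in> Ico T" using Icc_Ico s by auto
  let ?A = "{x::'a. norm x > R + phi_m m s}"
  have A: "?A \<inter> space LExt \<in> sets LExt"
  proof -
    have "?A \<in> sets lebesgue" 
    proof (intro sets_completionI_sets)
      have "open ?A" by (intro open_Collect_less continuous_intros)
      then show "?A \<in> sets lborel" by simp
    qed
    then show ?thesis
      unfolding sets_restrict_space space_restrict_space by (intro image_eqI[of _ _ ?A]) auto
  qed
  have vi: "integrable LExt (\<lambda>x. (v s x)\<^sup>2)" using vL2[OF sI] by (auto simp: L2_def)
  have iA: "integrable LExt (\<lambda>x. indicator ?A x * (v s x)\<^sup>2)"
  proof (rule Bochner_Integration.integrable_bound[OF vi])
    show "(\<lambda>x. indicator ?A x * (v s x)\<^sup>2) \<in> borel_measurable LExt"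
      using A vi by (intro borel_measurable_times) (auto simp: borel_measurable_indicator_iff)
  qed (auto simp: indicator_def)
  have lim: "((\<lambda>r. L2_norm (\<lambda>x. (u r x - u s x) / (r - s) - v s x)) \<longlongrightarrow> 0) (at s within {1..<s})"
  proof (rule tendsto_within_subset)
    show "((\<lambda>r. L2_norm (\<lambda>x. (u r x - u s x) / (r - s) - v s x)) \<longlongrightarrow> 0) (at s within Ico T)"
      using c1 sI by (auto simp: C1_L2_def)
    show "{1..<s} \<subseteq> Ico T" using Icc_Ico s by force
  qed
  have bound: "(\<integral>x. indicator ?A x * (v s x)\<^sup>2 \<partial>LExt) \<le> (L2_norm (\<lambda>x. (u r x - u s x) / (r - s) - v s x))\<^sup>2"
    if r: "r \<in> {1..<s}" for r
    unfolding L2_norm_sq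
  proof (rule integral_mono_AE[OF iA])
    have rI: "r \<in> Ico T" using Icc_Ico r s by auto
    show "integrable LExt (\<lambda>x. (norm ((u r x - u s x) / (r - s) - v s x))\<^sup>2)"
      using difference_quotient_L2[OF rI sI] by (auto simp: L2_def)
    have mono: "phi_m m r \<le> phi_m m s"
      unfolding phi_m_def using r s m by (intro divide_right_mono powr_mono2) auto
    have "AE x in LExt. norm x > R + phi_m m r \<longrightarrow> u r x = 0" "AE x in LExt. norm x > R + phi_m m s \<longrightarrow> u s x = 0"
      using supp rI sI by (auto simp: support_property_def)
    then show "AE x in LExt. indicator ?A x * (v s x)\<^sup>2 \<le> (norm ((u r x - u s x) / (r - s) - v s x))\<^sup>2"
    proof eventually_elim
      case (elim x)
      then show ?case using mono by (auto simp: indicator_def)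
    qed
  qed
  have "s islimpt {1..<s}"
    using islimpt_greaterThanLessThan2[of 1 s] s by (rule_tac islimpt_subset[of _ "{1<..<s}"]) auto
  then have nt: "at s within {1..<s} \<noteq> bot" by (simp add: trivial_limit_within)
  have "(\<integral>x. indicator ?A x * (v s x)\<^sup>2 \<partial>LExt) \<le> 0\<^sup>2"
    by (rule tendsto_lowerbound[OF tendsto_power[OF lim] _ nt])
      (use bound in \<open>auto simp: eventually_at_filter\<close>)
  moreover have "0 \<le> (\<integral>x. indicator ?A x * (v s x)\<^sup>2 \<partial>LExt)" by simp
  ultimately have "(\<integral>x. indicator ?A x * (v s x)\<^sup>2 \<partial>LExt) = 0" by simp
  then have "AE x in LExt. indicator ?A x * (v s x)\<^sup>2 = 0"
    using iA by (subst (asm) integral_nonneg_eq_0_iff_AE) auto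
  then show ?thesis by eventually_elim (auto simp: indicator_def)
qed

lemma pairing_derivative:
  assumes \<Psi>: "\<Psi> \<in> L2" and t: "t \<in> {1..t1}"
  shows "((\<lambda>s. \<integral>x. u s x * \<Psi> x \<partial>LExt) has_real_derivative (\<integral>x. v t x * \<Psi> x \<partial>LExt)) (at t within {1..t1})"
  unfolding has_field_derivative_iff
proof (rule Lim_null[THEN iffD2], rule Lim_null_comparison)
  let ?U = "\<lambda>s. \<integral>x. u s x * \<Psi> x \<partial>LExt"
  let ?D = "\<lambda>s. L2_norm (\<lambda>x. (u s x - u t x) / (s - t) - v t x)"
  have tI: "t \<in> Ico T" using Icc_Ico t by auto
  have "(?D \<longlongrightarrow> 0) (at t within {1..t1})"
  proof (rule tendsto_within_subset)
    show "(?D \<longlongrightarrow> 0) (at t within Ico T)" using c1 tI by (auto simp: C1_L2_def)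
  qed (use Icc_Ico in auto)
  from tendsto_mult_right[OF this, of "L2_norm \<Psi>"]
  show "((\<lambda>s. ?D s * L2_norm \<Psi>) \<longlongrightarrow> 0) (at t within {1..t1})" by simp
  show "\<forall>\<^sub>F s in at t within {1..t1}. norm ((?U s - ?U t) / (s - t) - (\<integral>x. v t x * \<Psi> x \<partial>LExt)) \<le> ?D s * L2_norm
      \<Psi>"
    unfolding eventually_at_filter
  proof (intro always_eventually allI impI)
    fix s assume "s \<noteq> t" "s \<in> {1..t1}"
    then have sI: "s \<in> Ico T" using Icc_Ico by auto
    have "(?U s - ?U t) / (s - t) - (\<integral>x. v t x * \<Psi> x \<partial>LExt) = (\<integral>x. ((u s x - u t x) / (s - t) - v t x) * \<Psi> x
        \<partial>LExt)"
    proof -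
      have i: "integrable LExt (\<lambda>x. u s x * \<Psi> x)" "integrable LExt (\<lambda>x. u t x * \<Psi> x)" "integrable LExt (\<lambda>x. v t
          x * \<Psi> x)"
        by (intro L2_mult_integrable uL2 vL2 sI tI \<Psi>)+
      have "(\<integral>x. ((u s x - u t x) / (s - t) - v t x) * \<Psi> x \<partial>LExt) = (\<integral>x. (u s x * \<Psi> x - u t x * \<Psi> x) / (s - t) -
          v t x * \<Psi> x \<partial>LExt)"
        by (intro Bochner_Integration.integral_cong) (auto simp: left_diff_distrib)
      also have "\<dots> = (?U s - ?U t) / (s - t) - (\<integral>x. v t x * \<Psi> x \<partial>LExt)"
        using i by simp
      finally show ?thesis by simp
    qed
    then show "norm ((?U s - ?U t) / (s - t) - (\<integral>x. v t x * \<Psi> x \<partial>LExt)) \<le> ?D s * L2_norm \<Psi>"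
      using L2_Cauchy_Schwarz[OF difference_quotient_L2[OF sI tI] \<Psi>] by simp
  qed
qed

lemma pairing_continuous:
  assumes \<Psi>: "\<Psi> \<in> L2"
  shows "continuous_on {1..t1} (\<lambda>s. \<integral>x. v s x * \<Psi> x \<partial>LExt)"
  unfolding continuous_on_def
proof
  fix t assume t: "t \<in> {1..t1}"
  let ?V = "\<lambda>s. \<integral>x. v s x * \<Psi> x \<partial>LExt"
  let ?D = "\<lambda>s. L2_norm (\<lambda>x. v s x - v t x)"
  have tI: "t \<in> Ico T" using Icc_Ico t by auto
  have lim: "(?D \<longlongrightarrow> 0) (at t within {1..t1})"
  proof (rule tendsto_within_subset)
    show "(?D \<longlongrightarrow> 0) (at t within Ico T)" using c1 tI by (auto simp: C1_L2_def C_L2_def)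
  qed (use Icc_Ico in auto)
  show "(?V \<longlongrightarrow> ?V t) (at t within {1..t1})"
  proof (rule Lim_null[THEN iffD2], rule Lim_null_comparison)
    show "((\<lambda>s. ?D s * L2_norm \<Psi>) \<longlongrightarrow> 0) (at t within {1..t1})"
      using tendsto_mult_right[OF lim, of "L2_norm \<Psi>"] by simp
    show "\<forall>\<^sub>F s in at t within {1..t1}. norm (?V s - ?V t) \<le> ?D s * L2_norm \<Psi>"
      unfolding eventually_at_filter
    proof (intro always_eventually allI impI)
      fix s assume "s \<noteq> t" "s \<in> {1..t1}"
      then have sI: "s \<in> Ico T" using Icc_Ico by auto
      have "?V s - ?V t = (\<integral>x. v s x * \<Psi> x - v t x * \<Psi> x \<partial>LExt)"
        by (intro Bochner_Integration.integral_diff[symmetric] L2_mult_integrable vL2 sI tI \<Psi>)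
      also have "\<dots> = (\<integral>x. (v s x - v t x) * \<Psi> x \<partial>LExt)" by (simp add: left_diff_distrib)
      finally show "norm (?V s - ?V t) \<le> ?D s * L2_norm \<Psi>"
        using L2_Cauchy_Schwarz[OF L2_diff[OF vL2[OF sI] vL2[OF tI]] \<Psi>] by simp
    qed
  qed
qed

end

text \<open>The support of \<open>v\<close> is controlled only after time 1; a single instant is
  negligible.\<close>

lemma AE_lebesgue_except_1: "AE s in lebesgue. s \<in> {1..t::real} \<longrightarrow> s \<noteq> 1 \<longrightarrow> Q s \<Longrightarrow>
    AE s in lebesgue. s \<in> {1..t} \<longrightarrow> Q s"
proof -
  assume a: "AE s in lebesgue. s \<in> {1..t::real} \<longrightarrow> s \<noteq> 1 \<longrightarrow> Q s"
  have "AE s in lebesgue. s \<noteq> (1::real)"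
    by (rule AE_completion) (auto intro: AE_lborel_singleton)
  with a show ?thesis by eventually_elim auto
qed

section \<open>Space-time test functions and reduction of the weak formulation\<close>

lemma smooth_on_fst_radial:
  "smooth_on UNIV P \<Longrightarrow> smooth_on UNIV (\<lambda>z::'a::euclidean_space \<times> real. P (fst z \<bullet> fst z))"
proof -
  assume P: "smooth_on UNIV P"
  have "bounded_linear (\<lambda>z::'a \<times> real. fst z \<bullet> b)" for b
    by (intro bounded_linear_compose[OF bounded_linear_inner_left bounded_linear_fst])
  then have "smooth_on UNIV (\<lambda>z::'a \<times> real. \<Sum>b\<in>Basis. (fst z \<bullet> b) * (fst z \<bullet> b))"
    by (intro smooth_on_sum smooth_on_mult smooth_on_bounded_linear) auto
  then have "smooth_on UNIV (\<lambda>z::'a \<times> real. fst z \<bullet> fst z)" by (simp add: euclidean_inner[symmetric])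
  from smooth_on_compose[OF P this] show ?thesis by simp
qed

lemma L2_measurable: "f \<in> L2 \<Longrightarrow> f \<in> borel_measurable LExt"
  by (simp add: L2_def)

text \<open>For \<open>a < b\<close>, a smooth switch from 1 to 0 across \<open>{a..b}\<close>, in a
  form built from the operations covered by the closure rules for \<open>smooth_on\<close>.\<close>

definition switch :: "real \<Rightarrow> real \<Rightarrow> real \<Rightarrow> real" where
  "switch a b s = 1 + (-1) * cutoff ((s + - a) * inverse (b - a))"

lemma switch_smooth: "smooth_on UNIV (switch a b)"
proof -
  have "smooth_on UNIV (\<lambda>s::real. cutoff ((s + - a) * inverse (b - a)))"
    by (intro smooth_on_compose[OF smooth_on_cutoff, where S = UNIV] smooth_on_add smooth_on_mult
        smooth_on_const smooth_on_bounded_linear bounded_linear_ident) simp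
  then show ?thesis
    unfolding switch_def[abs_def] by (intro smooth_on_add smooth_on_mult smooth_on_const)
qed

lemma switch_1: "a < b \<Longrightarrow> s \<le> a \<Longrightarrow> switch a b s = 1"
  unfolding switch_def by (subst cutoff_0) (auto simp: mult_le_0_iff)

lemma switch_0: "a < b \<Longrightarrow> s \<ge> b \<Longrightarrow> switch a b s = 0"
  unfolding switch_def by (subst cutoff_1) (auto simp: field_simps)

lemma switch_bounds: "0 \<le> switch a b s" "switch a b s \<le> 1"
  unfolding switch_def using cutoff_ge_0[of "(s + - a) * inverse (b - a)"] cutoff_le_1[of "(s + - a) * inverse
      (b - a)"] by auto

context radial_test
begin

text \<open>The switch provides compact support in \<open>Ico T\<close>; in space the support may
  touch the unit sphere, which belongs to \<open>Ext\<close>.\<close>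

lemma spacetime_test:
  assumes "1 < b" "ereal b < T" "a < b"
  shows "(\<lambda>z::'a::euclidean_space \<times> real. P (fst z \<bullet> fst z) * switch a b (snd z)) \<in> C0_infty (Ext \<times> Ico T)"
proof -
  let ?K = "(Ext \<inter> cball (0::'a) M) \<times> {1..b}"
  have "closed (Ext :: 'a set)" unfolding Ext_def by (metis Compl_eq_Diff_UNIV closed_Compl open_ball)
  then have "compact ?K" by (intro compact_Times closed_Int_compact) auto
  moreover have "?K \<subseteq> Ext \<times> Ico T"
  proof -
    have "s \<in> Ico T" if "1 \<le> s" "s \<le> b" for s
    proof -
      have "ereal s \<le> ereal b" using that by simp
      from le_less_trans[OF this assms(2)] that show ?thesis unfolding Ico_def by blast
    qed
    then show ?thesis by auto
  qed
  moreover have "P (fst z \<bullet> fst z) * switch a b (snd z) = 0" if z: "z \<in> Ext \<times> Ico T - ?K" for z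
  proof (cases "fst z \<in> cball 0 M")
    case True
    then have "\<not> snd z \<le> b" using z by (cases z) (auto simp: Ico_def)
    then show ?thesis using switch_0[OF assms(3)] by simp
  next
    case False
    then show ?thesis using P0[OF inner_gt_M[OF False]] by simp
  qed
  moreover have "smooth (\<lambda>z::'a \<times> real. P (fst z \<bullet> fst z) * switch a b (snd z))"
    unfolding smooth_iff_smooth_on
    by (intro smooth_on_mult smooth_on_fst_radial P smooth_on_compose[OF switch_smooth] smooth_on_bounded_linear
        bounded_linear_snd) auto
  ultimately show ?thesis unfolding C0_infty_def by blast
qed

lemma \<Psi>_L2: "(\<lambda>x::'a::euclidean_space. P (x \<bullet> x)) \<in> L2"
  by (rule L2_cont[OF radial_continuous[OF P] compact_cball[of 0 M]]) (auto simp: P0 inner_gt_M)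

lemma \<Psi>_borel: "(\<lambda>x::'a::euclidean_space. P (x \<bullet> x)) \<in> borel_measurable borel"
  by (rule borel_measurable_continuous_onI[OF radial_continuous[OF P]])

lemma \<Psi>_indicator_integrable: "integrable LExt (\<lambda>x::'a::euclidean_space. indicator (cball 0 \<rho>) x * P (x \<bullet> x))"
proof (rule Bochner_Integration.integrable_bound)
  show "integrable LExt (\<lambda>x::'a. P (x \<bullet> x))"
    by (rule integrable_LExt_cont[OF radial_continuous[OF P] compact_cball[of 0 M]]) (auto simp: P0 inner_gt_M)
  show "(\<lambda>x::'a. indicator (cball 0 \<rho>) x * P (x \<bullet> x)) \<in> borel_measurable LExt"
    by (rule borel_imp_LExt) (intro borel_measurable_times \<Psi>_borel borel_measurable_indicator, auto)
qed (auto simp: indicator_def)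

text \<open>Up to time \<open>t1\<close> the test function is constant in time, so the weak
  formulation says that \<open>V - V 1\<close> is the integral of \<open>c + A\<close>, with
  \<open>A\<close> merely integrable. Hoelder's inequality gives \<open>A \<ge> b\<close> almost
  everywhere with \<open>b\<close> continuous; hence \<open>V\<close> minus the integral of
  \<open>c + b\<close> is nondecreasing, and \<open>c + b\<close> bounds the Dini derivative of
  \<open>V\<close> from below. \<open>K\<close> bounds the mass of the test function on the support
  of \<open>v\<close>.\<close>

theorem weak_reduction:
  fixes u0 u1 :: "'a::euclidean_space \<Rightarrow> real"
  assumes m: "m \<ge> 0" and p: "p > 1" and R: "R > 1"
    and t1: "1 < t1" "ereal t1 < T"
    and ws: "weak_solution m \<mu> p \<epsilon> u0 u1 T u" and supp: "support_property m R T u"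
    and u0: "u0 \<in> L2" and u1: "u1 \<in> L2"
    and P1': "P 1 = 0" and Pnn: "\<And>y. y \<ge> 1 \<Longrightarrow> P y \<ge> 0"
    and ode: "\<And>y. 1 \<le> y \<Longrightarrow> y \<le> (R + phi_m m t1)\<^sup>2 \<Longrightarrow> 4 * P2 y * y + 2 * real DIM('a) * P1 y = P y"
    and K: "continuous_on {1..t1} K" "\<And>s. s \<in> {1..t1} \<Longrightarrow> K s > 0"
      "\<And>s. s \<in> {1..t1} \<Longrightarrow> (\<integral>x. indicator (cball (0::'a) (R + phi_m m s)) x * P (x \<bullet> x) \<partial>LExt) \<le> K s"
  shows "\<exists>U V. U 1 = \<epsilon> * (\<integral>x. u0 x * P (x \<bullet> x) \<partial>LExt) \<and> V 1 = \<epsilon> * (\<integral>x. u1 x * P (x \<bullet> x) \<partial>LExt) \<and>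
    (\<forall>t. 1 \<le> t \<longrightarrow> t \<le> t1 \<longrightarrow> (U has_real_derivative V t) (at t within {1..t1})) \<and> continuous_on {1..t1} V \<and>
    (\<forall>t. 1 \<le> t \<longrightarrow> t < t1 \<longrightarrow> lower_rderiv V t (t powr (2 * m) * U t - \<mu> / t * V t + K t powr (1 - p) * \<bar>V t\<bar> powr
        p))"
proof -
  let ?\<Psi> = "\<lambda>x::'a. P (x \<bullet> x)"
  have cH1: "C_H1 T u" and tr: "\<And>t. t \<in> Ico T \<Longrightarrow> has_trace (u t) (\<lambda>_. 0)"
    and ui: "AE x in LExt. u 1 x = \<epsilon> * u0 x"
    using ws unfolding weak_solution_def by simp_all
  from ws obtain v where c1: "C1_L2 T u v" and vi: "AE x in LExt. v 1 x = \<epsilon> * u1 x"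
    and weak0: "\<forall>\<Phi> \<in> C0_infty (Ext \<times> Ico T).
             (\<forall>x. \<forall>t\<in>Ico T. norm x = 1 \<longrightarrow> \<Phi> (x, t) = 0) \<longrightarrow>
             (\<forall>t\<in>Ico T.
                integrable (lebesgue_on ({1..t} \<times> Ext)) (\<lambda>(s, x). \<bar>v s x\<bar> powr p * \<Phi> (x, s)) \<and>
                (\<integral>x. v t x * \<Phi> (x, t) \<partial>LExt)
                - (\<integral>x. v 1 x * \<Phi> (x, 1) \<partial>LExt)
                - (LINT s:{1..t}|lebesgue. (\<integral>x. v s x * deriv (\<lambda>\<tau>. \<Phi> (x, \<tau>)) s \<partial>LExt))
                + (LINT s:{1..t}|lebesgue.
                     (\<integral>x. s powr (2 * m) * (weak_grad (u s) x \<bullet> grad (\<lambda>y. \<Phi> (y, s)) x) \<partial>LExt))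
                + (LINT s:{1..t}|lebesgue. (\<integral>x. \<mu> / s * v s x * \<Phi> (x, s) \<partial>LExt))
                = (LINT s:{1..t}|lebesgue. (\<integral>x. \<bar>v s x\<bar> powr p * \<Phi> (x, s) \<partial>LExt)))"
    unfolding weak_solution_def by (elim conjE exE)
  note ctx = m p R t1 cH1 c1 supp
  note Icc = Icc_Ico[OF ctx] and uL2 = uL2[OF ctx] and uH1 = uH1[OF ctx] and vL2 = vL2[OF ctx]
  define U where "U s = (\<integral>x. u s x * ?\<Psi> x \<partial>LExt)" for s
  define V where "V s = (\<integral>x. v s x * ?\<Psi> x \<partial>LExt)" for s
  define A where "A s = (\<integral>x. \<bar>v s x\<bar> powr p * ?\<Psi> x \<partial>LExt)" for s
  have init: "(\<integral>x. f x * ?\<Psi> x \<partial>LExt) = \<epsilon> * (\<integral>x. f0 x * ?\<Psi> x \<partial>LExt)"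
    if "f \<in> L2" "f0 \<in> L2" "AE x in LExt. f x = \<epsilon> * f0 x" for f f0
  proof -
    have "(\<integral>x. f x * ?\<Psi> x \<partial>LExt) = (\<integral>x. \<epsilon> * (f0 x * ?\<Psi> x) \<partial>LExt)"
    proof (rule integral_cong_AE)
      show "(\<lambda>x. f x * ?\<Psi> x) \<in> borel_measurable LExt" "(\<lambda>x. \<epsilon> * (f0 x * ?\<Psi> x)) \<in> borel_measurable LExt"
        by (intro borel_measurable_times borel_measurable_const L2_measurable that \<Psi>_L2)+
      show "AE x in LExt. f x * ?\<Psi> x = \<epsilon> * (f0 x * ?\<Psi> x)" using that(3) by eventually_elim simp
    qed
    then show ?thesis by simp
  qed
  have one: "1 \<in> Ico T" using Icc[of 1] t1 by auto
  have U1: "U 1 = \<epsilon> * (\<integral>x. u0 x * ?\<Psi> x \<partial>LExt)" unfolding U_def by (rule init[OF uL2[OF one] u0 ui])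
  have V1: "V 1 = \<epsilon> * (\<integral>x. u1 x * ?\<Psi> x \<partial>LExt)" unfolding V_def by (rule init[OF vL2[OF one] u1 vi])
  have Ud: "(U has_real_derivative V t) (at t within {1..t1})" if "1 \<le> t" "t \<le> t1" for t
    unfolding U_def[abs_def] V_def by (rule pairing_derivative[OF ctx \<Psi>_L2]) (use that in auto)
  have Vc: "continuous_on {1..t1} V"
    unfolding V_def[abs_def] by (rule pairing_continuous[OF ctx \<Psi>_L2])
  have Uc: "continuous_on {1..t1} U" by (rule DERIV_continuous_on[OF Ud]) auto
  \<comment> \<open>Two later times leave a margin: the switch equals 1 in a neighbourhood of
    \<open>t1\<close>, so the time derivative of the test function vanishes up to and including
    \<open>t1\<close>.\<close>
  obtain t2 where t2: "t1 < t2" "ereal t2 < T" using ereal_dense2[OF t1(2)] by auto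
  obtain t3 where t3: "t2 < t3" "ereal t3 < T" using ereal_dense2[OF t2(2)] by auto
  let ?\<zeta> = "switch t2 t3"
  define \<Phi> where "\<Phi> z = P (fst z \<bullet> fst z) * ?\<zeta> (snd z)" for z :: "'a \<times> real"
  have \<Phi>C: "\<Phi> \<in> C0_infty (Ext \<times> Ico T)"
    unfolding \<Phi>_def[abs_def] by (rule spacetime_test) (use t1 t2 t3 in auto)
  have \<Phi>b: "\<Phi> (x, t) = 0" if "norm x = 1" for x t
    using that P1' by (simp add: \<Phi>_def norm_eq_sqrt_inner)
  have weak: "integrable (lebesgue_on ({1..t} \<times> Ext)) (\<lambda>(s, x). \<bar>v s x\<bar> powr p * \<Phi> (x, s)) \<and>
                (\<integral>x. v t x * \<Phi> (x, t) \<partial>LExt)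
                - (\<integral>x. v 1 x * \<Phi> (x, 1) \<partial>LExt)
                - (LINT s:{1..t}|lebesgue. (\<integral>x. v s x * deriv (\<lambda>\<tau>. \<Phi> (x, \<tau>)) s \<partial>LExt))
                + (LINT s:{1..t}|lebesgue.
                     (\<integral>x. s powr (2 * m) * (weak_grad (u s) x \<bullet> grad (\<lambda>y. \<Phi> (y, s)) x) \<partial>LExt))
                + (LINT s:{1..t}|lebesgue. (\<integral>x. \<mu> / s * v s x * \<Phi> (x, s) \<partial>LExt))
                = (LINT s:{1..t}|lebesgue. (\<integral>x. \<bar>v s x\<bar> powr p * \<Phi> (x, s) \<partial>LExt))" if "t \<in> Ico T" for t
    using weak0[rule_format, OF \<Phi>C] \<Phi>b that by simp
  have \<Phi>e: "\<Phi> (x, s) = ?\<Psi> x" if "s \<le> t1" for x s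
    using that switch_1[of t2 t3 s] t2 t3 by (simp add: \<Phi>_def)
  have \<Phi>d: "deriv (\<lambda>\<tau>. \<Phi> (x, \<tau>)) s = 0" if "s \<le> t1" for x s
  proof (rule DERIV_imp_deriv)
    have "((\<lambda>\<tau>. ?\<Psi> x) has_real_derivative 0) (at s)" by simp
    then show "((\<lambda>\<tau>. \<Phi> (x, \<tau>)) has_real_derivative 0) (at s)"
      by (rule has_field_derivative_transform_within_open[of _ _ _ "{..<t2}"])
        (use that switch_1[of t2 t3] t2 t3 in \<open>auto simp: \<Phi>_def\<close>)
  qed
  \<comment> \<open>Green's formula brings in \<open>lap\<close>, which equals the test function on
    the support of \<open>u s\<close> by the eigenvalue equation. This produces the term with
    \<open>U\<close>.\<close>
  have \<Phi>g: "(\<integral>x. s powr (2 * m) * (weak_grad (u s) x \<bullet> grad (\<lambda>y. \<Phi> (y, s)) x) \<partial>LExt) = - (s powr (2 * m) * U s)"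
    if s: "s \<in> {1..t1}" for s
  proof -
    have sI: "s \<in> Ico T" by (rule Icc[OF s])
    have "(\<integral>x. s powr (2 * m) * (weak_grad (u s) x \<bullet> grad (\<lambda>y. \<Phi> (y, s)) x) \<partial>LExt)
      = s powr (2 * m) * (\<integral>x. weak_grad (u s) x \<bullet> grad ?\<Psi> x \<partial>LExt)"
      using s by (simp add: \<Phi>e)
    also have "(\<integral>x. weak_grad (u s) x \<bullet> grad ?\<Psi> x \<partial>LExt) = - (\<integral>x. u s x * lap x \<partial>LExt)"
      by (rule green_zero_trace[OF uH1[OF sI] tr[OF sI]])
    also have "(\<integral>x. u s x * lap x \<partial>LExt) = U s"
      unfolding U_def
    proof (rule integral_cong_AE)
      show "(\<lambda>x. u s x * lap x) \<in> borel_measurable LExt" "(\<lambda>x. u s x * ?\<Psi> x) \<in> borel_measurable LExt"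
        by (intro borel_measurable_times L2_measurable uL2[OF sI] \<Psi>_L2 lap_L2)+
      have mono: "phi_m m s \<le> phi_m m t1"
        unfolding phi_m_def using s m by (intro divide_right_mono powr_mono2) auto
      have "AE x in LExt. norm x > R + phi_m m s \<longrightarrow> u s x = 0"
        using supp sI by (auto simp: support_property_def)
      then show "AE x in LExt. u s x * lap x = u s x * ?\<Psi> x"
        using AE_LExt_norm
      proof eventually_elim
        case (elim x)
        show ?case
        proof (cases "norm x > R + phi_m m s")
          case False
          have "(norm x)\<^sup>2 \<le> (R + phi_m m t1)\<^sup>2" using False mono by (intro power_mono) auto
          then have "x \<bullet> x \<le> (R + phi_m m t1)\<^sup>2" by (simp add: power2_norm_eq_inner)
          moreover have "1 \<le> x \<bullet> x" using elim(2) by (simp add: norm_gt_1_iff)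
          ultimately show ?thesis using ode[of "x \<bullet> x"] by (simp add: lap_def)
        qed (use elim in simp)
      qed
    qed
    finally show ?thesis by simp
  qed
  have int: "integrable (lebesgue_on ({1..t1} \<times> Ext)) (\<lambda>(s, x). \<bar>v s x\<bar> powr p * \<Phi> (x, s))"
    using weak[of t1] Icc[of t1] t1 by auto
  have meas: "(\<lambda>x. (case (s, x) of (s, x) \<Rightarrow> \<bar>v s x\<bar> powr p * \<Phi> (x, s))) \<in> borel_measurable LExt"
    if s: "s \<in> {1..t1}" for s
  proof -
    have "(\<lambda>x. \<bar>v s x\<bar> powr p * ?\<Psi> x) \<in> borel_measurable LExt"
      by (intro borel_measurable_times powr_real_measurable borel_measurable_abs borel_measurable_const
          L2_measurable vL2[OF Icc[OF s]] \<Psi>_L2)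
    then show ?thesis using s by (simp add: \<Phi>e)
  qed
  have sl1: "AE s in lebesgue. s \<in> {1..t1} \<longrightarrow> integrable LExt (\<lambda>x. (case (s, x) of (s, x) \<Rightarrow> \<bar>v s x\<bar> powr p * \<Phi>
      (x, s)))"
    by (rule Fubini_slices_lebesgue(1)[OF int]) (rule meas)
  have sl2: "set_integrable lebesgue {1..t1} (\<lambda>s. \<integral>x. (case (s, x) of (s, x) \<Rightarrow> \<bar>v s x\<bar> powr p * \<Phi> (x, s))
      \<partial>LExt)"
    by (rule Fubini_slices_lebesgue(2)[OF int]) (rule meas)
  have Aint: "set_integrable lebesgue {1..t1} A"
    using sl2 by (rule set_integrable_cong[THEN iffD1, rotated 3]) (auto simp: A_def \<Phi>e)
  define b where "b s = K s powr (1 - p) * \<bar>V s\<bar> powr p" for s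
  \<comment> \<open>Hoelder's inequality holds at almost every time only: the slice of the integrand
    must be integrable, and the support of \<open>v s\<close> is known for
    \<open>s > 1\<close>.\<close>
  have Ab: "AE s in lebesgue. s \<in> {1..t1} \<longrightarrow> b s \<le> A s"
  proof (rule AE_lebesgue_except_1)
    show "AE s in lebesgue. s \<in> {1..t1} \<longrightarrow> s \<noteq> 1 \<longrightarrow> b s \<le> A s"
      using sl1
    proof eventually_elim
      case (elim s)
      show ?case
      proof (intro impI)
        assume s: "s \<in> {1..t1}" "s \<noteq> 1"
        have sI: "s \<in> Ico T" by (rule Icc[OF s(1)])
        have i1: "integrable LExt (\<lambda>x. \<bar>v s x\<bar> powr p * ?\<Psi> x)" using elim s by (simp add: \<Phi>e)
        have cb: "cball 0 (R + phi_m m s) \<inter> Ext \<in> sets (LExt :: 'a measure)"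
          unfolding sets_restrict_space by (intro image_eqI[of _ _ "cball 0 (R + phi_m m s)"]) auto
        have "K s powr (1 - p) * \<bar>\<integral>x. v s x * ?\<Psi> x \<partial>LExt\<bar> powr p \<le> (\<integral>x. \<bar>v s x\<bar> powr p * ?\<Psi> x \<partial>LExt)"
        proof (rule Hoelder_support[OF p K(2)[OF s(1)] _ cb _ i1])
          show "AE x in LExt. ?\<Psi> x \<ge> 0"
            using AE_LExt_norm by eventually_elim (auto intro!: Pnn simp: norm_gt_1_iff)
          have "AE x in LExt. norm x > R + phi_m m s \<longrightarrow> v s x = 0"
            by (rule v_support[OF ctx]) (use s in auto)
          then show "AE x in LExt. x \<notin> cball 0 (R + phi_m m s) \<inter> Ext \<longrightarrow> v s x = 0"
            using AE_LExt_norm by eventually_elim (auto simp: Ext_iff)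
          show "integrable LExt (\<lambda>x. v s x * ?\<Psi> x)" by (intro L2_mult_integrable vL2 sI \<Psi>_L2)
          have eq: "(\<integral>x. indicator (cball 0 (R + phi_m m s) \<inter> Ext) x * ?\<Psi> x \<partial>LExt) = (\<integral>x. indicator (cball 0 (R
              + phi_m m s)) x * ?\<Psi> x \<partial>LExt)"
            by (intro Bochner_Integration.integral_cong) (auto simp: indicator_def)
          show "(\<integral>x. indicator (cball 0 (R + phi_m m s) \<inter> Ext) x * ?\<Psi> x \<partial>LExt) \<le> K s"
            unfolding eq by (rule K(3)[OF s(1)])
          have "integrable LExt (\<lambda>x. indicator (cball 0 (R + phi_m m s)) x * ?\<Psi> x)"
              by (rule \<Psi>_indicator_integrable)
          then show "integrable LExt (\<lambda>x. indicator (cball 0 (R + phi_m m s) \<inter> Ext) x * ?\<Psi> x)"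
            by (rule Bochner_Integration.integrable_cong[THEN iffD1, rotated 2]) (auto simp: indicator_def)
        qed
        then show "b s \<le> A s" by (simp add: b_def V_def A_def)
      qed
    qed
  qed
  define c where "c s = s powr (2 * m) * U s - \<mu> / s * V s" for s
  have cc: "continuous_on {1..t1} c" unfolding c_def[abs_def] by (intro continuous_intros Uc Vc) auto
  have bc: "continuous_on {1..t1} b"
  proof -
    have "continuous_on {1..t1} (\<lambda>s. K s powr (1 - p))"
      by (intro continuous_on_powr K(1) continuous_on_const) (use K(2) in \<open>auto dest!: less_imp_neq[OF K(2)]\<close>)
    moreover have "continuous_on {1..t1} (\<lambda>s. \<bar>V s\<bar> powr p)"
      by (intro continuous_on_powr' continuous_on_rabs Vc continuous_on_const) (use p in auto)
    ultimately show ?thesis unfolding b_def[abs_def] by (rule continuous_on_mult)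
  qed
  have ci: "set_integrable lebesgue {1..t} f" if "continuous_on {1..t1} f" "t \<le> t1" for f :: "real \<Rightarrow> real" and t
    by (rule absolutely_integrable_continuous_real) (rule continuous_on_subset[OF that(1)], use that in auto)
  have Ai: "set_integrable lebesgue {1..t} A" if "t \<le> t1" for t
    by (rule set_integrable_subset[OF Aint]) (use that in auto)
  have main: "V t = V 1 + (LINT s:{1..t}|lebesgue. c s) + (LINT s:{1..t}|lebesgue. A s)"
      if t: "t \<in> {1..t1}" for t
  proof -
    have le: "s \<le> t1" "s \<in> {1..t1}" if "s \<in> {1..t}" for s using that t by auto
    have "(\<integral>x. v t x * \<Phi> (x, t) \<partial>LExt) = V t" "(\<integral>x. v 1 x * \<Phi> (x, 1) \<partial>LExt) = V 1"
      using t by (simp_all add: \<Phi>e V_def)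
    moreover have "(LINT s:{1..t}|lebesgue. (\<integral>x. v s x * deriv (\<lambda>\<tau>. \<Phi> (x, \<tau>)) s \<partial>LExt)) = (LINT
        s:{1..t}|lebesgue. 0)"
      using le by (intro set_lebesgue_integral_cong) (auto simp: \<Phi>d)
    moreover have "(LINT s:{1..t}|lebesgue. (\<integral>x. s powr (2 * m) * (weak_grad (u s) x \<bullet> grad (\<lambda>y. \<Phi> (y, s)) x)
        \<partial>LExt))
        = (LINT s:{1..t}|lebesgue. - (s powr (2 * m) * U s))"
      using le \<Phi>g by (intro set_lebesgue_integral_cong) auto
    moreover have "(LINT s:{1..t}|lebesgue. (\<integral>x. \<mu> / s * v s x * \<Phi> (x, s) \<partial>LExt)) = (LINT s:{1..t}|lebesgue. \<mu> /
        s * V s)"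
      using le by (intro set_lebesgue_integral_cong) (auto simp: \<Phi>e V_def mult.assoc)
    moreover have "(LINT s:{1..t}|lebesgue. (\<integral>x. \<bar>v s x\<bar> powr p * \<Phi> (x, s) \<partial>LExt)) = (LINT s:{1..t}|lebesgue. A
        s)"
      using le by (intro set_lebesgue_integral_cong) (auto simp: \<Phi>e A_def)
    moreover have "(LINT s:{1..t}|lebesgue. c s) = (LINT s:{1..t}|lebesgue. s powr (2 * m) * U s) - (LINT
        s:{1..t}|lebesgue. \<mu> / s * V s)"
      unfolding c_def by (rule set_integral_diff(2)) (use t in \<open>auto intro!: ci continuous_intros Uc Vc\<close>)
    moreover have "(LINT s:{1..t}|lebesgue. - (s powr (2 * m) * U s)) = - (LINT s:{1..t}|lebesgue. s powr (2 *
        m) * U s)"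
      by (simp add: set_lebesgue_integral_def)
    moreover have "(LINT s:{1..t}|lebesgue. (0::real)) = 0" by (simp add: set_lebesgue_integral_def)
    ultimately show ?thesis using weak[OF Icc[OF t]] by simp
  qed
  define I where "I t = integral {1..t} (\<lambda>s. c s + b s)" for t
  \<comment> \<open>Up to the constant \<open>V 1\<close> this is the integral of
    \<open>A - b\<close>, which is nonnegative almost everywhere.\<close>
  define W where "W t = V t - I t" for t
  have cbc: "continuous_on {1..t1} (\<lambda>s. c s + b s)" by (intro continuous_intros cc bc)
  have Id: "(I has_real_derivative c t + b t) (at t within {1..t1})" if "t \<in> {1..t1}" for t
    unfolding I_def[abs_def] by (rule integral_has_real_derivative[OF cbc that])
  have Weq: "W t = V 1 + (LINT s:{1..t}|lebesgue. A s - b s)" if t: "t \<in> {1..t1}" for t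
  proof -
    have "I t = (LINT s:{1..t}|lebesgue. c s + b s)"
      unfolding I_def by (rule set_lebesgue_integral_eq_integral(2)[symmetric]) (use t in \<open>auto intro!: ci cbc\<close>)
    also have "\<dots> = (LINT s:{1..t}|lebesgue. c s) + (LINT s:{1..t}|lebesgue. b s)"
      by (rule set_integral_add(2)) (use t in \<open>auto intro!: ci cc bc\<close>)
    finally have "W t = V 1 + ((LINT s:{1..t}|lebesgue. A s) - (LINT s:{1..t}|lebesgue. b s))"
      unfolding W_def using main[OF t] by simp
    also have "(LINT s:{1..t}|lebesgue. A s) - (LINT s:{1..t}|lebesgue. b s) = (LINT s:{1..t}|lebesgue. A s - b
        s)"
      by (rule set_integral_diff(2)[symmetric]) (use t in \<open>auto intro!: ci bc Ai\<close>)
    finally show ?thesis .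
  qed
  have Wmono: "W s \<le> W t" if st: "1 \<le> s" "s \<le> t" "t \<le> t1" for s t
  proof -
    have i: "set_integrable lebesgue {1..t'} (\<lambda>s. A s - b s)" if "t' \<le> t1" for t'
      by (intro set_integral_diff(1) Ai ci bc that)
    have "(LINT s:{1..s}|lebesgue. A s - b s) \<le> (LINT s:{1..t}|lebesgue. A s - b s)"
      unfolding set_lebesgue_integral_def
    proof (rule integral_mono_AE)
      show "integrable lebesgue (\<lambda>r. indicator {1..s} r *\<^sub>R (A r - b r))" "integrable lebesgue (\<lambda>r. indicator
          {1..t} r *\<^sub>R (A r - b r))"
        using i st unfolding set_integrable_def by auto
      show "AE r in lebesgue. indicator {1..s} r *\<^sub>R (A r - b r) \<le> indicator {1..t} r *\<^sub>R (A r - b r)"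
        using Ab by eventually_elim (use st in \<open>auto simp: indicator_def\<close>)
    qed
    then show ?thesis using Weq[of s] Weq[of t] st by auto
  qed
  have LR: "lower_rderiv V t (t powr (2 * m) * U t - \<mu> / t * V t + K t powr (1 - p) * \<bar>V t\<bar> powr p)"
      if t: "1 \<le> t" "t < t1" for t
  proof -
    have "lower_rderiv W t 0"
      unfolding lower_rderiv_def
    proof (intro allI impI)
      fix q :: real assume q: "q < 0"
      have "\<forall>\<^sub>F s in at_right t. s < t1 \<and> t < s"
        using t by (intro eventually_at_rightI[of t t1]) auto
      then show "\<forall>\<^sub>F s in at_right t. q * (s - t) \<le> W s - W t"
      proof eventually_elim
        case (elim s)
        have "q * (s - t) \<le> 0" using q elim by (intro mult_nonpos_nonneg) auto
        then show ?case using Wmono[of t s] elim t by auto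
      qed
    qed
    moreover have "lower_rderiv I t (c t + b t)"
    proof (rule lower_rderiv_deriv)
      have "at_right t \<le> at t within {1..t1}"
        using at_le[of "{t..t1}" "{1..t1}" t] t by (simp add: at_within_Icc_at_right)
      from tendsto_mono[OF this] show "(I has_real_derivative c t + b t) (at_right t)"
        using Id[of t] t unfolding has_field_derivative_iff by auto
    qed
    ultimately have "lower_rderiv (\<lambda>s. W s + I s) t (0 + (c t + b t))" by (rule lower_rderiv_add)
    then show ?thesis by (simp add: W_def c_def b_def)
  qed
  show ?thesis by (intro exI[of _ U] exI[of _ V] conjI allI impI U1 V1 Ud Vc LR)
qed

end

section \<open>Lifespan\<close>

locale radial_eigen =
  fixes n :: nat and F :: "real \<Rightarrow> real"
  assumes n: "n \<ge> 1" and F_smooth: "smooth_on {0<..} F" and F1: "F 1 = 0" and F_pos: "\<And>y. y > 1 \<Longrightarrow> F y > 0"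
    and F_ode: "\<And>y. y > 0 \<Longrightarrow> 4 * y * deriv (deriv F) y + 2 * real n * deriv F y = F y"
begin

text \<open>\<open>F\<close> is smooth only for positive arguments, so the first factor, 0 up to
  \<open>1 / 2\<close> and 1 from \<open>3 / 4\<close> on, removes a neighbourhood of the origin;
  the second bounds the support. Neither alters \<open>F\<close> near \<open>{1..L\<^sup>2}\<close>,
  the squared radii met by a solution supported in \<open>norm x \<le> L\<close>.\<close>

definition cut_profile :: "real \<Rightarrow> real \<Rightarrow> real" where
  "cut_profile L y = F y * (cutoff (4 * y + -2) * switch (L\<^sup>2 + 1) (L\<^sup>2 + 2) y)"

lemma cut_profile_eq: "3 / 4 < y \<Longrightarrow> y < L\<^sup>2 + 1 \<Longrightarrow> cut_profile L y = F y"
  by (simp add: cut_profile_def cutoff_1 switch_1)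

lemma cut_profile_smooth: "smooth_on UNIV (cut_profile L)"
proof -
  have c: "smooth_on UNIV (\<lambda>y::real. cutoff (4 * y + -2))"
    by (intro smooth_on_compose[OF smooth_on_cutoff, where S = UNIV] smooth_on_add smooth_on_mult
        smooth_on_const smooth_on_bounded_linear bounded_linear_ident) simp
  have "smooth_on {0<..} (cut_profile L)"
    unfolding cut_profile_def[abs_def]
    by (intro smooth_on_mult F_smooth smooth_on_subset[OF c] smooth_on_subset[OF switch_smooth]) auto
  moreover have "smooth_on {..<1/2} (cut_profile L)"
    by (subst smooth_on_cong[of _ _ "\<lambda>_. 0"]) (auto simp: cut_profile_def cutoff_0 smooth_on_const)
  ultimately have "smooth_on ({0<..} \<union> {..<1/2}) (cut_profile L)" by (intro smooth_on_Un) auto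
  moreover have "{0<..} \<union> {..<1/2} = (UNIV :: real set)" by auto
  ultimately show ?thesis by simp
qed

lemma cut_profile_radial_test: "radial_test (cut_profile L) (L\<^sup>2 + 2)"
  by unfold_locales (auto simp: cut_profile_smooth cut_profile_def switch_0)

lemma cut_profile_1: "cut_profile L 1 = 0"
  by (simp add: cut_profile_def F1)

lemma cut_profile_nonneg: "y \<ge> 1 \<Longrightarrow> cut_profile L y \<ge> 0"
  unfolding cut_profile_def using F_pos[of y] F1 switch_bounds(1) cutoff_ge_0
  by (cases "y = 1") (auto intro!: mult_nonneg_nonneg)

text \<open>On an open interval around \<open>{1..L\<^sup>2}\<close> the profile agrees with
  \<open>F\<close>, hence so do its first two derivatives.\<close>

lemma cut_profile_ode:
  assumes "1 \<le> y" "y \<le> L\<^sup>2"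
  shows "4 * radial_test.P2 (cut_profile L) y * y + 2 * real n * radial_test.P1 (cut_profile L) y = cut_profile
      L y"
proof -
  interpret radial_test "cut_profile L" "L\<^sup>2 + 2" by (rule cut_profile_radial_test)
  let ?S = "{3/4<..<L\<^sup>2 + 1}"
  have p1: "P1 z = deriv F z" if "z \<in> ?S" for z
  proof -
    have "(F has_real_derivative P1 z) (at z)"
      by (rule has_field_derivative_transform_within_open[OF P1(2), of ?S]) (use that cut_profile_eq in auto)
    then show ?thesis by (metis DERIV_imp_deriv)
  qed
  have p2: "P2 y = deriv (deriv F) y"
  proof -
    have "(deriv F has_real_derivative P2 y) (at y)"
      by (rule has_field_derivative_transform_within_open[OF P2(2), of ?S]) (use assms p1 in auto)
    then show ?thesis by (metis DERIV_imp_deriv)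
  qed
  show ?thesis using F_ode[of y] p1[of y] p2 cut_profile_eq[of y L] assms by (simp add: algebra_simps)
qed

end

text \<open>The profile has to reach radius \<open>R + phi_m m t\<close> and thus varies with
  \<open>t\<close>, yet all constants are fixed beforehand: the growth bound concerns
  \<open>F\<close> itself, and data supported in \<open>norm x \<le> R\<close> have the same pairing
  with every such profile. So \<open>C\<close> is uniform in the solution and in \<open>t\<close>,
  and \<open>\<epsilon>\<close> enters through \<open>V 1 = \<epsilon> * J u1\<close>.\<close>

lemma blowup_estimate:
  fixes u0 u1 :: "'a::euclidean_space \<Rightarrow> real" and m \<mu> p R :: real
  assumes m: "m \<ge> 0" and mu: "\<mu> \<ge> 0" and p: "p > 1" and R: "R > 1"
    and L2: "u0 \<in> L2" "u1 \<in> L2"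
    and nn: "AE x in LExt. u0 x \<ge> 0" "AE x in LExt. u1 x \<ge> 0"
    and supp: "AE x in LExt. norm x > R \<longrightarrow> u0 x = 0" "AE x in LExt. norm x > R \<longrightarrow> u1 x = 0"
    and nz: "\<not> (AE x in LExt. u0 x = 0)" "\<not> (AE x in LExt. u1 x = 0)"
    and G: "\<And>t. t > 0 \<Longrightarrow> (G has_real_derivative t powr (- ((p - 1) * ((1 + m) * ((real DIM('a) - 1) / 2) + (\<mu> -
        m) / 2)))) (at t)" "G 1 = 0"
  shows "\<exists>C>0. \<forall>\<epsilon> T u t. 0 < \<epsilon> \<longrightarrow> weak_solution m \<mu> p \<epsilon> u0 u1 T u \<longrightarrow> support_property m R T u \<longrightarrow>
    1 < t \<longrightarrow> ereal t < T \<longrightarrow> G t \<le> C * \<epsilon> powr (1 - p)"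
proof -
  define n where "n = DIM('a)"
  have n: "n \<ge> 1" using DIM_positive[where 'a='a] by (simp add: n_def Suc_le_eq)
  obtain F K2 where F: "smooth_on {0<..} F" "F 1 = 0" "\<And>y. y > 1 \<Longrightarrow> F y > 0"
    "\<And>y. y > 0 \<Longrightarrow> 4 * y * deriv (deriv F) y + 2 * real n * deriv F y = F y"
    and K2: "K2 > 0" "\<And>r. r \<ge> 1 \<Longrightarrow> F (r\<^sup>2) \<le> K2 * exp r * r powr (- ((real n - 1) / 2))"
    using radial_eigenfunction[OF n] by auto
  interpret radial_eigen n F by unfold_locales (use n F in auto)
  define k where "k = (real n - 1) / 2"
  have k: "k \<ge> 0" using n by (simp add: k_def)
  obtain K3 where K3: "K3 > 0" "\<And>L. L \<ge> 1 \<Longrightarrow>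
     (\<integral>x. indicator {x::'a. 1 \<le> norm x \<and> norm x \<le> L} x * (exp (norm x) * norm x powr (- k)) \<partial>lborel) \<le> K3 * (L
         powr k * exp L)"
    using exp_weight_integral_le[where 'a='a, of k] by (auto simp: k_def n_def)
  define \<nu> where "\<nu> = (1 + m) * k"
  \<comment> \<open>The growth constant of \<open>F\<close>, the constant of the weighted integral,
    and the loss in comparing \<open>\<rho> powr k * exp \<rho>\<close>,
    \<open>\<rho> = R + phi_m m s\<close>, with
    \<open>s powr \<nu> * exp (phi_m m s)\<close>.\<close>
  define Kc where "Kc = K2 * K3 * ((R + 1) powr k * exp R)"
  have Kc: "Kc > 0" using K2 K3 R by (simp add: Kc_def)
  define B where "B = Kc powr (1 - p)"
  have B: "B > 0" using Kc by (simp add: B_def)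
  define J where "J f = (\<integral>x. f x * cut_profile R (x \<bullet> x) \<partial>LExt)" for f :: "'a \<Rightarrow> real"
  have Jpos: "J f > 0" if f: "f \<in> L2" "AE x in LExt. f x \<ge> 0" "AE x in LExt. norm x > R \<longrightarrow> f x = 0"
    "\<not> (AE x in LExt. f x = 0)" for f
  proof (rule ccontr)
    interpret radial_test "cut_profile R" "R\<^sup>2 + 2" by (rule cut_profile_radial_test)
    assume "\<not> J f > 0"
    have i: "integrable LExt (\<lambda>x. f x * cut_profile R (x \<bullet> x))" by (intro L2_mult_integrable f \<Psi>_L2)
    have nn: "AE x in LExt. 0 \<le> f x * cut_profile R (x \<bullet> x)"
      using f(2) AE_LExt_norm by eventually_elim (auto intro!: cut_profile_nonneg mult_nonneg_nonneg simp:
          norm_gt_1_iff)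
    then have "0 \<le> J f" unfolding J_def by (rule integral_nonneg_AE)
    then have "J f = 0" using \<open>\<not> J f > 0\<close> by simp
    then have "AE x in LExt. f x * cut_profile R (x \<bullet> x) = 0"
      unfolding J_def using integral_nonneg_eq_0_iff_AE[OF i nn] by simp
    then have "AE x in LExt. f x = 0" using f(3) AE_LExt_norm
    proof eventually_elim
      case (elim x)
      show ?case
      proof (cases "norm x > R")
        case False
        then have "(norm x)\<^sup>2 \<le> R\<^sup>2" by (intro power_mono) auto
        moreover have "x \<bullet> x > 1" using elim by (simp add: norm_gt_1_iff)
        ultimately have "cut_profile R (x \<bullet> x) > 0"
          using cut_profile_eq[of "x \<bullet> x" R] F_pos[of "x \<bullet> x"] by (simp add: power2_norm_eq_inner)
        then show ?thesis using elim(1) by auto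
      qed (use elim in simp)
    qed
    then show False using f(4) by simp
  qed
  have J0: "J u0 > 0" by (rule Jpos[OF L2(1) nn(1) supp(1) nz(1)])
  have J1: "J u1 > 0" by (rule Jpos[OF L2(2) nn(2) supp(2) nz(2)])
  \<comment> \<open>The first entry yields the propagation condition, also by forcing
    \<open>\<kappa> \<le> 1\<close>; the second yields the initial inequality. The ratio is
    independent of \<open>\<epsilon>\<close>.\<close>
  define \<kappa> where "\<kappa> = min (1 / (1 + m + \<mu>)) (J u1 / J u0)"
  have \<kappa>: "\<kappa> > 0" "\<kappa> * (\<kappa> + m + \<mu>) \<le> 1" "\<kappa> * J u0 \<le> J u1"
  proof -
    show kp: "\<kappa> > 0" using J0 J1 m mu by (simp add: \<kappa>_def add_pos_nonneg)
    have le: "\<kappa> \<le> 1 / (1 + m + \<mu>)" "\<kappa> \<le> J u1 / J u0" by (simp_all add: \<kappa>_def)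
    then have k1: "\<kappa> * (1 + m + \<mu>) \<le> 1" using m mu by (simp add: pos_le_divide_eq add_pos_nonneg)
    have "\<kappa> * 1 \<le> \<kappa> * (1 + m + \<mu>)" using kp m mu by (intro mult_left_mono) auto
    then have "\<kappa> \<le> 1" using k1 by simp
    then have "\<kappa> * (\<kappa> + m + \<mu>) \<le> \<kappa> * (1 + m + \<mu>)" using kp by (intro mult_left_mono) auto
    then show "\<kappa> * (\<kappa> + m + \<mu>) \<le> 1" using k1 by simp
    show "\<kappa> * J u0 \<le> J u1" using le(2) J0 by (simp add: pos_le_divide_eq)
  qed
  \<comment> \<open>\<open>d\<close>, \<open>a3\<close> and \<open>a0\<close> repeat
    \<open>\<delta>\<close>, \<open>c3\<close> and \<open>weight 1\<close> of
    \<open>glassey_ode\<close>, so that \<open>C\<close> is fixed before any solution is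
    chosen.\<close>
  define d where "d = (m + \<mu>) / 2"
  define a3 where "a3 = 1 / (1 + (1 + d) / \<kappa>)"
  define a0 where "a0 = exp (- (1 + max 0 (d * (d + 1 - \<mu>))) / (1 + m))"
  have d: "d \<ge> 0" using m mu by (simp add: d_def)
  have a3: "a3 > 0" using d \<kappa> by (simp add: a3_def add_pos_nonneg)
  define D where "D = (p - 1) * a3 powr p * B"
  have D: "D > 0" using p a3 B by (simp add: D_def)
  define C where "C = (a0 * J u1) powr (1 - p) / D"
  have C: "C > 0" using D J1 by (simp add: C_def a0_def)
  have "G t \<le> C * \<epsilon> powr (1 - p)"
    if \<epsilon>: "0 < \<epsilon>" and ws: "weak_solution m \<mu> p \<epsilon> u0 u1 T u" and sp: "support_property m R T u"
      and t: "1 < t" "ereal t < T" for \<epsilon> T u t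
  proof -
    define L where "L = R + phi_m m t"
    have phi0: "phi_m m s \<ge> 0" for s using m by (simp add: phi_m_def)
    have LR: "R \<le> L" using phi0 by (simp add: L_def)
    interpret radial_test "cut_profile L" "L\<^sup>2 + 2" by (rule cut_profile_radial_test)
    have phic: "continuous_on {1..t} (phi_m m)"
      unfolding phi_m_def[abs_def] using m by (intro continuous_intros) auto
    define K where "K s = Kc * (s powr \<nu> * exp (phi_m m s))" for s
    have Kint: "(\<integral>x. indicator (cball (0::'a) (R + phi_m m s)) x * cut_profile L (x \<bullet> x) \<partial>LExt) \<le> K s"
        if s: "s \<in> {1..t}" for s
    proof -
      define \<rho> where "\<rho> = R + phi_m m s"
      have mono: "phi_m m s \<le> phi_m m t"
        unfolding phi_m_def using s m by (intro divide_right_mono powr_mono2) auto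
      have \<rho>: "1 \<le> \<rho>" "\<rho> \<le> L" using R phi0[of s] mono by (auto simp: \<rho>_def L_def)
      have bm: "(\<lambda>x::'a. indicator (cball 0 \<rho>) x * cut_profile L (x \<bullet> x)) \<in> borel_measurable borel"
        by (intro borel_measurable_times \<Psi>_borel borel_measurable_indicator) auto
      have "(\<integral>x. indicator (cball (0::'a) \<rho>) x * cut_profile L (x \<bullet> x) \<partial>LExt) = (\<integral>x. indicator Ext x *\<^sub>R
          (indicator (cball (0::'a) \<rho>) x * cut_profile L (x \<bullet> x)) \<partial>lborel)"
        by (rule LExt_integral(1)[OF bm])
      also have "\<dots> \<le> (\<integral>x. K2 * (indicator {x::'a. 1 \<le> norm x \<and> norm x \<le> \<rho>} x * (exp (norm x) * norm x powr (-
          k))) \<partial>lborel)"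
      proof (rule integral_mono)
        show "integrable lborel (\<lambda>x::'a. indicator Ext x *\<^sub>R (indicator (cball 0 \<rho>) x * cut_profile L (x \<bullet> x)))"
          using LExt_integral(2)[OF bm] \<Psi>_indicator_integrable[where 'a='a, of \<rho>] by simp
        have "{x::'a. 1 \<le> norm x \<and> norm x \<le> \<rho>} = cball 0 \<rho> \<inter> - ball 0 1" by auto
        then have cpt: "compact {x::'a. 1 \<le> norm x \<and> norm x \<le> \<rho>}"
          by (metis closed_Compl compact_Int_closed compact_cball open_ball)
        have "continuous_on {x::'a. 1 \<le> norm x \<and> norm x \<le> \<rho>} (\<lambda>x. exp (norm x) * norm x powr (- k))"
          by (intro continuous_intros) auto
        from borel_integrable_compact[OF cpt this]
        show "integrable lborel (\<lambda>x::'a. K2 * (indicator {x::'a. 1 \<le> norm x \<and> norm x \<le> \<rho>} x * (exp (norm x) *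
            norm x powr (- k))))"
          by simp
        fix x :: 'a
        show "indicator Ext x *\<^sub>R (indicator (cball 0 \<rho>) x * cut_profile L (x \<bullet> x))
          \<le> K2 * (indicator {x::'a. 1 \<le> norm x \<and> norm x \<le> \<rho>} x * (exp (norm x) * norm x powr (- k)))"
        proof (cases "1 \<le> norm x \<and> norm x \<le> \<rho>")
          case True
          have "(norm x)\<^sup>2 \<le> L\<^sup>2" using True \<rho> by (intro power_mono) auto
          moreover have "1 \<le> (norm x)\<^sup>2" using True by simp
          ultimately have "cut_profile L (x \<bullet> x) = F ((norm x)\<^sup>2)"
              by (subst cut_profile_eq) (auto simp: power2_norm_eq_inner)
          also have "\<dots> \<le> K2 * exp (norm x) * norm x powr (- k)" using K2(2)[of "norm x"] True
              by (simp add: k_def)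
          finally show ?thesis using True by (simp add: Ext_iff)
        next
          case False
          then show ?thesis by (auto simp: indicator_def Ext_iff)
        qed
      qed
      also have "\<dots> = K2 * (\<integral>x. indicator {x::'a. 1 \<le> norm x \<and> norm x \<le> \<rho>} x * (exp (norm x) * norm x powr (- k))
          \<partial>lborel)"
        by simp
      also have "\<dots> \<le> K2 * (K3 * (\<rho> powr k * exp \<rho>))"
        using K2(1) K3(2)[OF \<rho>(1)] by (intro mult_left_mono) auto
      also have "\<dots> \<le> K2 * (K3 * (((R + 1) powr k * s powr \<nu>) * (exp R * exp (phi_m m s))))"
      proof -
        have s1: "1 \<le> s powr (1 + m)" using s m by (intro ge_one_powr_ge_zero) auto
        \<comment> \<open>Both \<open>phi_m m s\<close> and \<open>R\<close> are dominated by
          multiples of \<open>s powr (1 + m)\<close>, whose power \<open>k\<close> is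
          \<open>s powr \<nu>\<close>.\<close>
        have "phi_m m s \<le> s powr (1 + m)" using m by (simp add: phi_m_def divide_le_eq mult_le_cancel_left1)
        moreover have "R \<le> R * s powr (1 + m)" using s1 R by simp
        ultimately have "\<rho> \<le> (R + 1) * s powr (1 + m)" by (simp add: \<rho>_def algebra_simps)
        then have "\<rho> powr k \<le> ((R + 1) * s powr (1 + m)) powr k" using \<rho> k by (intro powr_mono2) auto
        also have "\<dots> = (R + 1) powr k * s powr \<nu>" using R s by (simp add: powr_mult powr_powr \<nu>_def)
        finally show ?thesis using K2 K3 by (intro mult_left_mono mult_mono) (auto simp: \<rho>_def exp_add)
      qed
      also have "\<dots> = K s" by (simp add: K_def Kc_def algebra_simps)
      finally show ?thesis by (simp add: \<rho>_def)
    qed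
    have ode: "4 * P2 y * y + 2 * real DIM('a) * P1 y = cut_profile L y"
        if "1 \<le> y" "y \<le> (R + phi_m m t)\<^sup>2" for y
      using cut_profile_ode[of y L] that by (simp add: L_def n_def)
    have Kcont: "continuous_on {1..t} K" unfolding K_def[abs_def] by (intro continuous_intros phic) auto
    have Kpos: "K s > 0" if "s \<in> {1..t}" for s using Kc that by (simp add: K_def)
    obtain U V where UV: "U 1 = \<epsilon> * (\<integral>x. u0 x * cut_profile L (x \<bullet> x) \<partial>LExt)" "V 1 = \<epsilon> * (\<integral>x. u1 x * cut_profile
        L (x \<bullet> x) \<partial>LExt)"
      "\<And>s. 1 \<le> s \<Longrightarrow> s \<le> t \<Longrightarrow> (U has_real_derivative V s) (at s within {1..t})" "continuous_on {1..t} V"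
      "\<And>s. 1 \<le> s \<Longrightarrow> s < t \<Longrightarrow> lower_rderiv V s (s powr (2 * m) * U s - \<mu> / s * V s + K s powr (1 - p) * \<bar>V s\<bar> powr
          p)"
      using weak_reduction[OF m p R t ws sp L2 cut_profile_1 cut_profile_nonneg ode Kcont Kpos Kint] by auto
    \<comment> \<open>Both profiles coincide with \<open>F\<close> on
      \<open>1 < norm x \<le> R\<close>, and the data vanish beyond \<open>R\<close>.\<close>
    have JL: "(\<integral>x. f x * cut_profile L (x \<bullet> x) \<partial>LExt) = J f"
        if f: "f \<in> L2" "AE x in LExt. norm x > R \<longrightarrow> f x = 0" for f :: "'a \<Rightarrow> real"
      unfolding J_def
    proof (rule integral_cong_AE)
      show "(\<lambda>x. f x * cut_profile L (x \<bullet> x)) \<in> borel_measurable LExt"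
        by (intro borel_measurable_times L2_measurable f \<Psi>_L2)
      show "(\<lambda>x. f x * cut_profile R (x \<bullet> x)) \<in> borel_measurable LExt"
        by (intro borel_measurable_times L2_measurable f radial_test.\<Psi>_L2[OF cut_profile_radial_test])
      show "AE x in LExt. f x * cut_profile L (x \<bullet> x) = f x * cut_profile R (x \<bullet> x)"
        using f(2) AE_LExt_norm
      proof eventually_elim
        case (elim x)
        show ?case
        proof (cases "norm x > R")
          case False
          then have "(norm x)\<^sup>2 \<le> R\<^sup>2" by (intro power_mono) auto
          moreover have "R\<^sup>2 \<le> L\<^sup>2" using LR R by (intro power_mono) auto
          moreover have "x \<bullet> x > 1" using elim by (simp add: norm_gt_1_iff)
          ultimately show ?thesis using cut_profile_eq[of "x \<bullet> x" R] cut_profile_eq[of "x \<bullet> x" L]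
              by (simp add: power2_norm_eq_inner)
        qed (use elim in simp)
      qed
    qed
    have U1: "U 1 = \<epsilon> * J u0" and V1: "V 1 = \<epsilon> * J u1"
      using UV(1,2) JL[OF L2(1) supp(1)] JL[OF L2(2) supp(2)] by auto
    interpret ode: glassey_ode m \<mu> p \<kappa> B \<nu> t U V
    proof
      show "\<kappa> * U 1 \<le> V 1" using \<kappa>(3) \<epsilon> unfolding U1 V1 by (simp add: mult.left_commute)
      show "U 1 > 0" "V 1 > 0" using U1 V1 J0 J1 \<epsilon> by auto
      show "lower_rderiv V s (s powr (2 * m) * U s - \<mu> / s * V s + B * (s powr \<nu> * exp (phi_m m s)) powr (1 - p)
          * \<bar>V s\<bar> powr p)"
        if "1 \<le> s" "s < t" for s
      proof -
        have "K s powr (1 - p) = B * (s powr \<nu> * exp (phi_m m s)) powr (1 - p)"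
          unfolding K_def B_def using Kc by (subst powr_mult) auto
        then show ?thesis using UV(5)[OF that] by simp
      qed
    qed (use m mu p t B \<kappa> UV in auto)
    have "(p - 1) * ode.c3 powr p * B * G t \<le> (exp (- (1 + ode.c0) / (1 + m)) * V 1) powr (1 - p)"
    proof (rule ode.lifespan_estimate[where G = G])
      show "(G has_real_derivative r powr - ((p - 1) * (\<nu> + (\<mu> - m) / 2))) (at r)" if "r > 0" for r
        unfolding \<nu>_def k_def n_def by (rule G(1)[OF that])
    qed (rule G(2))
    then have "D * G t \<le> (a0 * (\<epsilon> * J u1)) powr (1 - p)"
      by (simp add: D_def a3_def a0_def d_def ode.c3_def ode.c0_def ode.\<delta>_def V1)
    also have "\<dots> = (a0 * J u1) powr (1 - p) * \<epsilon> powr (1 - p)"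
    proof -
      have "a0 * (\<epsilon> * J u1) = (a0 * J u1) * \<epsilon>" by simp
      then show ?thesis using J1 \<epsilon> by (simp only: powr_mult) 
    qed
    finally show ?thesis using D by (simp add: C_def field_simps)
  qed
  then show ?thesis using C by blast
qed

text \<open>A solution on an interval with \<open>T > X\<close> would leave room for a real time
  above both \<open>X\<close> and 1; the maximum with 1 is taken because the estimates concern
  \<open>t > 1\<close>.\<close>

lemma lifespan_leI:
  assumes "\<And>T u t. weak_solution m \<mu> p \<epsilon> u0 u1 T u \<Longrightarrow> support_property m R T u \<Longrightarrow> 1 < t \<Longrightarrow> ereal t < T \<Longrightarrow> t \<le> X"
  shows "lifespan m \<mu> p R \<epsilon> u0 u1 \<le> ereal X"
  unfolding lifespan_def
proof (rule Sup_least)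
  fix T assume "T \<in> {T. 1 < T \<and> (\<exists>u. weak_solution m \<mu> p \<epsilon> u0 u1 T u \<and> support_property m R T u)}"
  then obtain u where u: "1 < T" "weak_solution m \<mu> p \<epsilon> u0 u1 T u" "support_property m R T u" by auto
  show "T \<le> ereal X"
  proof (rule ccontr)
    assume "\<not> T \<le> ereal X"
    then have "max 1 (ereal X) < T" using u(1) by simp
    then obtain t where t: "max 1 (ereal X) < ereal t" "ereal t < T" using ereal_dense2 by blast
    then have "1 < t" "X < t" by auto
    then show False using assms[OF u(2,3) _ t(2)] by simp
  qed
qed

text \<open>Here \<open>\<theta> = q * (p - 1) / 2 < 1\<close>, so the primitive of
  \<open>t powr (- \<theta>)\<close> is an unbounded power and a bound on \<open>G t\<close> bounds
  \<open>t\<close>; the stated exponent is \<open>(1 - p) / (1 - \<theta>)\<close>. In dimension 1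
  the number \<open>q\<close> may be nonpositive.\<close>

lemma lifespan_subcritical:
  fixes u0 u1 :: "'a::euclidean_space \<Rightarrow> real" and m \<mu> p R :: real
  defines "q \<equiv> (1 + m) * (real DIM('a) - 1) - m + \<mu>"
  assumes "m \<ge> 0" "\<mu> \<ge> 0" and p: "p > 1" and "R > 1" "u0 \<in> L2" "u1 \<in> L2"
    "AE x in LExt. u0 x \<ge> 0" "AE x in LExt. u1 x \<ge> 0"
    "AE x in LExt. norm x > R \<longrightarrow> u0 x = 0" "AE x in LExt. norm x > R \<longrightarrow> u1 x = 0"
    "\<not> (AE x in LExt. u0 x = 0)" "\<not> (AE x in LExt. u1 x = 0)"
    and q: "q * (p - 1) < 2"
  shows "\<exists>C>0. \<forall>\<epsilon>. 0 < \<epsilon> \<and> \<epsilon> \<le> 1 \<longrightarrow> lifespan m \<mu> p R \<epsilon> u0 u1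
    \<le> ereal (C * \<epsilon> powr (- (2 * (p - 1) / (2 - q * (p - 1)))))"
proof -
  define \<theta> where "\<theta> = (p - 1) * ((1 + m) * ((real DIM('a) - 1) / 2) + (\<mu> - m) / 2)"
  have e: "(1 + m) * ((real DIM('a) - 1) / 2) + (\<mu> - m) / 2 = q / 2"
    by (simp add: q_def add_divide_distrib diff_divide_distrib)
  have \<theta>q: "2 * \<theta> = q * (p - 1)" unfolding \<theta>_def e by simp
  have \<theta>: "1 - \<theta> > 0" using q \<theta>q by linarith
  define G where "G t = (t powr (1 - \<theta>) - 1) / (1 - \<theta>)" for t
  have G: "(G has_real_derivative t powr (- \<theta>)) (at t)" if "t > 0" for t
  proof -
    have "((\<lambda>t. (t powr (1 - \<theta>) - 1) / (1 - \<theta>)) has_real_derivative ((1 - \<theta>) * t powr (1 - \<theta> - 1) - 0) / (1 -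
        \<theta>)) (at t)"
      by (intro DERIV_cdivide DERIV_diff has_real_derivative_powr that DERIV_const)
    then show ?thesis using \<theta> by (simp add: G_def[abs_def])
  qed
  have G1: "G 1 = 0" by (simp add: G_def)
  obtain C0 where C0: "C0 > 0" "\<And>\<epsilon> T u t. 0 < \<epsilon> \<Longrightarrow> weak_solution m \<mu> p \<epsilon> u0 u1 T u \<Longrightarrow> support_property m R T u \<Longrightarrow>
    1 < t \<Longrightarrow> ereal t < T \<Longrightarrow> G t \<le> C0 * \<epsilon> powr (1 - p)"
    using blowup_estimate[OF assms(2-13) G[unfolded \<theta>_def] G1] by blast
  \<comment> \<open>The 1 subtracted in \<open>G\<close> is absorbed by
    \<open>\<epsilon> powr (1 - p) \<ge> 1\<close>, for which \<open>\<epsilon> \<le> 1\<close> is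
    used.\<close>
  define C1 where "C1 = 1 + (1 - \<theta>) * C0"
  have C1: "C1 > 0" using \<theta> C0 by (simp add: C1_def add_pos_pos)
  define C where "C = C1 powr (1 / (1 - \<theta>))"
  have "lifespan m \<mu> p R \<epsilon> u0 u1 \<le> ereal (C * \<epsilon> powr (- (2 * (p - 1) / (2 - q * (p - 1)))))"
    if \<epsilon>: "0 < \<epsilon>" "\<epsilon> \<le> 1" for \<epsilon>
  proof (rule lifespan_leI)
    fix T u t assume h: "weak_solution m \<mu> p \<epsilon> u0 u1 T u" "support_property m R T u" "1 < t" "ereal t < T"
    have "1 \<le> \<epsilon> powr (1 - p)"
      using powr_mono2'[of "1 - p" \<epsilon> 1] \<epsilon> p by simp
    moreover have "t powr (1 - \<theta>) - 1 \<le> (1 - \<theta>) * (C0 * \<epsilon> powr (1 - p))"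
      using C0(2)[OF \<epsilon>(1) h] \<theta> by (simp add: G_def pos_divide_le_eq mult.commute)
    ultimately have "t powr (1 - \<theta>) \<le> C1 * \<epsilon> powr (1 - p)" by (simp add: C1_def algebra_simps)
    then have "(t powr (1 - \<theta>)) powr (1 / (1 - \<theta>)) \<le> (C1 * \<epsilon> powr (1 - p)) powr (1 / (1 - \<theta>))"
      using \<theta> by (intro powr_mono2) auto
    moreover have "(t powr (1 - \<theta>)) powr (1 / (1 - \<theta>)) = t" using h(3) \<theta> by (simp add: powr_powr)
    moreover have "(C1 * \<epsilon> powr (1 - p)) powr (1 / (1 - \<theta>)) = C * \<epsilon> powr ((1 - p) * (1 / (1 - \<theta>)))"
      using C1 by (simp add: powr_mult powr_powr C_def)
    moreover have "(1 - p) * (1 / (1 - \<theta>)) = - (2 * (p - 1) / (2 - q * (p - 1)))"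
      unfolding \<theta>q[symmetric] using \<theta> by (simp add: field_simps)
    ultimately show "t \<le> C * \<epsilon> powr (- (2 * (p - 1) / (2 - q * (p - 1))))" by simp
  qed
  moreover have "C > 0" using C1 by (simp add: C_def)
  ultimately show ?thesis by blast
qed

text \<open>At \<open>\<theta> = 1\<close> the primitive is the logarithm, so the bound on it
  becomes an exponential bound on the lifespan.\<close>

lemma lifespan_critical:
  fixes u0 u1 :: "'a::euclidean_space \<Rightarrow> real" and m \<mu> p R :: real
  defines "q \<equiv> (1 + m) * (real DIM('a) - 1) - m + \<mu>"
  assumes "m \<ge> 0" "\<mu> \<ge> 0" and p: "p > 1" and "R > 1" "u0 \<in> L2" "u1 \<in> L2"
    "AE x in LExt. u0 x \<ge> 0" "AE x in LExt. u1 x \<ge> 0"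
    "AE x in LExt. norm x > R \<longrightarrow> u0 x = 0" "AE x in LExt. norm x > R \<longrightarrow> u1 x = 0"
    "\<not> (AE x in LExt. u0 x = 0)" "\<not> (AE x in LExt. u1 x = 0)"
    and q: "q * (p - 1) = 2"
  shows "\<exists>C>0. \<forall>\<epsilon>. 0 < \<epsilon> \<and> \<epsilon> \<le> 1 \<longrightarrow> lifespan m \<mu> p R \<epsilon> u0 u1 \<le> ereal (exp (C * \<epsilon> powr (- (p - 1))))"
proof -
  define \<theta> where "\<theta> = (p - 1) * ((1 + m) * ((real DIM('a) - 1) / 2) + (\<mu> - m) / 2)"
  have e: "(1 + m) * ((real DIM('a) - 1) / 2) + (\<mu> - m) / 2 = q / 2"
    by (simp add: q_def add_divide_distrib diff_divide_distrib)
  have "2 * \<theta> = q * (p - 1)" unfolding \<theta>_def e by simp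
  then have \<theta>: "\<theta> = 1" using q by linarith
  have G: "(ln has_real_derivative t powr (- \<theta>)) (at t)" if "t > 0" for t :: real
    using DERIV_ln[OF that] that by (simp add: \<theta> powr_minus)
  obtain C where C: "C > 0" "\<And>\<epsilon> T u t. 0 < \<epsilon> \<Longrightarrow> weak_solution m \<mu> p \<epsilon> u0 u1 T u \<Longrightarrow> support_property m R T u \<Longrightarrow>
    1 < t \<Longrightarrow> ereal t < T \<Longrightarrow> ln t \<le> C * \<epsilon> powr (1 - p)"
    using blowup_estimate[OF assms(2-13) G[unfolded \<theta>_def] ln_one] by blast
  have "lifespan m \<mu> p R \<epsilon> u0 u1 \<le> ereal (exp (C * \<epsilon> powr (- (p - 1))))" if \<epsilon>: "0 < \<epsilon>" for \<epsilon>
  proof (rule lifespan_leI)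
    fix T u t assume h: "weak_solution m \<mu> p \<epsilon> u0 u1 T u" "support_property m R T u" "1 < t" "ereal t < T"
    have "exp (ln t) \<le> exp (C * \<epsilon> powr (1 - p))" using C(2)[OF \<epsilon> h] by simp
    then show "t \<le> exp (C * \<epsilon> powr (- (p - 1)))" using h(3) by simp
  qed
  then show ?thesis using C(1) by blast
qed

theorem theorem2p2:
  fixes u0 u1 :: "'a::euclidean_space \<Rightarrow> real"
    and \<mu> m p R N :: real
  assumes N: "N = real DIM('a)"
    and "\<mu> \<ge> 0" and "m \<ge> 0" and "p > 1" and "R > 1"
    and "u0 \<in> H1" and "u1 \<in> L2"
    and "AE x in LExt. u0 x \<ge> 0" and "AE x in LExt. u1 x \<ge> 0"
    and "AE x in LExt. norm x > R \<longrightarrow> u0 x = 0"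
    and "AE x in LExt. norm x > R \<longrightarrow> u1 x = 0"
    and "\<not> (AE x in LExt. u0 x = 0)" and "\<not> (AE x in LExt. u1 x = 0)"
    and "DIM('a) \<ge> 2 \<Longrightarrow> 1 < p \<and> p \<le> p_T (N + \<mu> / (m + 1)) m"
    and "DIM('a) = 1 \<Longrightarrow>
           1 < p \<and> ereal p < p_crit1 \<mu> m \<or> \<mu> > m \<and> p = 1 + 2 / (\<mu> - m)"
  shows "\<exists>\<epsilon>0>0. \<exists>C>0. \<forall>\<epsilon>. 0 < \<epsilon> \<and> \<epsilon> \<le> \<epsilon>0 \<longrightarrow>
    lifespan m \<mu> p R \<epsilon> u0 u1 < \<infinity> \<and>
    (DIM('a) \<ge> 2 \<longrightarrow>
      (1 < p \<and> p < p_T (N + \<mu> / (m + 1)) m \<longrightarrow>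
        lifespan m \<mu> p R \<epsilon> u0 u1
          \<le> ereal (C * \<epsilon> powr (- (2 * (p - 1) / (2 - ((1 + m) * (N - 1) - m + \<mu>) * (p - 1)))))) \<and>
      (p = p_T (N + \<mu> / (m + 1)) m \<longrightarrow>
        lifespan m \<mu> p R \<epsilon> u0 u1 \<le> ereal (exp (C * \<epsilon> powr (- (p - 1)))))) \<and>
    (DIM('a) = 1 \<longrightarrow>
      (1 < p \<and> ereal p < p_crit1 \<mu> m \<longrightarrow>
        lifespan m \<mu> p R \<epsilon> u0 u1
          \<le> ereal (C * \<epsilon> powr (- (2 * (p - 1) / (2 - (\<mu> - m) * (p - 1)))))) \<and>
      (\<mu> > m \<and> p = 1 + 2 / (\<mu> - m) \<longrightarrow>
        lifespan m \<mu> p R \<epsilon> u0 u1 \<le> ereal (exp (C * \<epsilon> powr (- (p - 1))))))"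
proof -
  \<comment> \<open>One parameter governs all four cases: \<open>p_T\<close> equals
    \<open>1 + 2 / q\<close>, and in dimension 1 \<open>q\<close> is \<open>\<mu> - m\<close>, so
    the assumption on \<open>p\<close> always amounts to \<open>q * (p - 1) \<le> 2\<close>.\<close>
  define q where "q = (1 + m) * (N - 1) - m + \<mu>"
  have q': "q = (1 + m) * (real DIM('a) - 1) - m + \<mu>" by (simp add: q_def N)
  have pT: "p_T (N + \<mu> / (m + 1)) m = 1 + 2 / q"
  proof -
    have "(m + 1) * ((N - 1) + \<mu> / (m + 1)) = (m + 1) * (N - 1) + \<mu>"
      unfolding distrib_left using \<open>m \<ge> 0\<close> by simp
    then have "(m + 1) * (N + \<mu> / (m + 1) - 1) - m = q" by (simp add: q_def algebra_simps)
    then show ?thesis by (simp add: p_T_def)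
  qed
  have q2: "q > 0" if "DIM('a) \<ge> 2"
  proof -
    have "(1 + m) * 1 \<le> (1 + m) * (N - 1)" using that \<open>m \<ge> 0\<close> by (intro mult_left_mono) (auto simp: N)
    then show ?thesis using \<open>\<mu> \<ge> 0\<close> by (simp add: q_def)
  qed
  have q1: "q = \<mu> - m" if "DIM('a) = 1" using that by (simp add: q_def N)
  have lt2: "p < p_T (N + \<mu> / (m + 1)) m \<longleftrightarrow> q * (p - 1) < 2" "p = p_T (N + \<mu> / (m + 1)) m \<longleftrightarrow> q * (p - 1) = 2"
    if "DIM('a) \<ge> 2"
    using q2[OF that] unfolding pT by (auto simp: field_simps)
  \<comment> \<open>For \<open>\<mu> \<le> m\<close> the left side of the inequality in
    \<open>q\<close> is nonpositive, in accordance with the infinite threshold.\<close>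
  have lt1: "ereal p < p_crit1 \<mu> m \<longleftrightarrow> q * (p - 1) < 2" if "DIM('a) = 1"
  proof (cases "\<mu> > m")
    case True
    then show ?thesis by (simp add: p_crit1_def q1[OF that] field_simps)
  next
    case False
    then have "q * (p - 1) \<le> 0" using q1[OF that] \<open>p > 1\<close> by (intro mult_nonpos_nonneg) auto
    then show ?thesis using False by (simp add: p_crit1_def)
  qed
  have eq1: "\<mu> > m \<and> p = 1 + 2 / (\<mu> - m) \<Longrightarrow> q * (p - 1) = 2" if "DIM('a) = 1"
  proof -
    assume h: "\<mu> > m \<and> p = 1 + 2 / (\<mu> - m)"
    then have "q > 0" "p - 1 = 2 / q" using q1[OF that] by simp_all
    then show ?thesis by simp
  qed
  have "DIM('a) \<ge> 2 \<or> DIM('a) = 1" using DIM_positive[where 'a='a] by linarith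
  then have cases: "q * (p - 1) < 2 \<or> q * (p - 1) = 2"
    using lt2 lt1 eq1 assms(14,15) by fastforce
  note data = \<open>m \<ge> 0\<close> \<open>\<mu> \<ge> 0\<close> \<open>p > 1\<close> \<open>R > 1\<close> H1_L2[OF \<open>u0 \<in> H1\<close>] assms(7-13)
  from cases show ?thesis
  proof
    assume sub: "q * (p - 1) < 2"
    obtain C where C: "C > 0" "\<And>\<epsilon>. 0 < \<epsilon> \<and> \<epsilon> \<le> 1 \<Longrightarrow> lifespan m \<mu> p R \<epsilon> u0 u1
      \<le> ereal (C * \<epsilon> powr (- (2 * (p - 1) / (2 - q * (p - 1)))))"
      using lifespan_subcritical[OF data sub[unfolded q']] unfolding q'[symmetric] by blast
    have fin: "lifespan m \<mu> p R \<epsilon> u0 u1 < \<infinity>" if "0 < \<epsilon> \<and> \<epsilon> \<le> 1" for \<epsilon>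
      by (rule le_less_trans[OF C(2)[OF that]]) simp
    \<comment> \<open>The choice \<open>\<epsilon>0 = 1\<close> suffices; the critical branches of
      the conclusion contradict \<open>q * (p - 1) < 2\<close>.\<close>
    show ?thesis
      unfolding q_def[symmetric]
    proof (rule exI[of _ 1], rule conjI, simp, rule exI[of _ C], intro conjI allI impI)
    qed (use C fin lt2(2) eq1 q1 sub in auto)
  next
    assume crit: "q * (p - 1) = 2"
    obtain C where C: "C > 0" "\<And>\<epsilon>. 0 < \<epsilon> \<and> \<epsilon> \<le> 1 \<Longrightarrow>
        lifespan m \<mu> p R \<epsilon> u0 u1 \<le> ereal (exp (C * \<epsilon> powr (- (p - 1))))"
      using lifespan_critical[OF data crit[unfolded q']] by blast
    have fin: "lifespan m \<mu> p R \<epsilon> u0 u1 < \<infinity>" if "0 < \<epsilon> \<and> \<epsilon> \<le> 1" for \<epsilon>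
      by (rule le_less_trans[OF C(2)[OF that]]) simp
    show ?thesis
    proof (rule exI[of _ 1], rule conjI, simp, rule exI[of _ C], intro conjI allI impI)
    qed (use C fin lt2(1) lt1 crit in auto)
  qed
qed

end
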